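(* Let $M=({}_xM,{}_y\alpha_x)$ be a representation of a species $\mathfrak S=(R_x,{}_yA_x)$. Assume that, for each $x\in\mathsf C$, the $R_x$-module ${}_xM$ has finite length. Then $M$ is a direct sum of strongly indecomposable representations of $\mathfrak S$.
   Context: $\mathsf C$ is a fixed set of arbitrary cardinality; rings are associative and unital. A species $\mathfrak S=(R_x,{}_yA_x)$ consists of a ring $R_x$ for each $x\in\mathsf C$ and an $R_y$-$R_x$-bimodule ${}_yA_x$ for each $(y,x)\in\mathsf C^2$. An $\mathfrak S$-representation $({}_xM,{}_y\alpha_x)$ consists of a left $R_x$-module ${}_xM$ for each $x\in\mathsf C$ and a left $R_y$-linear map ${}_y\alpha_x\colon {}_yA_x\otimes_{R_x}{}_xM\to{}_yM$ for each $(y,x)\in\mathsf C^2$. A morphism $({}_xf)\colon({}_xM,{}_y\alpha_x)\to({}_xN,{}_y\beta_x)$ consists of $R_x$-linear maps ${}_xf\colon{}_xM\to{}_xN$ such that ${}_y\beta_x\circ(1_{{}_yA_x}\otimes{}_xf)={}_yf\circ{}_y\alpha_x$ for all $(y,x)$. $\mathrm{Rep}(\mathfrak S)$ is the category of $\mathfrak S$-representations. A representation is strongly indecomposable if its endomorphism ring in $\mathrm{Rep}(\mathfrak S)$ is local. *)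

theory Defs
  imports "HOL-Algebra.Module" "HOL-Algebra.Free_Abelian_Groups"
begin

section \<open>Modules and bimodules over non-commutative rings\<close>

text \<open>
  The library locale \<open>module\<close> is restricted to commutative rings. We reuse its record type, and
  the locale \<open>submodule\<close>, which does not depend on commutativity. The fields \<open>mult\<close> and \<open>one\<close>
  of a module record carry no meaning.
\<close>

locale left_module = R?: ring R + M?: abelian_group M for R (structure) and M (structure) +
  assumes smult_closed:
      "\<lbrakk>r \<in> carrier R; m \<in> carrier M\<rbrakk> \<Longrightarrow> r \<odot>\<^bsub>M\<^esub> m \<in> carrier M"
    and smult_l_distr:
      "\<lbrakk>r \<in> carrier R; s \<in> carrier R; m \<in> carrier M\<rbrakk> \<Longrightarrow>
        (r \<oplus> s) \<odot>\<^bsub>M\<^esub> m = r \<odot>\<^bsub>M\<^esub> m \<oplus>\<^bsub>M\<^esub> s \<odot>\<^bsub>M\<^esub> m"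
    and smult_r_distr:
      "\<lbrakk>r \<in> carrier R; m \<in> carrier M; n \<in> carrier M\<rbrakk> \<Longrightarrow>
        r \<odot>\<^bsub>M\<^esub> (m \<oplus>\<^bsub>M\<^esub> n) = r \<odot>\<^bsub>M\<^esub> m \<oplus>\<^bsub>M\<^esub> r \<odot>\<^bsub>M\<^esub> n"
    and smult_assoc:
      "\<lbrakk>r \<in> carrier R; s \<in> carrier R; m \<in> carrier M\<rbrakk> \<Longrightarrow>
        (r \<otimes> s) \<odot>\<^bsub>M\<^esub> m = r \<odot>\<^bsub>M\<^esub> (s \<odot>\<^bsub>M\<^esub> m)"
    and smult_one:
      "m \<in> carrier M \<Longrightarrow> \<one> \<odot>\<^bsub>M\<^esub> m = m"

definition left_module_hom ::
    "('r, 'x) ring_scheme \<Rightarrow> ('r, 'm, 'y) module_scheme \<Rightarrow> ('r, 'n, 'z) module_scheme \<Rightarrow> ('m \<Rightarrow> 'n) set"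
  where "left_module_hom R M N =
    {f \<in> hom (add_monoid M) (add_monoid N).
       \<forall>r\<in>carrier R. \<forall>m\<in>carrier M. f (r \<odot>\<^bsub>M\<^esub> m) = r \<odot>\<^bsub>N\<^esub> f m}"

text \<open>Finite length: existence of a composition series
  \<open>0 = L 0 \<subset> L 1 \<subset> \<dots> \<subset> L n = M\<close>, each term being a maximal proper submodule of the next.\<close>

definition finite_length :: "('r, 'x) ring_scheme \<Rightarrow> ('r, 'm, 'y) module_scheme \<Rightarrow> bool"
  where "finite_length R M \<longleftrightarrow>
    (\<exists>(n::nat) L. L 0 = {\<zero>\<^bsub>M\<^esub>} \<and> L n = carrier M \<and>
       (\<forall>i\<le>n. submodule (L i) R M) \<and>
       (\<forall>i<n. L i \<subset> L (Suc i) \<and>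
          (\<forall>K. submodule K R M \<and> L i \<subseteq> K \<and> K \<subseteq> L (Suc i) \<longrightarrow> K = L i \<or> K = L (Suc i))))"

record ('s, 'r, 'a) bimodule = "('s, 'a) module" +
  rsmult :: "['a, 'r] \<Rightarrow> 'a" (infixl \<open>\<star>\<index>\<close> 70)

locale bimodule = left_module S A + R: ring R for S and R and A (structure) +
  assumes rsmult_closed:
      "\<lbrakk>a \<in> carrier A; r \<in> carrier R\<rbrakk> \<Longrightarrow> a \<star> r \<in> carrier A"
    and rsmult_l_distr:
      "\<lbrakk>a \<in> carrier A; b \<in> carrier A; r \<in> carrier R\<rbrakk> \<Longrightarrow> (a \<oplus> b) \<star> r = a \<star> r \<oplus> b \<star> r"
    and rsmult_r_distr:
      "\<lbrakk>a \<in> carrier A; r \<in> carrier R; r' \<in> carrier R\<rbrakk> \<Longrightarrow>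
        a \<star> (r \<oplus>\<^bsub>R\<^esub> r') = a \<star> r \<oplus> a \<star> r'"
    and rsmult_assoc:
      "\<lbrakk>a \<in> carrier A; r \<in> carrier R; r' \<in> carrier R\<rbrakk> \<Longrightarrow>
        a \<star> (r \<otimes>\<^bsub>R\<^esub> r') = (a \<star> r) \<star> r'"
    and rsmult_one:
      "a \<in> carrier A \<Longrightarrow> a \<star> \<one>\<^bsub>R\<^esub> = a"
    and smult_rsmult:
      "\<lbrakk>s \<in> carrier S; a \<in> carrier A; r \<in> carrier R\<rbrakk> \<Longrightarrow> (s \<odot> a) \<star> r = s \<odot> (a \<star> r)"


section \<open>Tensor products\<close>

text \<open>
  \<open>A \<otimes>\<^sub>R M\<close> is the free abelian group on \<open>A \<times> M\<close> modulo the subgroup generated by the usual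
  relations. Its elements are thus cosets.
\<close>

definition tensor_rels ::
    "('r, 'x) ring_scheme \<Rightarrow> ('s, 'r, 'a, 'y) bimodule_scheme \<Rightarrow> ('r, 'm, 'z) module_scheme
      \<Rightarrow> ('a \<times> 'm \<Rightarrow>\<^sub>0 int) set"
  where "tensor_rels R A M = generate (free_Abelian_group (carrier A \<times> carrier M))
    ({frag_of (a \<oplus>\<^bsub>A\<^esub> b, m) - frag_of (a, m) - frag_of (b, m) | a b m.
        a \<in> carrier A \<and> b \<in> carrier A \<and> m \<in> carrier M} \<union>
     {frag_of (a, m \<oplus>\<^bsub>M\<^esub> n) - frag_of (a, m) - frag_of (a, n) | a m n.
        a \<in> carrier A \<and> m \<in> carrier M \<and> n \<in> carrier M} \<union>
     {frag_of (a \<star>\<^bsub>A\<^esub> r, m) - frag_of (a, r \<odot>\<^bsub>M\<^esub> m) | a r m.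
        a \<in> carrier A \<and> r \<in> carrier R \<and> m \<in> carrier M})"

text \<open>\<open>tensor_map R A M B N g f\<close> is the map \<open>g \<otimes> f\<close> from \<open>A \<otimes>\<^sub>R M\<close> to \<open>B \<otimes>\<^sub>R N\<close>. As it acts on
  cosets, it is written as a union over representatives; for \<open>g\<close> and \<open>f\<close> respecting the
  relations, all representatives contribute the same coset.\<close>

definition tensor_map ::
    "('r, 'x) ring_scheme
      \<Rightarrow> ('s, 'r, 'a, 'y) bimodule_scheme \<Rightarrow> ('r, 'm, 'z) module_scheme
      \<Rightarrow> ('t, 'r, 'b, 'u) bimodule_scheme \<Rightarrow> ('r, 'n, 'v) module_scheme
      \<Rightarrow> ('a \<Rightarrow> 'b) \<Rightarrow> ('m \<Rightarrow> 'n) \<Rightarrow> ('a \<times> 'm \<Rightarrow>\<^sub>0 int) set \<Rightarrow> ('b \<times> 'n \<Rightarrow>\<^sub>0 int) set"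
  where "tensor_map R A M B N g f X =
    (\<Union>z\<in>X. tensor_rels R B N #>\<^bsub>free_Abelian_group (carrier B \<times> carrier N)\<^esub>
              frag_extend (\<lambda>(a, m). frag_of (g a, f m)) z)"

text \<open>The left module structure on \<open>A \<otimes>\<^sub>R M\<close> is induced by the left action on the bimodule \<open>A\<close>.\<close>

definition tensor ::
    "('r, 'x) ring_scheme \<Rightarrow> ('s, 'r, 'a, 'y) bimodule_scheme \<Rightarrow> ('r, 'm, 'z) module_scheme
      \<Rightarrow> ('s, ('a \<times> 'm \<Rightarrow>\<^sub>0 int) set) module"
  where "tensor R A M = (let F = free_Abelian_group (carrier A \<times> carrier M); K = tensor_rels R A M in
    \<lparr>carrier = rcosets\<^bsub>F\<^esub> K, monoid.mult = undefined, one = undefined,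
     ring.zero = K, ring.add = (\<lambda>X Y. X <#>\<^bsub>F\<^esub> Y),
     smult = (\<lambda>s. tensor_map R A M A M (\<lambda>a. s \<odot>\<^bsub>A\<^esub> a) (\<lambda>m. m))\<rparr>)"


section \<open>Species and their representations\<close>

text \<open>\<open>arrow S y x\<close> is the bimodule \<open>\<^sub>yA\<^sub>x\<close>.\<close>

record ('c, 'r, 'a) species =
  vertices :: "'c set"
  vring :: "'c \<Rightarrow> 'r ring"
  arrow :: "'c \<Rightarrow> 'c \<Rightarrow> ('r, 'r, 'a) bimodule"

locale species =
  fixes S :: "('c, 'r, 'a) species"
  assumes ring_vring: "x \<in> vertices S \<Longrightarrow> ring (vring S x)"
    and bimodule_arrow: "\<lbrakk>x \<in> vertices S; y \<in> vertices S\<rbrakk> \<Longrightarrow>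
          bimodule (vring S y) (vring S x) (arrow S y x)"

text \<open>\<open>rmap M y x\<close> is the structure map from \<open>\<^sub>yA\<^sub>x \<otimes> \<^sub>xM\<close> to \<open>\<^sub>yM\<close>.\<close>

record ('c, 'r, 'a, 'm) rep =
  rmod :: "'c \<Rightarrow> ('r, 'm) module"
  rmap :: "'c \<Rightarrow> 'c \<Rightarrow> ('a \<times> 'm \<Rightarrow>\<^sub>0 int) set \<Rightarrow> 'm"

definition representation :: "('c, 'r, 'a) species \<Rightarrow> ('c, 'r, 'a, 'm) rep \<Rightarrow> bool"
  where "representation S M \<longleftrightarrow>
    (\<forall>x\<in>vertices S. left_module (vring S x) (rmod M x)) \<and>
    (\<forall>x\<in>vertices S. \<forall>y\<in>vertices S.
       rmap M y x \<in> left_module_hom (vring S y) (tensor (vring S x) (arrow S y x) (rmod M x)) (rmod M y))"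

text \<open>Morphisms are taken extensional, so that equality of morphisms is equality of functions.\<close>

definition rep_hom ::
    "('c, 'r, 'a) species \<Rightarrow> ('c, 'r, 'a, 'm) rep \<Rightarrow> ('c, 'r, 'a, 'n) rep \<Rightarrow> ('c \<Rightarrow> 'm \<Rightarrow> 'n) set"
  where "rep_hom S M N =
    {f \<in> (\<Pi>\<^sub>E x\<in>vertices S.
            left_module_hom (vring S x) (rmod M x) (rmod N x) \<inter> extensional (carrier (rmod M x))).
       \<forall>x\<in>vertices S. \<forall>y\<in>vertices S.
         \<forall>t\<in>carrier (tensor (vring S x) (arrow S y x) (rmod M x)).
           rmap N y x (tensor_map (vring S x) (arrow S y x) (rmod M x) (arrow S y x) (rmod N x)
             (\<lambda>a. a) (f x) t) = f y (rmap M y x t)}"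

definition rep_id :: "('c, 'r, 'a) species \<Rightarrow> ('c, 'r, 'a, 'm) rep \<Rightarrow> 'c \<Rightarrow> 'm \<Rightarrow> 'm"
  where "rep_id S M = (\<lambda>x\<in>vertices S. \<lambda>m\<in>carrier (rmod M x). m)"

text \<open>\<open>rep_comp S M g f\<close> is the composite \<open>g \<circ> f\<close>, where \<open>M\<close> is the domain of \<open>f\<close>.\<close>

definition rep_comp ::
    "('c, 'r, 'a) species \<Rightarrow> ('c, 'r, 'a, 'm) rep \<Rightarrow> ('c \<Rightarrow> 'n \<Rightarrow> 'p) \<Rightarrow> ('c \<Rightarrow> 'm \<Rightarrow> 'n) \<Rightarrow> 'c \<Rightarrow> 'm \<Rightarrow> 'p"
  where "rep_comp S M g f = (\<lambda>x\<in>vertices S. compose (carrier (rmod M x)) (g x) (f x))"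

definition rep_isomorphic ::
    "('c, 'r, 'a) species \<Rightarrow> ('c, 'r, 'a, 'm) rep \<Rightarrow> ('c, 'r, 'a, 'n) rep \<Rightarrow> bool"
  where "rep_isomorphic S M N \<longleftrightarrow>
    (\<exists>f\<in>rep_hom S M N. \<exists>g\<in>rep_hom S N M.
       rep_comp S M g f = rep_id S M \<and> rep_comp S N f g = rep_id S N)"

definition rep_End :: "('c, 'r, 'a) species \<Rightarrow> ('c, 'r, 'a, 'm) rep \<Rightarrow> ('c \<Rightarrow> 'm \<Rightarrow> 'm) ring"
  where "rep_End S M =
    \<lparr>carrier = rep_hom S M M, monoid.mult = rep_comp S M, one = rep_id S M,
     ring.zero = (\<lambda>x\<in>vertices S. \<lambda>m\<in>carrier (rmod M x). \<zero>\<^bsub>rmod M x\<^esub>),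
     ring.add = (\<lambda>f g. \<lambda>x\<in>vertices S. \<lambda>m\<in>carrier (rmod M x). f x m \<oplus>\<^bsub>rmod M x\<^esub> g x m)\<rparr>"

text \<open>A not necessarily commutative ring is local if it is nonzero and its non-units are closed
  under addition.\<close>

definition local_ring :: "('r, 'x) ring_scheme \<Rightarrow> bool"
  where "local_ring R \<longleftrightarrow> ring R \<and> \<one>\<^bsub>R\<^esub> \<noteq> \<zero>\<^bsub>R\<^esub> \<and>
    (\<forall>a\<in>carrier R. \<forall>b\<in>carrier R. a \<notin> Units R \<and> b \<notin> Units R \<longrightarrow> a \<oplus>\<^bsub>R\<^esub> b \<notin> Units R)"

definition strongly_indecomposable :: "('c, 'r, 'a) species \<Rightarrow> ('c, 'r, 'a, 'm) rep \<Rightarrow> bool"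
  where "strongly_indecomposable S M \<longleftrightarrow> local_ring (rep_End S M)"


section \<open>Direct sums\<close>

definition module_direct_sum :: "'i set \<Rightarrow> ('i \<Rightarrow> ('r, 'm) module) \<Rightarrow> ('r, 'i \<Rightarrow> 'm) module"
  where "module_direct_sum I N =
    \<lparr>carrier = {v \<in> \<Pi>\<^sub>E i\<in>I. carrier (N i). finite {i \<in> I. v i \<noteq> \<zero>\<^bsub>N i\<^esub>}},
     monoid.mult = undefined, one = undefined,
     ring.zero = (\<lambda>i\<in>I. \<zero>\<^bsub>N i\<^esub>), ring.add = (\<lambda>v w. \<lambda>i\<in>I. v i \<oplus>\<^bsub>N i\<^esub> w i),
     smult = (\<lambda>r v. \<lambda>i\<in>I. r \<odot>\<^bsub>N i\<^esub> v i)\<rparr>"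

text \<open>The direct sum is formed vertexwise; the \<open>i\<close>-th component of its structure map is the structure
  map of \<open>N i\<close> applied after tensoring with the \<open>i\<close>-th projection, which sends
  \<open>a \<otimes> (v\<^sub>j)\<^sub>j\<close> to \<open>a \<otimes> v\<^sub>i\<close>.\<close>

definition rep_direct_sum ::
    "('c, 'r, 'a) species \<Rightarrow> 'i set \<Rightarrow> ('i \<Rightarrow> ('c, 'r, 'a, 'm) rep) \<Rightarrow> ('c, 'r, 'a, 'i \<Rightarrow> 'm) rep"
  where "rep_direct_sum S I N =
    \<lparr>rmod = (\<lambda>x. module_direct_sum I (\<lambda>i. rmod (N i) x)),
     rmap = (\<lambda>y x t. \<lambda>i\<in>I. rmap (N i) y x
       (tensor_map (vring S x)
          (arrow S y x) (module_direct_sum I (\<lambda>i. rmod (N i) x))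
          (arrow S y x) (rmod (N i) x)
          (\<lambda>a. a) (\<lambda>v. v i) t))\<rparr>"

end

theory Submission
  imports Defs
begin

text \<open>
  A representation is a family of abelian groups with operators: the scalars and the maps
  \<open>a \<otimes> -\<close>. Choose, by Zorn's lemma, a maximal set \<open>B\<close> of pairwise commuting idempotent
  endomorphisms. At each vertex the images of its members satisfy the descending chain condition,
  so the module at that vertex is the direct sum of finitely many joint eigenspaces of \<open>B\<close>; the
  joint eigenspaces of the whole representation are thus the summands of a direct sum decomposition.
  Extended by zero, an idempotent endomorphism of a summand commutes with \<open>B\<close>, hence belongs to
  \<open>B\<close> and is 0 or 1 on the summand. Fitting's lemma, applied vertexwise to an endomorphism \<open>f\<close> of
  a summand, yields such an idempotent, so \<open>f\<close> is either bijective or locally nilpotent at all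
  vertices simultaneously; in the second case \<open>1 - f\<close> is bijective.
\<close>

section \<open>Families of abelian groups with operators\<close>

text \<open>The obstacle is that \<open>M\<close> as a whole satisfies no chain condition: with
  infinitely many vertices the lengths and the Fitting exponents may be unbounded, and successive
  refinements of a decomposition of \<open>M\<close> need not stop. The proof therefore separates
  global objects, the idempotent endomorphisms of all of \<open>M\<close>, from finiteness, which is
  available only at one vertex at a time. The Zorn argument needs no finiteness, because commutation
  concerns two elements only. Finiteness enters afterwards: at a given vertex the projection onto a
  joint eigenspace is some member of \<open>B\<close>, but which one depends on the vertex. The
  product of the members chosen at two vertices works at both, and an operator involves only two
  vertices, so the vertexwise projections form an endomorphism. Eigenspaces at different vertices
  have to be matched to form one summand; the common assignment of eigenvalues does this. Replacing
  a structure map by its single operators confines tensor products to a final translation, where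
  additive maps are compared on pure tensors.\<close>

locale op_family =
  fixes V :: "'c set" and G :: "'c \<Rightarrow> ('m, 'z) ring_scheme" and Op :: "'c \<Rightarrow> 'c \<Rightarrow> ('m \<Rightarrow> 'm) set"
  assumes abelian: "x \<in> V \<Longrightarrow> abelian_group (G x)"
    and op_closed: "\<lbrakk>x \<in> V; y \<in> V; h \<in> Op y x; m \<in> carrier (G x)\<rbrakk> \<Longrightarrow> h m \<in> carrier (G y)"
    and op_add: "\<lbrakk>x \<in> V; y \<in> V; h \<in> Op y x; m \<in> carrier (G x); n \<in> carrier (G x)\<rbrakk> \<Longrightarrow>
      h (m \<oplus>\<^bsub>G x\<^esub> n) = h m \<oplus>\<^bsub>G y\<^esub> h n"
begin

definition sub :: "('c \<Rightarrow> 'm set) \<Rightarrow> bool" where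
  "sub P \<longleftrightarrow>
    (\<forall>x\<in>V. P x \<subseteq> carrier (G x) \<and> \<zero>\<^bsub>G x\<^esub> \<in> P x \<and> (\<forall>m\<in>P x. \<forall>n\<in>P x. m \<ominus>\<^bsub>G x\<^esub> n \<in> P x)) \<and>
    (\<forall>x\<in>V. \<forall>y\<in>V. \<forall>h\<in>Op y x. \<forall>m\<in>P x. h m \<in> P y)"

text \<open>Values off \<open>P\<close> are unconstrained, so such maps are only ever compared on
  \<open>P\<close>. Extensional representatives are recovered by
  \<open>rep_hom_restrict\<close>.\<close>

definition endo :: "('c \<Rightarrow> 'm set) \<Rightarrow> ('c \<Rightarrow> 'm \<Rightarrow> 'm) \<Rightarrow> bool" where
  "endo P f \<longleftrightarrow>
    (\<forall>x\<in>V. \<forall>m\<in>P x. f x m \<in> P x) \<and>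
    (\<forall>x\<in>V. \<forall>m\<in>P x. \<forall>n\<in>P x. f x (m \<oplus>\<^bsub>G x\<^esub> n) = f x m \<oplus>\<^bsub>G x\<^esub> f x n) \<and>
    (\<forall>x\<in>V. \<forall>y\<in>V. \<forall>h\<in>Op y x. \<forall>m\<in>P x. f y (h m) = h (f x m))"

abbreviation whole :: "'c \<Rightarrow> 'm set" where
  "whole \<equiv> \<lambda>x. carrier (G x)"

lemma diff_closed:
  "\<lbrakk>x \<in> V; m \<in> carrier (G x); n \<in> carrier (G x)\<rbrakk> \<Longrightarrow> m \<ominus>\<^bsub>G x\<^esub> n \<in> carrier (G x)"
  using abelian_group.minus_closed abelian by metis

lemma add_closed:
  "\<lbrakk>x \<in> V; m \<in> carrier (G x); n \<in> carrier (G x)\<rbrakk> \<Longrightarrow> m \<oplus>\<^bsub>G x\<^esub> n \<in> carrier (G x)"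
  by (simp add: abelian abelian_groupE)

lemma zero_closed: "x \<in> V \<Longrightarrow> \<zero>\<^bsub>G x\<^esub> \<in> carrier (G x)"
  by (simp add: abelian abelian_groupE)

lemma diff_add_cancel:
  assumes "x \<in> V" "m \<in> carrier (G x)" "n \<in> carrier (G x)"
  shows "(m \<ominus>\<^bsub>G x\<^esub> n) \<oplus>\<^bsub>G x\<^esub> n = m"
proof -
  interpret abelian_group "G x" by (rule abelian) fact
  show ?thesis using assms by (simp add: minus_eq a_assoc l_neg)
qed

lemma add_diff_cancel:
  assumes "x \<in> V" "m \<in> carrier (G x)" "n \<in> carrier (G x)"
  shows "(m \<oplus>\<^bsub>G x\<^esub> n) \<ominus>\<^bsub>G x\<^esub> n = m"
proof -
  interpret abelian_group "G x" by (rule abelian) fact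
  show ?thesis using assms by (simp add: minus_eq a_assoc r_neg)
qed

lemma diff_zero:
  assumes "x \<in> V" "m \<in> carrier (G x)"
  shows "m \<ominus>\<^bsub>G x\<^esub> \<zero>\<^bsub>G x\<^esub> = m"
proof -
  interpret abelian_group "G x" by (rule abelian) fact
  show ?thesis using assms by (simp add: minus_eq)
qed

lemma diff_self:
  assumes "x \<in> V" "m \<in> carrier (G x)"
  shows "m \<ominus>\<^bsub>G x\<^esub> m = \<zero>\<^bsub>G x\<^esub>"
proof -
  interpret abelian_group "G x" by (rule abelian) fact
  show ?thesis using assms by (simp add: minus_eq r_neg)
qed

lemma diff_eq_iff:
  assumes "x \<in> V" "m \<in> carrier (G x)" "n \<in> carrier (G x)" "k \<in> carrier (G x)"
  shows "m \<ominus>\<^bsub>G x\<^esub> n = k \<longleftrightarrow> m = k \<oplus>\<^bsub>G x\<^esub> n"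
  using assms diff_add_cancel add_diff_cancel by metis

lemma diff_eq_zero_iff:
  assumes "x \<in> V" "m \<in> carrier (G x)" "n \<in> carrier (G x)"
  shows "m \<ominus>\<^bsub>G x\<^esub> n = \<zero>\<^bsub>G x\<^esub> \<longleftrightarrow> m = n"
  using assms diff_add_cancel[of x m n] diff_self zero_closed
  by (metis abelian abelian_groupE(5))

lemma diff_diff_swap:
  assumes "x \<in> V" "a \<in> carrier (G x)" "b \<in> carrier (G x)" "c \<in> carrier (G x)" "d \<in> carrier (G x)"
  shows "(a \<oplus>\<^bsub>G x\<^esub> b) \<ominus>\<^bsub>G x\<^esub> (c \<oplus>\<^bsub>G x\<^esub> d) = (a \<ominus>\<^bsub>G x\<^esub> c) \<oplus>\<^bsub>G x\<^esub> (b \<ominus>\<^bsub>G x\<^esub> d)"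
proof -
  interpret abelian_group "G x" by (rule abelian) fact
  show ?thesis using assms by (simp add: minus_eq a_ac minus_add)
qed

lemma diff_diff_left_cancel:
  assumes "x \<in> V" "a \<in> carrier (G x)" "b \<in> carrier (G x)" "c \<in> carrier (G x)"
  shows "(a \<ominus>\<^bsub>G x\<^esub> b) \<ominus>\<^bsub>G x\<^esub> (a \<ominus>\<^bsub>G x\<^esub> c) = c \<ominus>\<^bsub>G x\<^esub> b"
proof -
  interpret abelian_group "G x" by (rule abelian) fact
  have "(a \<ominus>\<^bsub>G x\<^esub> b) = (a \<ominus>\<^bsub>G x\<^esub> c) \<oplus>\<^bsub>G x\<^esub> (c \<ominus>\<^bsub>G x\<^esub> b)"
    using assms by (simp add: minus_eq a_assoc l_neg r_neg1)
  then show ?thesis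
    using assms by (metis a_comm add_diff_cancel minus_closed)
qed

lemma
  assumes "sub P" "x \<in> V"
  shows sub_carrier: "m \<in> P x \<Longrightarrow> m \<in> carrier (G x)"
    and sub_zero: "\<zero>\<^bsub>G x\<^esub> \<in> P x"
    and sub_diff: "\<lbrakk>m \<in> P x; n \<in> P x\<rbrakk> \<Longrightarrow> m \<ominus>\<^bsub>G x\<^esub> n \<in> P x"
    and sub_op: "\<lbrakk>y \<in> V; h \<in> Op y x; m \<in> P x\<rbrakk> \<Longrightarrow> h m \<in> P y"
  using assms unfolding sub_def by blast+

lemma sub_add:
  assumes "sub P" "x \<in> V" "m \<in> P x" "n \<in> P x"
  shows "m \<oplus>\<^bsub>G x\<^esub> n \<in> P x"
proof -
  interpret abelian_group "G x" by (rule abelian) fact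
  have "m \<ominus>\<^bsub>G x\<^esub> (\<zero>\<^bsub>G x\<^esub> \<ominus>\<^bsub>G x\<^esub> n) = m \<oplus>\<^bsub>G x\<^esub> n"
    using assms sub_carrier by (simp add: minus_eq)
  then show ?thesis using assms sub_zero sub_diff by metis
qed

lemma sub_whole: "sub whole"
  unfolding sub_def by (auto simp: zero_closed diff_closed op_closed)

lemma additive_zero:
  assumes "y \<in> V" "u \<in> carrier (G y)" "u = u \<oplus>\<^bsub>G y\<^esub> u"
  shows "u = \<zero>\<^bsub>G y\<^esub>"
proof -
  interpret abelian_group "G y" by (rule abelian) fact
  show ?thesis using assms by (metis add.l_cancel_one' )
qed

lemma op_zero:
  assumes "x \<in> V" "y \<in> V" "h \<in> Op y x" shows "h \<zero>\<^bsub>G x\<^esub> = \<zero>\<^bsub>G y\<^esub>"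
  using assms additive_zero op_add op_closed zero_closed
  by (metis abelian abelian_groupE(5))

lemma op_diff:
  assumes "x \<in> V" "y \<in> V" "h \<in> Op y x" "m \<in> carrier (G x)" "n \<in> carrier (G x)"
  shows "h (m \<ominus>\<^bsub>G x\<^esub> n) = h m \<ominus>\<^bsub>G y\<^esub> h n"
proof -
  have "h m = h (m \<ominus>\<^bsub>G x\<^esub> n) \<oplus>\<^bsub>G y\<^esub> h n"
    using assms op_add[of x y h "m \<ominus>\<^bsub>G x\<^esub> n" n] by (simp add: diff_add_cancel diff_closed)
  then show ?thesis
    using assms add_diff_cancel diff_closed op_closed by metis
qed

lemma
  assumes "endo P f" "x \<in> V"
  shows endo_closed: "m \<in> P x \<Longrightarrow> f x m \<in> P x"
    and endo_add: "\<lbrakk>m \<in> P x; n \<in> P x\<rbrakk> \<Longrightarrow> f x (m \<oplus>\<^bsub>G x\<^esub> n) = f x m \<oplus>\<^bsub>G x\<^esub> f x n"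
    and endo_op: "\<lbrakk>y \<in> V; h \<in> Op y x; m \<in> P x\<rbrakk> \<Longrightarrow> f y (h m) = h (f x m)"
  using assms unfolding endo_def by blast+

lemma endo_zero:
  assumes "sub P" "endo P f" "x \<in> V" shows "f x \<zero>\<^bsub>G x\<^esub> = \<zero>\<^bsub>G x\<^esub>"
  using assms additive_zero endo_add endo_closed sub_zero sub_carrier
  by (metis abelian abelian_groupE(5))

lemma endo_diff:
  assumes "sub P" "endo P f" "x \<in> V" "m \<in> P x" "n \<in> P x"
  shows "f x (m \<ominus>\<^bsub>G x\<^esub> n) = f x m \<ominus>\<^bsub>G x\<^esub> f x n"
proof -
  have "f x m = f x (m \<ominus>\<^bsub>G x\<^esub> n) \<oplus>\<^bsub>G x\<^esub> f x n"
    using assms by (metis diff_add_cancel endo_add sub_carrier sub_diff)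
  then show ?thesis
    using assms by (metis add_diff_cancel endo_closed sub_carrier sub_diff)
qed

lemma endo_id: "endo P (\<lambda>x m. m)"
  unfolding endo_def by simp

lemma endo_comp:
  assumes "sub P" "endo P f" "endo P g" shows "endo P (\<lambda>x m. f x (g x m))"
  using assms unfolding endo_def by (auto simp: sub_op)

lemma endo_pow:
  assumes "sub P" "endo P f" shows "endo P (\<lambda>x. f x ^^ n)"
proof (induction n)
  case 0
  then show ?case using endo_id by (simp add: endo_def)
next
  case (Suc n)
  then show ?case using endo_comp[OF assms Suc] by (simp add: o_def)
qed

lemma endo_diff_fun:
  assumes "sub P" "endo P f" "endo P g"
  shows "endo P (\<lambda>x m. f x m \<ominus>\<^bsub>G x\<^esub> g x m)"
  unfolding endo_def
proof (intro conjI ballI)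
  fix x m assume "x \<in> V" "m \<in> P x"
  then show "f x m \<ominus>\<^bsub>G x\<^esub> g x m \<in> P x"
    using assms endo_closed sub_diff by metis
next
  fix x m n assume "x \<in> V" "m \<in> P x" "n \<in> P x"
  then show "f x (m \<oplus>\<^bsub>G x\<^esub> n) \<ominus>\<^bsub>G x\<^esub> g x (m \<oplus>\<^bsub>G x\<^esub> n) =
      (f x m \<ominus>\<^bsub>G x\<^esub> g x m) \<oplus>\<^bsub>G x\<^esub> (f x n \<ominus>\<^bsub>G x\<^esub> g x n)"
    using assms by (simp add: endo_add diff_diff_swap endo_closed sub_carrier[OF \<open>sub P\<close>])
next
  fix x y h m assume "x \<in> V" "y \<in> V" "h \<in> Op y x" "m \<in> P x"
  then show "f y (h m) \<ominus>\<^bsub>G y\<^esub> g y (h m) = h (f x m \<ominus>\<^bsub>G x\<^esub> g x m)"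
    using assms by (simp add: endo_op op_diff endo_closed sub_carrier[OF \<open>sub P\<close>])
qed

lemma sub_kernel:
  assumes "sub P" "endo P f" shows "sub (\<lambda>x. {m \<in> P x. f x m = \<zero>\<^bsub>G x\<^esub>})"
  using assms unfolding sub_def[of "\<lambda>x. {m \<in> P x. f x m = \<zero>\<^bsub>G x\<^esub>}"]
  by (auto simp: sub_carrier sub_zero endo_zero sub_diff endo_diff endo_op op_zero sub_op
      diff_zero zero_closed)

lemma sub_image:
  assumes "sub P" "endo P f" shows "sub (\<lambda>x. f x ` P x)"
  unfolding sub_def[of "\<lambda>x. f x ` P x"]
proof (intro conjI ballI)
  fix x assume x: "x \<in> V"
  show "f x ` P x \<subseteq> carrier (G x)"
    using assms x endo_closed sub_carrier by blast
  show "\<zero>\<^bsub>G x\<^esub> \<in> f x ` P x"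
    using assms x by (metis endo_zero image_eqI sub_zero)
  fix m n assume "m \<in> f x ` P x" "n \<in> f x ` P x"
  then show "m \<ominus>\<^bsub>G x\<^esub> n \<in> f x ` P x"
    using assms x endo_diff sub_diff by (smt (verit) imageE image_eqI)
next
  fix x y h m assume "x \<in> V" "y \<in> V" "h \<in> Op y x" "m \<in> f x ` P x"
  then show "h m \<in> f y ` P y"
    using assms endo_op sub_op by (smt (verit) imageE image_eqI)
qed

text \<open>The \<open>Q\<close>-component of an element is unique because \<open>Q\<close> and
  \<open>R\<close> meet in zero. Sums and operator images of decompositions are again
  decompositions, so uniqueness turns an arbitrary choice of components into an
  endomorphism.\<close>

lemma complement_idempotent:
  assumes P: "sub P" and Q: "sub Q" and R: "sub R"
    and le: "\<And>x. x \<in> V \<Longrightarrow> Q x \<subseteq> P x" "\<And>x. x \<in> V \<Longrightarrow> R x \<subseteq> P x"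
    and disj: "\<And>x m. \<lbrakk>x \<in> V; m \<in> Q x; m \<in> R x\<rbrakk> \<Longrightarrow> m = \<zero>\<^bsub>G x\<^esub>"
    and span: "\<And>x m. \<lbrakk>x \<in> V; m \<in> P x\<rbrakk> \<Longrightarrow> \<exists>q\<in>Q x. m \<ominus>\<^bsub>G x\<^esub> q \<in> R x"
  obtains e where "endo P e"
    and "\<And>x m. \<lbrakk>x \<in> V; m \<in> P x\<rbrakk> \<Longrightarrow> e x m \<in> Q x"
    and "\<And>x m. \<lbrakk>x \<in> V; m \<in> Q x\<rbrakk> \<Longrightarrow> e x m = m"
    and "\<And>x m. \<lbrakk>x \<in> V; m \<in> R x\<rbrakk> \<Longrightarrow> e x m = \<zero>\<^bsub>G x\<^esub>"
proof -
  obtain e where e: "\<And>x m. \<lbrakk>x \<in> V; m \<in> P x\<rbrakk> \<Longrightarrow> e x m \<in> Q x \<and> m \<ominus>\<^bsub>G x\<^esub> e x m \<in> R x"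
    using span by metis
  \<comment> \<open>The difference of two candidates lies in \<open>Q\<close>, and it is also a
    difference of two remainders in \<open>R\<close>.\<close>
  have uniq: "q = e x m" if "x \<in> V" "m \<in> P x" "q \<in> Q x" "m \<ominus>\<^bsub>G x\<^esub> q \<in> R x" for x m q
  proof -
    have "(m \<ominus>\<^bsub>G x\<^esub> e x m) \<ominus>\<^bsub>G x\<^esub> (m \<ominus>\<^bsub>G x\<^esub> q) = q \<ominus>\<^bsub>G x\<^esub> e x m"
      using that e P Q sub_carrier by (intro diff_diff_left_cancel) blast+
    then have "q \<ominus>\<^bsub>G x\<^esub> e x m \<in> R x"
      using that e R sub_diff by metis
    moreover have "q \<ominus>\<^bsub>G x\<^esub> e x m \<in> Q x"
      using that e Q sub_diff by metis
    ultimately have "q \<ominus>\<^bsub>G x\<^esub> e x m = \<zero>\<^bsub>G x\<^esub>"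
      using disj that by blast
    then show ?thesis
      using that e Q sub_carrier diff_eq_zero_iff by metis
  qed
  show thesis
  proof (rule that[of e])
    show "endo P e"
      unfolding endo_def
    proof (intro conjI ballI)
      fix x m assume "x \<in> V" "m \<in> P x"
      then show "e x m \<in> P x" using e le by blast
    next
      fix x m n assume x: "x \<in> V" and m: "m \<in> P x" and n: "n \<in> P x"
      have "(m \<oplus>\<^bsub>G x\<^esub> n) \<ominus>\<^bsub>G x\<^esub> (e x m \<oplus>\<^bsub>G x\<^esub> e x n)
          = (m \<ominus>\<^bsub>G x\<^esub> e x m) \<oplus>\<^bsub>G x\<^esub> (n \<ominus>\<^bsub>G x\<^esub> e x n)"
        using x m n e P Q sub_carrier by (intro diff_diff_swap) blast+
      then have "(m \<oplus>\<^bsub>G x\<^esub> n) \<ominus>\<^bsub>G x\<^esub> (e x m \<oplus>\<^bsub>G x\<^esub> e x n) \<in> R x"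
        using x m n e R sub_add by metis
      then show "e x (m \<oplus>\<^bsub>G x\<^esub> n) = e x m \<oplus>\<^bsub>G x\<^esub> e x n"
        using uniq x m n e P Q sub_add by metis
    next
      fix x y h m assume x: "x \<in> V" and y: "y \<in> V" and h: "h \<in> Op y x" and m: "m \<in> P x"
      have "h m \<ominus>\<^bsub>G y\<^esub> h (e x m) = h (m \<ominus>\<^bsub>G x\<^esub> e x m)"
        using op_diff x y h m e P Q sub_carrier by metis
      then have "h m \<ominus>\<^bsub>G y\<^esub> h (e x m) \<in> R y"
        using x y h m e R sub_op by metis
      then show "e y (h m) = h (e x m)"
        using uniq x y h m e P Q sub_op by metis
    qed
    show "e x m \<in> Q x" if "x \<in> V" "m \<in> P x" for x m
      using e that by blast
    show "e x m = m" if "x \<in> V" "m \<in> Q x" for x m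
      using that uniq[of x m m] le Q R sub_zero sub_carrier diff_self by (metis subsetD)
    show "e x m = \<zero>\<^bsub>G x\<^esub>" if "x \<in> V" "m \<in> R x" for x m
      using that uniq[of x m "\<zero>\<^bsub>G x\<^esub>"] le Q R sub_zero sub_carrier diff_zero by (metis subsetD)
  qed
qed

end

section \<open>Fitting's lemma under vertexwise chain conditions\<close>

text \<open>\<open>len\<close> is any rank that increases strictly along subfamilies compared at one
  vertex. The bound \<open>bd\<close> varies with the vertex, so nothing is bounded uniformly in
  \<open>x\<close>.\<close>

locale finite_op_family = op_family V G Op
  for V :: "'c set" and G :: "'c \<Rightarrow> ('m, 'z) ring_scheme" and Op :: "'c \<Rightarrow> 'c \<Rightarrow> ('m \<Rightarrow> 'm) set" +
  fixes len :: "'c \<Rightarrow> 'm set \<Rightarrow> nat" and bd :: "'c \<Rightarrow> nat"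
  assumes len_mono: "\<lbrakk>x \<in> V; sub P; sub Q; P x \<subset> Q x\<rbrakk> \<Longrightarrow> len x (P x) < len x (Q x)"
    and len_le: "\<lbrakk>x \<in> V; sub P\<rbrakk> \<Longrightarrow> len x (P x) \<le> bd x"
begin

text \<open>Kernels of powers ascend and images descend; an exponent of maximal kernel length and
  one of minimal image length make both stationary at \<open>x\<close>. The exponent depends on
  \<open>x\<close>, hence the purely local conclusion.\<close>

lemma fitting:
  assumes P: "sub P" and f: "endo P f" and x: "x \<in> V"
  obtains n where "\<And>k m. \<lbrakk>m \<in> P x; (f x ^^ k) m = \<zero>\<^bsub>G x\<^esub>\<rbrakk> \<Longrightarrow> (f x ^^ n) m = \<zero>\<^bsub>G x\<^esub>"
    and "\<And>k m. m \<in> P x \<Longrightarrow> (f x ^^ n) m \<in> (f x ^^ k) ` P x"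
proof -
  define K where "K n = (\<lambda>x. {m \<in> P x. (f x ^^ n) m = \<zero>\<^bsub>G x\<^esub>})" for n :: nat
  define J where "J n = (\<lambda>x. (f x ^^ n) ` P x)" for n :: nat
  have K: "sub (K n)" for n
    unfolding K_def using sub_kernel[OF P endo_pow[OF P f]] .
  have J: "sub (J n)" for n
    unfolding J_def using sub_image[OF P endo_pow[OF P f]] .
  have Kmono: "K n x \<subseteq> K (n + k) x" for n k
    unfolding K_def using endo_zero[OF P endo_pow[OF P f] x, of k]
    by (auto simp: add.commute[of n] funpow_add)
  have Jmono: "J (n + k) x \<subseteq> J n x" for n k
    unfolding J_def using endo_closed[OF endo_pow[OF P f] x]
    by (auto simp: funpow_add)
  \<comment> \<open>A maximum exists because \<open>bd x\<close> bounds the lengths;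
    \<open>Suc\<close> only makes this bound strict. The minimum below exists by
    well-ordering.\<close>
  obtain a where a: "\<And>n. len x (K n x) \<le> len x (K a x)"
    using ex_has_greatest_nat[of "\<lambda>_. True" 0 "\<lambda>n. len x (K n x)" "Suc (bd x)"]
      len_le[OF x K] by (auto simp: less_Suc_eq_le)
  obtain b where b: "\<And>n. len x (J b x) \<le> len x (J n x)"
    using ex_has_least_nat[of "\<lambda>_. True" 0 "\<lambda>n. len x (J n x)"] by auto
  have Ka: "K k x \<subseteq> K a x" for k
  proof -
    have "K a x = K (a + k) x"
      using a[of "a + k"] Kmono[of a k] len_mono[OF x K K, of a "a + k"] by fastforce
    then show ?thesis using Kmono[of k a] by (simp add: add.commute)
  qed
  have Jb: "J b x \<subseteq> J k x" for k
  proof -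
    have "J b x = J (b + k) x"
      using b[of "b + k"] Jmono[of b k] len_mono[OF x J J, of "b + k" b] by fastforce
    then show ?thesis using Jmono[of k b] by (simp add: add.commute)
  qed
  show thesis
  \<comment> \<open>From \<open>a\<close> on the kernels are constant, from \<open>b\<close> on the
    images are; the sum serves both.\<close>
  proof (rule that[of "a + b"])
    show "(f x ^^ (a + b)) m = \<zero>\<^bsub>G x\<^esub>" if "m \<in> P x" "(f x ^^ k) m = \<zero>\<^bsub>G x\<^esub>" for k m
      using Ka[of k] Kmono[of a b] that unfolding K_def by auto
    show "(f x ^^ (a + b)) m \<in> (f x ^^ k) ` P x" if "m \<in> P x" for k m
      using Jb[of k] Jmono[of b a] that unfolding J_def
      by (simp add: add.commute[of b]) blast
  qed
qed

text \<open>A fixed point of a locally nilpotent map is zero, which gives injectivity. For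
  surjectivity the geometric series is unrolled by induction on the exponent killing
  \<open>m\<close>: if \<open>u\<close> is a preimage of \<open>f x m\<close>, then \<open>m\<close>
  plus \<open>u\<close> is a preimage of \<open>m\<close>. The exponent may depend on
  \<open>m\<close>.\<close>

lemma nilpotent_imp_bij:
  assumes P: "sub P" and f: "endo P f" and x: "x \<in> V"
    and nil: "\<And>m. m \<in> P x \<Longrightarrow> \<exists>n. (f x ^^ n) m = \<zero>\<^bsub>G x\<^esub>"
  shows "bij_betw (\<lambda>m. m \<ominus>\<^bsub>G x\<^esub> f x m) (P x) (P x)"
proof -
  note g = endo_diff_fun[OF P endo_id f]
  have inj: "m = \<zero>\<^bsub>G x\<^esub>" if m: "m \<in> P x" and "m \<ominus>\<^bsub>G x\<^esub> f x m = \<zero>\<^bsub>G x\<^esub>" for m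
  proof -
    have "f x m = m"
      using that P f x by (metis diff_eq_zero_iff endo_closed sub_carrier)
    then have "(f x ^^ n) m = m" for n
      by (induction n) auto
    then show ?thesis using nil m by metis
  qed
  have surj: "\<exists>u\<in>P x. u \<ominus>\<^bsub>G x\<^esub> f x u = m" if "m \<in> P x" "(f x ^^ n) m = \<zero>\<^bsub>G x\<^esub>" for m n
    using that
  proof (induction n arbitrary: m)
    case 0
    then show ?case using P f x by (intro bexI[of _ m]) (auto simp: endo_zero diff_zero zero_closed)
  next
    case (Suc n)
    have "f x m \<in> P x" using f x Suc.prems endo_closed by blast
    moreover have "(f x ^^ n) (f x m) = \<zero>\<^bsub>G x\<^esub>"
      using Suc.prems by (simp add: funpow_swap1)
    ultimately obtain u where u: "u \<in> P x" "u \<ominus>\<^bsub>G x\<^esub> f x u = f x m"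
      using Suc.IH by blast
    have c: "m \<in> carrier (G x)" "u \<in> carrier (G x)" "f x m \<in> carrier (G x)" "f x u \<in> carrier (G x)"
      using u Suc.prems P f x endo_closed sub_carrier by blast+
    have "(m \<oplus>\<^bsub>G x\<^esub> u) \<ominus>\<^bsub>G x\<^esub> f x (m \<oplus>\<^bsub>G x\<^esub> u) = (m \<ominus>\<^bsub>G x\<^esub> f x m) \<oplus>\<^bsub>G x\<^esub> (u \<ominus>\<^bsub>G x\<^esub> f x u)"
      using endo_add[OF f x] u Suc.prems c x by (simp add: diff_diff_swap)
    then show ?case
      using u c P x Suc.prems by (metis diff_add_cancel sub_add)
  qed
  show ?thesis
    unfolding bij_betw_def
  proof
    show "inj_on (\<lambda>m. m \<ominus>\<^bsub>G x\<^esub> f x m) (P x)"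
    proof (rule inj_onI)
      fix m n assume mn: "m \<in> P x" "n \<in> P x" "m \<ominus>\<^bsub>G x\<^esub> f x m = n \<ominus>\<^bsub>G x\<^esub> f x n"
      then have "(m \<ominus>\<^bsub>G x\<^esub> n) \<ominus>\<^bsub>G x\<^esub> f x (m \<ominus>\<^bsub>G x\<^esub> n) = \<zero>\<^bsub>G x\<^esub>"
        using endo_diff[OF P g x] P x f by (metis diff_self diff_closed endo_closed sub_carrier)
      then show "m = n"
        using inj mn P x by (metis diff_eq_zero_iff sub_carrier sub_diff)
    qed
    show "(\<lambda>m. m \<ominus>\<^bsub>G x\<^esub> f x m) ` P x = P x"
      using surj nil endo_closed[OF g x] by (fastforce simp: image_iff)
  qed
qed

text \<open>Fitting's decomposition yields the projection onto the stable image along the stable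
  kernel. As this is one endomorphism of the whole family, triviality of idempotents selects the
  same alternative at every vertex.\<close>

theorem indecomposable_imp_bij:
  assumes P: "sub P" and f: "endo P f"
    and triv: "\<And>q. \<lbrakk>endo P q; \<And>x m. \<lbrakk>x \<in> V; m \<in> P x\<rbrakk> \<Longrightarrow> q x (q x m) = q x m\<rbrakk> \<Longrightarrow>
      (\<forall>x\<in>V. \<forall>m\<in>P x. q x m = m) \<or> (\<forall>x\<in>V. \<forall>m\<in>P x. q x m = \<zero>\<^bsub>G x\<^esub>)"
  shows "(\<forall>x\<in>V. bij_betw (f x) (P x) (P x)) \<or>
    (\<forall>x\<in>V. bij_betw (\<lambda>m. m \<ominus>\<^bsub>G x\<^esub> f x m) (P x) (P x))"
proof -
  obtain n where n: "\<And>x k m. \<lbrakk>x \<in> V; m \<in> P x; (f x ^^ k) m = \<zero>\<^bsub>G x\<^esub>\<rbrakk> \<Longrightarrow> (f x ^^ n x) m = \<zero>\<^bsub>G x\<^esub>"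
    and n': "\<And>x k m. \<lbrakk>x \<in> V; m \<in> P x\<rbrakk> \<Longrightarrow> (f x ^^ n x) m \<in> (f x ^^ k) ` P x"
  proof -
    have "\<forall>x\<in>V. \<exists>n. (\<forall>k. \<forall>m\<in>P x. (f x ^^ k) m = \<zero>\<^bsub>G x\<^esub> \<longrightarrow> (f x ^^ n) m = \<zero>\<^bsub>G x\<^esub>) \<and>
        (\<forall>k. \<forall>m\<in>P x. (f x ^^ n) m \<in> (f x ^^ k) ` P x)"
      by (intro ballI, erule fitting[OF P f]) blast
    from bchoice[OF this] show thesis using that by blast
  qed
  \<comment> \<open>Quantifying over all exponents removes the dependence on \<open>n x\<close>, so
    that operators between vertices with different exponents preserve \<open>K\<close> and
    \<open>J\<close>.\<close>
  define K where "K = (\<lambda>x. {m \<in> P x. \<exists>k. (f x ^^ k) m = \<zero>\<^bsub>G x\<^esub>})"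
  define J where "J = (\<lambda>x. {m \<in> P x. \<forall>k. m \<in> (f x ^^ k) ` P x})"
  note fp = endo_pow[OF P f]
  \<comment> \<open>At a single vertex the sets are one kernel and one image, which makes them
    subgroups.\<close>
  have Kx: "K x = {m \<in> P x. (f x ^^ n x) m = \<zero>\<^bsub>G x\<^esub>}" if "x \<in> V" for x
    unfolding K_def by (intro Collect_cong conj_cong refl iffI) (erule exE, rule n[OF that], assumption+, rule exI)
  have Jx: "J x = (f x ^^ n x) ` P x" if "x \<in> V" for x
  proof
    show "J x \<subseteq> (f x ^^ n x) ` P x" unfolding J_def by blast
    show "(f x ^^ n x) ` P x \<subseteq> J x"
      unfolding J_def using n'[OF that] endo_closed[OF fp that] by (simp add: image_subset_iff)
  qed
  have K: "sub K"
    unfolding sub_def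
  proof (intro conjI ballI)
    fix x assume x: "x \<in> V"
    note S = sub_kernel[OF P fp[of "n x"]]
    show "K x \<subseteq> carrier (G x)" "\<zero>\<^bsub>G x\<^esub> \<in> K x"
      using sub_carrier[OF S x] sub_zero[OF S x] unfolding Kx[OF x] by blast+
    fix m m' assume "m \<in> K x" "m' \<in> K x"
    then show "m \<ominus>\<^bsub>G x\<^esub> m' \<in> K x"
      using sub_diff[OF S x] unfolding Kx[OF x] by blast
  next
    fix x y h m assume "x \<in> V" "y \<in> V" "h \<in> Op y x" "m \<in> K x"
    then show "h m \<in> K y"
      unfolding K_def using endo_op[OF fp] op_zero sub_op[OF P] by (smt (verit) mem_Collect_eq)
  qed
  have J: "sub J"
    unfolding sub_def
  proof (intro conjI ballI)
    fix x assume x: "x \<in> V"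
    note S = sub_image[OF P fp[of "n x"]]
    show "J x \<subseteq> carrier (G x)" "\<zero>\<^bsub>G x\<^esub> \<in> J x"
      using sub_carrier[OF S x] sub_zero[OF S x] unfolding Jx[OF x] by blast+
    fix m m' assume "m \<in> J x" "m' \<in> J x"
    then show "m \<ominus>\<^bsub>G x\<^esub> m' \<in> J x"
      using sub_diff[OF S x] unfolding Jx[OF x] by blast
  next
    fix x y h m assume "x \<in> V" "y \<in> V" "h \<in> Op y x" "m \<in> J x"
    then show "h m \<in> J y"
      unfolding J_def using sub_op[OF sub_image[OF P fp]] sub_op[OF P] by blast
  qed
  have disj: "m = \<zero>\<^bsub>G x\<^esub>" if x: "x \<in> V" and m: "m \<in> J x" "m \<in> K x" for x m
  proof -
    obtain u where u: "u \<in> P x" "m = (f x ^^ n x) u" using m Jx[OF x] by blast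
    then have "(f x ^^ (n x + n x)) u = \<zero>\<^bsub>G x\<^esub>"
      using m Kx[OF x] by (simp add: funpow_add)
    then show ?thesis using n[OF x u(1)] u by metis
  qed
  have span: "\<exists>q\<in>J x. m \<ominus>\<^bsub>G x\<^esub> q \<in> K x" if x: "x \<in> V" and m: "m \<in> P x" for x m
  proof -
    \<comment> \<open>The exponent is doubled so that the power of \<open>u\<close> to be subtracted
      from \<open>m\<close> again lies in the image of the \<open>n x\<close>-th power.\<close>
    obtain u where u: "u \<in> P x" "(f x ^^ n x) m = (f x ^^ (n x + n x)) u"
      using n'[OF x m, of "n x + n x"] by blast
    let ?q = "(f x ^^ n x) u"
    have q: "?q \<in> P x" using u endo_closed[OF fp x] by blast
    have "(f x ^^ n x) (m \<ominus>\<^bsub>G x\<^esub> ?q) = \<zero>\<^bsub>G x\<^esub>"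
      using u m x q P endo_diff[OF P fp x m q] endo_closed[OF fp x m]
      by (metis comp_apply diff_self funpow_add sub_carrier)
    then show ?thesis
      using u m x q P Kx[OF x] Jx[OF x] sub_diff by blast
  qed
  obtain q where q: "endo P q" "\<And>x m. \<lbrakk>x \<in> V; m \<in> P x\<rbrakk> \<Longrightarrow> q x m \<in> J x"
    "\<And>x m. \<lbrakk>x \<in> V; m \<in> J x\<rbrakk> \<Longrightarrow> q x m = m" "\<And>x m. \<lbrakk>x \<in> V; m \<in> K x\<rbrakk> \<Longrightarrow> q x m = \<zero>\<^bsub>G x\<^esub>"
    using complement_idempotent[OF P J K _ _ disj span] unfolding J_def K_def by blast
  \<comment> \<open>If \<open>q\<close> is the identity, \<open>K\<close> vanishes and
    \<open>J\<close> is all of \<open>P\<close>; if \<open>q\<close> is zero, \<open>J\<close>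
    vanishes and \<open>P\<close> is all of \<open>K\<close>.\<close>
  from triv[OF q(1)] q(2,3) consider "\<forall>x\<in>V. \<forall>m\<in>P x. q x m = m" | "\<forall>x\<in>V. \<forall>m\<in>P x. q x m = \<zero>\<^bsub>G x\<^esub>"
    by blast
  then show ?thesis
  proof cases
    case 1
    have "bij_betw (f x) (P x) (P x)" if x: "x \<in> V" for x
      unfolding bij_betw_def
    proof
      show "inj_on (f x) (P x)"
      proof (rule inj_onI)
        fix a b assume ab: "a \<in> P x" "b \<in> P x" "f x a = f x b"
        then have d: "a \<ominus>\<^bsub>G x\<^esub> b \<in> P x" using P sub_diff x by blast
        have "f x (a \<ominus>\<^bsub>G x\<^esub> b) = \<zero>\<^bsub>G x\<^esub>"
          using ab P f x by (metis diff_self endo_closed endo_diff sub_carrier)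
        then have "(f x ^^ 1) (a \<ominus>\<^bsub>G x\<^esub> b) = \<zero>\<^bsub>G x\<^esub>" by simp
        then have "a \<ominus>\<^bsub>G x\<^esub> b \<in> K x" unfolding K_def using d by blast
        then have "a \<ominus>\<^bsub>G x\<^esub> b = \<zero>\<^bsub>G x\<^esub>" using 1 q(4) d x by metis
        then show "a = b" using ab P x by (metis diff_eq_zero_iff sub_carrier)
      qed
      have "m \<in> f x ` P x" if "m \<in> P x" for m
      proof -
        have "m \<in> J x" using 1 q(2) that x by metis
        then have "m \<in> (f x ^^ 1) ` P x" unfolding J_def by blast
        then show ?thesis by simp
      qed
      then show "f x ` P x = P x" using f x endo_closed by blast
    qed
    then show ?thesis by blast
  next
    case 2
    have "\<exists>k. (f x ^^ k) m = \<zero>\<^bsub>G x\<^esub>" if x: "x \<in> V" and m: "m \<in> P x" for x m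
    proof -
      obtain u where u: "u \<in> J x" "m \<ominus>\<^bsub>G x\<^esub> u \<in> K x" using span x m by blast
      have "u = \<zero>\<^bsub>G x\<^esub>" using 2 q(3) u x unfolding J_def by fastforce
      then have "m \<in> K x" using u m x P by (simp add: diff_zero sub_carrier)
      then show ?thesis unfolding K_def by blast
    qed
    then show ?thesis using nilpotent_imp_bij[OF P f] by blast
  qed
qed

end

section \<open>Decomposition by a maximal set of commuting idempotents\<close>

context op_family
begin

definition idem :: "('c \<Rightarrow> 'm \<Rightarrow> 'm) \<Rightarrow> bool" where
  "idem e \<longleftrightarrow> endo whole e \<and> (\<forall>x\<in>V. \<forall>m\<in>carrier (G x). e x (e x m) = e x m)"

definition commutes :: "('c \<Rightarrow> 'm \<Rightarrow> 'm) \<Rightarrow> ('c \<Rightarrow> 'm \<Rightarrow> 'm) \<Rightarrow> bool" where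
  "commutes e f \<longleftrightarrow> (\<forall>x\<in>V. \<forall>m\<in>carrier (G x). e x (f x m) = f x (e x m))"

lemma commutes_sym: "commutes e f \<Longrightarrow> commutes f e"
  unfolding commutes_def by simp

text \<open>Two members of the union of a chain lie in a common member of the chain, so commutation
  survives unions. Every map commutes with itself, hence maximality only asks for commutation with
  \<open>B\<close>.\<close>

lemma maximal_commuting_idempotents:
  obtains B where "\<And>e. e \<in> B \<Longrightarrow> idem e" and "\<And>e f. \<lbrakk>e \<in> B; f \<in> B\<rbrakk> \<Longrightarrow> commutes e f"
    and "\<And>e. \<lbrakk>idem e; \<And>f. f \<in> B \<Longrightarrow> commutes e f\<rbrakk> \<Longrightarrow> e \<in> B"
proof -
  define \<A> where "\<A> = {B. (\<forall>e\<in>B. idem e) \<and> (\<forall>e\<in>B. \<forall>f\<in>B. commutes e f)}"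
  have "\<Union>C \<in> \<A>" if C: "subset.chain \<A> C" for C
  proof -
    have "commutes e f" if "e \<in> X" "X \<in> C" "f \<in> Y" "Y \<in> C" for e f X Y
    proof -
      have "X \<in> \<A>" "Y \<in> \<A>" "X \<subseteq> Y \<or> Y \<subseteq> X"
        using C that by (auto simp: subset_chain_def)
      then show ?thesis using that unfolding \<A>_def by blast
    qed
    moreover have "idem e" if "e \<in> X" "X \<in> C" for e X
      using that C unfolding \<A>_def by (auto simp: subset_chain_def)
    ultimately show ?thesis unfolding \<A>_def by blast
  qed
  from subset_Zorn'[OF this] obtain B where B: "B \<in> \<A>" and max: "\<And>X. \<lbrakk>X \<in> \<A>; B \<subseteq> X\<rbrakk> \<Longrightarrow> X = B"
    by blast
  show thesis
  proof (rule that[of B])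
    fix e assume e: "idem e" "\<And>f. f \<in> B \<Longrightarrow> commutes e f"
    have "commutes e e" by (simp add: commutes_def)
    then have "insert e B \<in> \<A>"
      using e B commutes_sym unfolding \<A>_def by blast
    then show "e \<in> B" using max by blast
  qed (use B in \<open>auto simp: \<A>_def\<close>)
qed

end

locale maximal_idempotents = finite_op_family V G Op len bd
  for V :: "'c set" and G :: "'c \<Rightarrow> ('m, 'z) ring_scheme" and Op len bd +
  fixes B :: "('c \<Rightarrow> 'm \<Rightarrow> 'm) set"
  assumes B_idem: "e \<in> B \<Longrightarrow> idem e"
    and B_commutes: "\<lbrakk>e \<in> B; f \<in> B\<rbrakk> \<Longrightarrow> commutes e f"
    and B_maximal: "\<lbrakk>idem e; \<And>f. f \<in> B \<Longrightarrow> commutes e f\<rbrakk> \<Longrightarrow> e \<in> B"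
begin

lemma B_endo: "e \<in> B \<Longrightarrow> endo whole e"
  using B_idem idem_def by blast

lemma
  assumes "e \<in> B" "x \<in> V" "m \<in> carrier (G x)"
  shows B_closed: "e x m \<in> carrier (G x)"
    and B_fix: "e x (e x m) = e x m"
    and B_comm: "f \<in> B \<Longrightarrow> e x (f x m) = f x (e x m)"
  using assms endo_closed[OF B_endo] B_idem B_commutes unfolding idem_def commutes_def by blast+

section \<open>Boolean operations on the maximal set\<close>

lemma B_id: "(\<lambda>x m. m) \<in> B"
  by (rule B_maximal) (simp_all add: idem_def commutes_def endo_id)

text \<open>A product of members is idempotent because they commute, and it commutes with all that
  its factors commute with; maximality then puts it into \<open>B\<close>. With the complements
  below, \<open>B\<close> is a Boolean algebra up to equality on the carriers, and its two-valued
  assignments are the characters.\<close>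

lemma B_mult:
  assumes "e \<in> B" "f \<in> B" shows "(\<lambda>x m. e x (f x m)) \<in> B"
proof (rule B_maximal)
  show "idem (\<lambda>x m. e x (f x m))"
    unfolding idem_def using assms endo_comp[OF sub_whole] B_endo
    by (auto simp: B_comm[of e _ _ f] B_fix B_closed)
  show "commutes (\<lambda>x m. e x (f x m)) g" if "g \<in> B" for g
    unfolding commutes_def using assms that
    by (auto simp: B_comm[of f _ _ g] B_comm[of e _ _ g] B_closed)
qed

abbreviation compl :: "('c \<Rightarrow> 'm \<Rightarrow> 'm) \<Rightarrow> 'c \<Rightarrow> 'm \<Rightarrow> 'm" where
  "compl e \<equiv> \<lambda>x m. m \<ominus>\<^bsub>G x\<^esub> e x m"

lemma B_compl:
  assumes "e \<in> B" shows "compl e \<in> B"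
proof (rule B_maximal)
  show "idem (compl e)"
    unfolding idem_def using assms endo_diff_fun[OF sub_whole endo_id B_endo]
    by (auto simp: endo_diff[OF sub_whole B_endo] B_fix B_closed diff_self diff_zero diff_closed)
  show "commutes (compl e) f" if "f \<in> B" for f
    unfolding commutes_def using assms that
    by (auto simp: endo_diff[OF sub_whole B_endo] B_closed B_comm[of e _ _ f])
qed

text \<open>A character assigns to the idempotents in \<open>B\<close> the values 1 (on \<open>U\<close>) and 0 (off \<open>U\<close>);
  its piece is the joint eigenspace.\<close>

definition character :: "('c \<Rightarrow> 'm \<Rightarrow> 'm) set \<Rightarrow> bool" where
  "character U \<longleftrightarrow> U \<subseteq> B \<and> (\<forall>e\<in>U. \<forall>f\<in>U. (\<lambda>x m. e x (f x m)) \<in> U) \<and>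
    (\<forall>e\<in>B. (e \<in> U) \<noteq> (compl e \<in> U))"

definition piece :: "('c \<Rightarrow> 'm \<Rightarrow> 'm) set \<Rightarrow> 'c \<Rightarrow> 'm set" where
  "piece U x = {m \<in> carrier (G x). \<forall>e\<in>U. e x m = m}"

lemma character_B: "\<lbrakk>character U; e \<in> U\<rbrakk> \<Longrightarrow> e \<in> B"
  unfolding character_def by blast

lemma character_mult: "\<lbrakk>character U; e \<in> U; f \<in> U\<rbrakk> \<Longrightarrow> (\<lambda>x m. e x (f x m)) \<in> U"
  unfolding character_def by blast

lemma character_compl: "\<lbrakk>character U; e \<in> B; e \<notin> U\<rbrakk> \<Longrightarrow> compl e \<in> U"
  unfolding character_def by blast

lemma piece_carrier: "m \<in> piece U x \<Longrightarrow> m \<in> carrier (G x)"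
  unfolding piece_def by blast

lemma piece_fix: "\<lbrakk>m \<in> piece U x; e \<in> U\<rbrakk> \<Longrightarrow> e x m = m"
  unfolding piece_def by blast

lemma sub_piece:
  assumes "character U" shows "sub (piece U)"
proof -
  have e: "endo whole e" if "e \<in> U" for e
    using character_B[OF assms that] B_endo by blast
  show ?thesis
    unfolding sub_def
  proof (intro conjI ballI)
    fix x assume x: "x \<in> V"
    show "piece U x \<subseteq> carrier (G x)" using piece_carrier by blast
    show "\<zero>\<^bsub>G x\<^esub> \<in> piece U x"
      unfolding piece_def using endo_zero[OF sub_whole e x] zero_closed[OF x] by blast
    fix m n assume m: "m \<in> piece U x" and n: "n \<in> piece U x"
    show "m \<ominus>\<^bsub>G x\<^esub> n \<in> piece U x"
      unfolding piece_def[of U x]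
    proof (intro CollectI conjI ballI)
      show "m \<ominus>\<^bsub>G x\<^esub> n \<in> carrier (G x)"
        using m n piece_carrier diff_closed x by blast
      show "f x (m \<ominus>\<^bsub>G x\<^esub> n) = m \<ominus>\<^bsub>G x\<^esub> n" if "f \<in> U" for f
        using endo_diff[OF sub_whole e[OF that] x, of m n] m n piece_carrier piece_fix[OF _ that]
        by simp
    qed
  next
    fix x y h m assume x: "x \<in> V" and y: "y \<in> V" and h: "h \<in> Op y x" and m: "m \<in> piece U x"
    have mc: "m \<in> carrier (G x)" using m piece_carrier by blast
    have "f y (h m) = h m" if "f \<in> U" for f
      using endo_op[OF e[OF that] x y h mc] piece_fix[OF m that] by simp
    then show "h m \<in> piece U y"
      unfolding piece_def[of U y] using op_closed[OF x y h mc] by blast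
  qed
qed

text \<open>The complement of \<open>e\<close> lies in \<open>U\<close> and fixes \<open>m\<close>,
  so \<open>e\<close> kills \<open>m\<close>. The eigenvalue 0 is thus enforced although
  \<open>piece\<close> mentions only fixed elements.\<close>

lemma piece_kill:
  assumes "character U" "e \<in> B" "e \<notin> U" "x \<in> V" "m \<in> piece U x"
  shows "e x m = \<zero>\<^bsub>G x\<^esub>"
proof -
  have m: "m \<in> carrier (G x)" using assms piece_carrier by blast
  have "m \<ominus>\<^bsub>G x\<^esub> e x m = m"
    using piece_fix[OF assms(5) character_compl[OF assms(1-3)]] .
  then have "m \<ominus>\<^bsub>G x\<^esub> (m \<ominus>\<^bsub>G x\<^esub> e x m) = \<zero>\<^bsub>G x\<^esub>"
    using m assms by (simp add: diff_self)
  moreover have "m \<ominus>\<^bsub>G x\<^esub> (m \<ominus>\<^bsub>G x\<^esub> e x m) = e x m"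
    using diff_diff_left_cancel[of x m "\<zero>\<^bsub>G x\<^esub>" "e x m"] m assms
    by (simp add: zero_closed B_closed diff_zero)
  ultimately show ?thesis by simp
qed

section \<open>Vertexwise projections onto the joint eigenspaces\<close>

text \<open>Take \<open>e\<close> in \<open>U\<close> whose image at \<open>x\<close> has minimal
  length. For \<open>f\<close> in \<open>U\<close> the product of \<open>e\<close> and
  \<open>f\<close> is in \<open>U\<close> and its image lies in that of \<open>e\<close>, so the two
  images agree; hence \<open>f\<close> fixes the image of \<open>e\<close>. The minimal
  \<open>e\<close> depends on \<open>x\<close>.\<close>

lemma piece_attained:
  assumes U: "character U" and x: "x \<in> V"
  shows "\<exists>e\<in>U. \<forall>m\<in>carrier (G x). e x m \<in> piece U x"
proof -
  have "\<exists>e. e \<in> U" using U B_id unfolding character_def by blast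
  then obtain e where e: "e \<in> U"
    and min: "\<And>f. f \<in> U \<Longrightarrow> len x (e x ` carrier (G x)) \<le> len x (f x ` carrier (G x))"
    using ex_has_least_nat[of "\<lambda>e. e \<in> U" _ "\<lambda>e. len x (e x ` carrier (G x))"] by blast
  have eB: "e \<in> B" using character_B U e by blast
  have "f x (e x m) = e x m" if f: "f \<in> U" and m: "m \<in> carrier (G x)" for f m
  proof -
    have fB: "f \<in> B" using character_B U f by blast
    have ef: "(\<lambda>x m. e x (f x m)) \<in> U" using U e f character_mult by blast
    have le: "(\<lambda>m. e x (f x m)) ` carrier (G x) \<subseteq> e x ` carrier (G x)"
      using B_closed[OF fB x] by blast
    have "sub (\<lambda>x. (\<lambda>m. e x (f x m)) ` carrier (G x))" "sub (\<lambda>x. e x ` carrier (G x))"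
      using sub_image[OF sub_whole B_endo[OF character_B[OF U ef]]]
        sub_image[OF sub_whole B_endo[OF eB]] by blast+
    from len_mono[OF x this] have "(\<lambda>m. e x (f x m)) ` carrier (G x) = e x ` carrier (G x)"
      using min[OF ef] le by fastforce
    then obtain u where u: "u \<in> carrier (G x)" "e x m = e x (f x u)"
      using m by blast
    then show ?thesis
      using B_comm[OF eB x u(1) fB] B_fix[OF fB x] B_closed[OF eB x] by metis
  qed
  then have "\<forall>m\<in>carrier (G x). e x m \<in> piece U x"
    unfolding piece_def using B_closed[OF eB x] by blast
  then show ?thesis using e by blast
qed

text \<open>The choice is made separately at each vertex, so \<open>proj U\<close> is not by
  construction a member of \<open>B\<close>, nor even an endomorphism.\<close>

definition proj :: "('c \<Rightarrow> 'm \<Rightarrow> 'm) set \<Rightarrow> 'c \<Rightarrow> 'm \<Rightarrow> 'm" where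
  "proj U x = (SOME e. e \<in> U \<and> (\<forall>m\<in>carrier (G x). e x m \<in> piece U x)) x"

lemma proj_in_character:
  assumes "character U" "x \<in> V"
  obtains e where "e \<in> U" "\<And>m. m \<in> carrier (G x) \<Longrightarrow> e x m \<in> piece U x" "proj U x = e x"
  using someI_ex[OF piece_attained[OF assms, unfolded Bex_def]] unfolding proj_def by blast

lemma
  assumes "character U" "x \<in> V"
  shows proj_piece: "m \<in> carrier (G x) \<Longrightarrow> proj U x m \<in> piece U x"
    and proj_fix: "m \<in> piece U x \<Longrightarrow> proj U x m = m"
    and proj_comm: "\<lbrakk>f \<in> B; m \<in> carrier (G x)\<rbrakk> \<Longrightarrow> proj U x (f x m) = f x (proj U x m)"
    and proj_add: "\<lbrakk>m \<in> carrier (G x); n \<in> carrier (G x)\<rbrakk> \<Longrightarrow>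
      proj U x (m \<oplus>\<^bsub>G x\<^esub> n) = proj U x m \<oplus>\<^bsub>G x\<^esub> proj U x n"
    and proj_zero: "proj U x \<zero>\<^bsub>G x\<^esub> = \<zero>\<^bsub>G x\<^esub>"
proof -
  obtain e where e: "e \<in> U" "\<And>m. m \<in> carrier (G x) \<Longrightarrow> e x m \<in> piece U x" and p: "proj U x = e x"
    using proj_in_character[OF assms] by blast
  have eB: "e \<in> B" using e character_B assms by blast
  show "m \<in> carrier (G x) \<Longrightarrow> proj U x m \<in> piece U x"
    using p e by simp
  show "m \<in> piece U x \<Longrightarrow> proj U x m = m"
    using p e piece_fix by simp
  show "\<lbrakk>f \<in> B; m \<in> carrier (G x)\<rbrakk> \<Longrightarrow> proj U x (f x m) = f x (proj U x m)"
    using p B_comm[OF eB assms(2)] by simp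
  show "\<lbrakk>m \<in> carrier (G x); n \<in> carrier (G x)\<rbrakk> \<Longrightarrow>
      proj U x (m \<oplus>\<^bsub>G x\<^esub> n) = proj U x m \<oplus>\<^bsub>G x\<^esub> proj U x n"
    using p endo_add[OF B_endo[OF eB] assms(2)] by simp
  show "proj U x \<zero>\<^bsub>G x\<^esub> = \<zero>\<^bsub>G x\<^esub>"
    using p endo_zero[OF sub_whole B_endo[OF eB] assms(2)] by simp
qed

text \<open>Commuting idempotents with the same image are equal: each fixes the image of the other.
  This makes the choice in \<open>proj\<close> immaterial.\<close>

lemma proj_eqI:
  assumes "character U" "x \<in> V" "e \<in> U" "\<And>m. m \<in> carrier (G x) \<Longrightarrow> e x m \<in> piece U x"
    and m: "m \<in> carrier (G x)"
  shows "e x m = proj U x m"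
proof -
  have "proj U x (e x m) = e x m"
    using assms by (simp add: proj_fix)
  moreover have "e x (proj U x m) = proj U x m"
    using assms piece_fix proj_piece by blast
  ultimately show ?thesis
    using assms proj_comm character_B by metis
qed

text \<open>The product of members of \<open>U\<close> chosen for \<open>x\<close> and for
  \<open>y\<close> projects onto the piece at both vertices. As it belongs to \<open>B\<close>, it
  commutes with the operators from \<open>x\<close> to \<open>y\<close>.\<close>

lemma endo_proj:
  assumes U: "character U" shows "endo whole (proj U)"
  unfolding endo_def
proof (intro conjI ballI)
  fix x y h m assume x: "x \<in> V" and y: "y \<in> V" and h: "h \<in> Op y x" and m: "m \<in> carrier (G x)"
  obtain e where e: "e \<in> U" "\<And>m. m \<in> carrier (G x) \<Longrightarrow> e x m \<in> piece U x"
    using proj_in_character[OF U x] by blast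
  obtain f where f: "f \<in> U" "\<And>m. m \<in> carrier (G y) \<Longrightarrow> f y m \<in> piece U y"
    using proj_in_character[OF U y] by blast
  have B: "e \<in> B" "f \<in> B" using U e f character_B by blast+
  let ?g = "\<lambda>x m. e x (f x m)"
  have g: "?g \<in> U" using U e f character_mult by blast
  have "?g x m = proj U x m"
    using proj_eqI[OF U x g _ m] e(2) B_closed[OF B(2) x] by blast
  moreover have "?g y (h m) = proj U y (h m)"
    using proj_eqI[OF U y g _ op_closed[OF x y h m]] f(2) B_closed[OF B(1) y] B_comm[OF B(1) y _ B(2)]
    by simp
  moreover have "?g y (h m) = h (?g x m)"
    using endo_op[OF B_endo[OF character_B[OF U g]] x y h m] .
  ultimately show "proj U y (h m) = h (proj U x m)" by simp
qed (use U proj_piece piece_carrier proj_add in blast)+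

text \<open>A member of \<open>B\<close> on which the two characters differ acts as 1 on one piece
  and as 0 on the other, and the projection commutes with it.\<close>

lemma proj_orthogonal:
  assumes U: "character U" and W: "character W" and ne: "U \<noteq> W" and x: "x \<in> V" and m: "m \<in> piece W x"
  shows "proj U x m = \<zero>\<^bsub>G x\<^esub>"
proof -
  have mc: "m \<in> carrier (G x)" using m piece_carrier by blast
  from ne consider f where "f \<in> U" "f \<notin> W" | f where "f \<in> W" "f \<notin> U" by blast
  then show ?thesis
  proof cases
    case 1
    have f: "f \<in> B" using 1 U character_B by blast
    have "f x (proj U x m) = proj U x m"
      using piece_fix[OF proj_piece[OF U x mc] 1(1)] .
    moreover have "f x m = \<zero>\<^bsub>G x\<^esub>"
      using piece_kill[OF W f 1(2) x m] .
    ultimately show ?thesis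
      using proj_comm[OF U x f mc] proj_zero[OF U x] by simp
  next
    case 2
    have f: "f \<in> B" using 2 W character_B by blast
    show ?thesis
      using proj_comm[OF U x f mc] piece_kill[OF U f 2(2) x proj_piece[OF U x mc]]
        piece_fix[OF m 2(1)] by simp
  qed
qed

text \<open>Induction on the length of the image of \<open>e\<close>. If some \<open>f\<close> in
  \<open>B\<close> is neither zero nor the identity on that image, then \<open>f\<close> and its
  complement cut it into two shorter images and \<open>m\<close> into two summands. Otherwise all of
  \<open>B\<close> acts on the image by 0 and 1, and a nonzero \<open>m\<close> lies in a single
  piece. The bound on lengths thus replaces finiteness of the set of characters.\<close>

lemma proj_finite_separating:
  assumes "e \<in> B" "x \<in> V" "m \<in> e x ` carrier (G x)"
  shows "finite {U. character U \<and> proj U x m \<noteq> \<zero>\<^bsub>G x\<^esub>} \<and>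
    ((\<forall>U. character U \<longrightarrow> proj U x m = \<zero>\<^bsub>G x\<^esub>) \<longrightarrow> m = \<zero>\<^bsub>G x\<^esub>)"
  using assms
proof (induction "len x (e x ` carrier (G x))" arbitrary: e m rule: less_induct)
  case less
  note e = less.prems(1) and x = less.prems(2)
  have mc: "m \<in> carrier (G x)" using less.prems B_closed by blast
  have image: "sub (\<lambda>x. f x ` carrier (G x))" if "f \<in> B" for f
    using sub_image[OF sub_whole B_endo[OF that]] .
  show ?case
  proof (cases "\<exists>f\<in>B. (\<exists>u\<in>carrier (G x). f x (e x u) \<noteq> \<zero>\<^bsub>G x\<^esub>) \<and>
      (\<exists>u\<in>carrier (G x). f x (e x u) \<noteq> e x u)")
    case True
    then obtain f u v where f: "f \<in> B" and u: "u \<in> carrier (G x)" "f x (e x u) \<noteq> \<zero>\<^bsub>G x\<^esub>"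
      and v: "v \<in> carrier (G x)" "f x (e x v) \<noteq> e x v" by blast
    \<comment> \<open>Stated for a general \<open>g\<close>, to be used for \<open>f\<close> and for
      its complement. The witness \<open>w\<close> makes the inclusion of images strict:
      \<open>g\<close> fixes its own image but moves \<open>e x w\<close>.\<close>
    have step: "finite {U. character U \<and> proj U x (g x m) \<noteq> \<zero>\<^bsub>G x\<^esub>} \<and>
        ((\<forall>U. character U \<longrightarrow> proj U x (g x m) = \<zero>\<^bsub>G x\<^esub>) \<longrightarrow> g x m = \<zero>\<^bsub>G x\<^esub>)"
      if g: "g \<in> B" and w: "w \<in> carrier (G x)" "g x (e x w) \<noteq> e x w" for g w
    proof -
      let ?h = "\<lambda>x m. g x (e x m)"
      have h: "?h \<in> B" using B_mult g e by blast
      have "?h x ` carrier (G x) \<subseteq> e x ` carrier (G x)"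
        using B_comm[OF g x _ e] B_closed[OF g x] by auto
      moreover have "e x w \<notin> ?h x ` carrier (G x)"
      proof
        assume "e x w \<in> ?h x ` carrier (G x)"
        then obtain v where "v \<in> carrier (G x)" "e x w = g x (e x v)" by blast
        then show False using w(2) B_fix[OF g x B_closed[OF e x]] by simp
      qed
      ultimately have "?h x ` carrier (G x) \<subset> e x ` carrier (G x)"
        using w by blast
      then have "len x (?h x ` carrier (G x)) < len x (e x ` carrier (G x))"
        using len_mono[OF x image[OF h] image[OF e]] by blast
      moreover have "g x m \<in> ?h x ` carrier (G x)"
        using less.prems(3) by blast
      ultimately show ?thesis
        using less.hyps[OF _ h x] by blast
    qed
    have c: "compl f \<in> B" using f B_compl by blast
    \<comment> \<open>The complement of \<open>f\<close> moves \<open>e x u\<close>: otherwise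
      applying \<open>f\<close> to both sides would give zero on the left and a nonzero element on
      the right.\<close>
    have "e x u \<ominus>\<^bsub>G x\<^esub> f x (e x u) \<noteq> e x u"
    proof
      assume a: "e x u \<ominus>\<^bsub>G x\<^esub> f x (e x u) = e x u"
      have "f x (e x u \<ominus>\<^bsub>G x\<^esub> f x (e x u)) = \<zero>\<^bsub>G x\<^esub>"
        using endo_diff[OF sub_whole B_endo[OF f] x] B_closed[OF e x u(1)] B_closed[OF f x]
          B_fix[OF f x] diff_self[OF x] by simp
      then show False using a u by simp
    qed
    then have 1: "finite {U. character U \<and> proj U x (compl f x m) \<noteq> \<zero>\<^bsub>G x\<^esub>} \<and>
        ((\<forall>U. character U \<longrightarrow> proj U x (compl f x m) = \<zero>\<^bsub>G x\<^esub>) \<longrightarrow> compl f x m = \<zero>\<^bsub>G x\<^esub>)"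
      using step[OF c u(1)] by blast
    have 2: "finite {U. character U \<and> proj U x (f x m) \<noteq> \<zero>\<^bsub>G x\<^esub>} \<and>
        ((\<forall>U. character U \<longrightarrow> proj U x (f x m) = \<zero>\<^bsub>G x\<^esub>) \<longrightarrow> f x m = \<zero>\<^bsub>G x\<^esub>)"
      using step[OF f v] .
    have fm: "f x m \<in> carrier (G x)" "compl f x m \<in> carrier (G x)"
      using B_closed[OF f x mc] B_closed[OF c x mc] by blast+
    have m: "compl f x m \<oplus>\<^bsub>G x\<^esub> f x m = m"
      using diff_add_cancel x mc fm by blast
    have zz: "\<zero>\<^bsub>G x\<^esub> \<oplus>\<^bsub>G x\<^esub> \<zero>\<^bsub>G x\<^esub> = \<zero>\<^bsub>G x\<^esub>"
      using abelian[OF x] by (simp add: abelian_groupE)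
    have "{U. character U \<and> proj U x m \<noteq> \<zero>\<^bsub>G x\<^esub>} \<subseteq> {U. character U \<and> proj U x (f x m) \<noteq> \<zero>\<^bsub>G x\<^esub>} \<union>
        {U. character U \<and> proj U x (compl f x m) \<noteq> \<zero>\<^bsub>G x\<^esub>}"
      using proj_add[OF _ x fm(2,1)] m zz by fastforce
    then have "finite {U. character U \<and> proj U x m \<noteq> \<zero>\<^bsub>G x\<^esub>}"
      using 1 2 by (meson finite_UnI finite_subset)
    moreover have "m = \<zero>\<^bsub>G x\<^esub>" if "\<forall>U. character U \<longrightarrow> proj U x m = \<zero>\<^bsub>G x\<^esub>"
    proof -
      have "proj U x (g x m) = \<zero>\<^bsub>G x\<^esub>" if "character U" "g \<in> B" for U g
        using that \<open>\<forall>U. _\<close> proj_comm[OF that(1) x that(2) mc] endo_zero[OF sub_whole B_endo x] by simp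
      then have "f x m = \<zero>\<^bsub>G x\<^esub>" "compl f x m = \<zero>\<^bsub>G x\<^esub>"
        using 1 2 f c by blast+
      then show ?thesis using m zz by metis
    qed
    ultimately show ?thesis by blast
  next
    case False
    show ?thesis
    proof (cases "m = \<zero>\<^bsub>G x\<^esub>")
      case True
      have "{U. character U \<and> proj U x m \<noteq> \<zero>\<^bsub>G x\<^esub>} = {}"
        unfolding True using proj_zero[OF _ x] by blast
      then have "finite {U. character U \<and> proj U x m \<noteq> \<zero>\<^bsub>G x\<^esub>}" by (simp only: finite.emptyI)
      then show ?thesis using True by blast
    next
      case ne: False
      obtain u where u: "u \<in> carrier (G x)" "m = e x u" using less.prems by blast
      have dich: "(f x m = m) \<noteq> (f x m = \<zero>\<^bsub>G x\<^esub>)" if "f \<in> B" for f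
        using False that u ne by metis
      \<comment> \<open>Every member of \<open>B\<close> either fixes or kills the nonzero
        \<open>m\<close>, and not both, so the members fixing it form a character whose piece
        contains \<open>m\<close>.\<close>
      define W where "W = {f \<in> B. f x m = m}"
      have W: "character W"
        unfolding character_def W_def
      proof (intro conjI ballI)
        fix f assume f: "f \<in> B"
        have fc: "f x m \<in> carrier (G x)" using B_closed f x mc by blast
        have "m \<ominus>\<^bsub>G x\<^esub> f x m = \<zero>\<^bsub>G x\<^esub> \<longleftrightarrow> m = f x m"
          using diff_eq_zero_iff x mc fc by blast
        then show "(f \<in> {f \<in> B. f x m = m}) \<noteq> (compl f \<in> {f \<in> B. f x m = m})"
          using f B_compl[OF f] dich[OF f] dich[OF B_compl[OF f]] by auto
      qed (auto simp: B_mult)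
      have mW: "m \<in> piece W x" using mc unfolding piece_def W_def by blast
      have "{U. character U \<and> proj U x m \<noteq> \<zero>\<^bsub>G x\<^esub>} \<subseteq> {W}"
        using proj_orthogonal[OF _ W _ x mW] by blast
      then have "finite {U. character U \<and> proj U x m \<noteq> \<zero>\<^bsub>G x\<^esub>}"
        by (rule finite_subset) simp
      then show ?thesis
        using proj_fix[OF W x mW] W by auto
    qed
  qed
qed

text \<open>Summing the prescribed components suffices, since by orthogonality each projection reads
  off exactly its own component.\<close>

lemma proj_realize:
  assumes x: "x \<in> V" and F: "finite F" "\<And>U. U \<in> F \<Longrightarrow> character U" "\<And>U. U \<in> F \<Longrightarrow> w U \<in> piece U x"
  shows "\<exists>m\<in>carrier (G x). \<forall>U. character U \<longrightarrow> proj U x m = (if U \<in> F then w U else \<zero>\<^bsub>G x\<^esub>)"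
  using F
proof (induction F rule: finite_induct)
  case empty
  then show ?case using proj_zero x zero_closed by auto
next
  case (insert W F)
  then obtain m where m: "m \<in> carrier (G x)"
    "\<And>U. character U \<Longrightarrow> proj U x m = (if U \<in> F then w U else \<zero>\<^bsub>G x\<^esub>)" by auto
  have W: "character W" "w W \<in> piece W x" "w W \<in> carrier (G x)"
    using insert.prems piece_carrier by blast+
  interpret Gx: abelian_group "G x" by (rule abelian) fact
  have "proj U x (m \<oplus>\<^bsub>G x\<^esub> w W) = (if U \<in> insert W F then w U else \<zero>\<^bsub>G x\<^esub>)" if U: "character U" for U
  proof (cases "U = W")
    case True
    then show ?thesis
      using proj_add[OF U x m(1) W(3)] m(2)[OF U] proj_fix[OF W(1) x W(2)] insert.hyps W by simp
  next
    case False
    then show ?thesis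
      using proj_add[OF U x m(1) W(3)] m(2)[OF U] proj_orthogonal[OF U W(1) False x W(2)]
        insert.prems(2)[of U] piece_carrier[of "w U" U x] by auto
  qed
  then show ?case using m W by blast
qed

text \<open>Each \<open>f\<close> in \<open>B\<close> is a scalar 0 or 1 on the piece and therefore
  commutes with every endomorphism of it; this is what places the extension of \<open>q\<close> in
  \<open>B\<close>. Membership of that extension in \<open>U\<close> then decides between the
  alternatives.\<close>

lemma piece_indecomposable:
  assumes U: "character U" and q: "endo (piece U) q"
    and qq: "\<And>x m. \<lbrakk>x \<in> V; m \<in> piece U x\<rbrakk> \<Longrightarrow> q x (q x m) = q x m"
  shows "(\<forall>x\<in>V. \<forall>m\<in>piece U x. q x m = m) \<or> (\<forall>x\<in>V. \<forall>m\<in>piece U x. q x m = \<zero>\<^bsub>G x\<^esub>)"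
proof -
  let ?e = "\<lambda>x m. q x (proj U x m)"
  have P: "q x (proj U x m) \<in> piece U x" "proj U x m \<in> piece U x" if "x \<in> V" "m \<in> carrier (G x)" for x m
    using endo_closed[OF q] proj_piece[OF U] that by blast+
  have e: "?e \<in> B"
  proof (rule B_maximal)
    show "idem ?e"
      unfolding idem_def endo_def
    proof (intro conjI ballI)
      fix x m assume x: "x \<in> V" and m: "m \<in> carrier (G x)"
      then show "?e x m \<in> carrier (G x)" using P piece_carrier by blast
      show "?e x (?e x m) = ?e x m"
        using P[OF x m] proj_fix[OF U x] qq[OF x] by simp
      fix n assume n: "n \<in> carrier (G x)"
      show "?e x (m \<oplus>\<^bsub>G x\<^esub> n) = ?e x m \<oplus>\<^bsub>G x\<^esub> ?e x n"
        using proj_add[OF U x m n] endo_add[OF q x] P(2) x m n by simp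
    next
      fix x y h m assume x: "x \<in> V" and y: "y \<in> V" and h: "h \<in> Op y x" and m: "m \<in> carrier (G x)"
      show "?e y (h m) = h (?e x m)"
        using endo_op[OF endo_proj[OF U] x y h m] endo_op[OF q x y h P(2)[OF x m]] by simp
    qed
    fix f assume f: "f \<in> B"
    show "commutes ?e f"
      unfolding commutes_def
    proof (intro ballI)
      fix x m assume x: "x \<in> V" and m: "m \<in> carrier (G x)"
      show "?e x (f x m) = f x (?e x m)"
      proof (cases "f \<in> U")
        case True
        then show ?thesis
          using proj_comm[OF U x f m] piece_fix[OF P(1)[OF x m] True] piece_fix[OF P(2)[OF x m] True] by simp
      next
        case False
        then show ?thesis
          using proj_comm[OF U x f m] piece_kill[OF U f False x] P[OF x m]
            endo_zero[OF sub_piece[OF U] q x] by simp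
      qed
    qed
  qed
  show ?thesis
  proof (cases "?e \<in> U")
    case True
    have "q x m = m" if "x \<in> V" "m \<in> piece U x" for x m
      using piece_fix[OF that(2) True] proj_fix[OF U that] by simp
    then show ?thesis by blast
  next
    case False
    have "q x m = \<zero>\<^bsub>G x\<^esub>" if "x \<in> V" "m \<in> piece U x" for x m
      using piece_kill[OF U e False that] proj_fix[OF U that] by simp
    then show ?thesis by blast
  qed
qed

end

section \<open>The decomposition of an operator family\<close>

text \<open>Characters are hidden: the summands index themselves. Finite support, separation and
  realisation of components together identify each vertex group with a direct sum, and the last
  clause is the dichotomy behind local endomorphism rings.\<close>

theorem (in finite_op_family) decomposition:
  obtains I p where
    "\<And>P. P \<in> I \<Longrightarrow> sub P"
    and "\<And>P. P \<in> I \<Longrightarrow> \<exists>x\<in>V. P x \<noteq> {\<zero>\<^bsub>G x\<^esub>}"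
    and "\<And>P. P \<in> I \<Longrightarrow> endo whole (p P)"
    and "\<And>P x m. \<lbrakk>P \<in> I; x \<in> V; m \<in> carrier (G x)\<rbrakk> \<Longrightarrow> p P x m \<in> P x"
    and "\<And>x m. \<lbrakk>x \<in> V; m \<in> carrier (G x)\<rbrakk> \<Longrightarrow> finite {P \<in> I. p P x m \<noteq> \<zero>\<^bsub>G x\<^esub>}"
    and "\<And>x m. \<lbrakk>x \<in> V; m \<in> carrier (G x); \<And>P. P \<in> I \<Longrightarrow> p P x m = \<zero>\<^bsub>G x\<^esub>\<rbrakk> \<Longrightarrow> m = \<zero>\<^bsub>G x\<^esub>"
    and "\<And>x w. \<lbrakk>x \<in> V; \<And>P. P \<in> I \<Longrightarrow> w P \<in> P x; finite {P \<in> I. w P \<noteq> \<zero>\<^bsub>G x\<^esub>}\<rbrakk> \<Longrightarrow>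
      \<exists>m\<in>carrier (G x). \<forall>P\<in>I. p P x m = w P"
    and "\<And>P f. \<lbrakk>P \<in> I; endo P f\<rbrakk> \<Longrightarrow> (\<forall>x\<in>V. bij_betw (f x) (P x) (P x)) \<or>
      (\<forall>x\<in>V. bij_betw (\<lambda>m. m \<ominus>\<^bsub>G x\<^esub> f x m) (P x) (P x))"
proof -
  obtain B where B: "\<And>e. e \<in> B \<Longrightarrow> idem e" "\<And>e f. \<lbrakk>e \<in> B; f \<in> B\<rbrakk> \<Longrightarrow> commutes e f"
    "\<And>e. \<lbrakk>idem e; \<And>f. f \<in> B \<Longrightarrow> commutes e f\<rbrakk> \<Longrightarrow> e \<in> B"
    using maximal_commuting_idempotents by blast
  interpret maximal_idempotents V G Op len bd B 
  proof unfold_locales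
    show "e \<in> B" if "idem e" "\<And>f. f \<in> B \<Longrightarrow> commutes e f" for e
      using B(3)[OF that] .
  qed (use B in blast)+
  \<comment> \<open>Pieces that vanish at all vertices are discarded: a zero summand has no local
    endomorphism ring, and only a nonzero piece determines its character.\<close>
  define I where "I = {piece U | U. character U \<and> (\<exists>x\<in>V. piece U x \<noteq> {\<zero>\<^bsub>G x\<^esub>})}"
  define idx where "idx P = (SOME U. character U \<and> piece U = P)" for P
  have idx: "character (idx P)" "piece (idx P) = P" if "P \<in> I" for P
  proof -
    have "\<exists>U. character U \<and> piece U = P" using that unfolding I_def by blast
    from someI_ex[OF this] show "character (idx P)" "piece (idx P) = P" unfolding idx_def by blast+
  qed
  have nz: "\<exists>x\<in>V. \<exists>m\<in>P x. m \<noteq> \<zero>\<^bsub>G x\<^esub>" if "P \<in> I" for P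
    using that sub_zero[OF sub_piece] unfolding I_def by fast
  \<comment> \<open>A nonzero element of the common piece is fixed by the projection for
    \<open>U\<close>, and would be killed by it if the characters were distinct.\<close>
  have inj: "U = W" if "character U" "character W" "piece U = piece W" "piece U \<in> I" for U W
    using nz[OF that(4)] proj_orthogonal[OF that(1,2)] proj_fix[OF that(1)] that(3) by metis
  have idx_eq: "idx (piece U) = U" if "character U" "piece U \<in> I" for U
    using inj[of "idx (piece U)" U] idx[OF that(2)] that by simp
  have zero: "proj U x m = \<zero>\<^bsub>G x\<^esub>" if "character U" "piece U \<notin> I" "x \<in> V" "m \<in> carrier (G x)" for U x m
    using that proj_piece[OF that(1,3,4)] unfolding I_def by blast
  show thesis
  proof (rule that[of I "\<lambda>P. proj (idx P)"])
    fix P assume P: "P \<in> I"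
    show "sub P" using sub_piece[OF idx(1)[OF P]] idx(2)[OF P] by simp
    show "\<exists>x\<in>V. P x \<noteq> {\<zero>\<^bsub>G x\<^esub>}" using P unfolding I_def by blast
    show "endo whole (proj (idx P))" using endo_proj idx P by blast
    show "proj (idx P) x m \<in> P x" if "x \<in> V" "m \<in> carrier (G x)" for x m
      using proj_piece[OF idx(1)[OF P] that] idx(2)[OF P] by simp
    show "(\<forall>x\<in>V. bij_betw (f x) (P x) (P x)) \<or> (\<forall>x\<in>V. bij_betw (\<lambda>m. m \<ominus>\<^bsub>G x\<^esub> f x m) (P x) (P x))"
      if "endo P f" for f
      using indecomposable_imp_bij[OF sub_piece[OF idx(1)[OF P]], unfolded idx(2)[OF P], OF that]
        piece_indecomposable[OF idx(1)[OF P], unfolded idx(2)[OF P]] by blast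
  next
    fix x m assume x: "x \<in> V" and m: "m \<in> carrier (G x)"
    have fs: "finite {U. character U \<and> proj U x m \<noteq> \<zero>\<^bsub>G x\<^esub>}"
      "(\<forall>U. character U \<longrightarrow> proj U x m = \<zero>\<^bsub>G x\<^esub>) \<longrightarrow> m = \<zero>\<^bsub>G x\<^esub>"
      using proj_finite_separating[OF B_id x] m by auto
    have "{P \<in> I. proj (idx P) x m \<noteq> \<zero>\<^bsub>G x\<^esub>} \<subseteq> piece ` {U. character U \<and> proj U x m \<noteq> \<zero>\<^bsub>G x\<^esub>}"
      using idx by (smt (verit) imageI mem_Collect_eq subsetI)
    then show "finite {P \<in> I. proj (idx P) x m \<noteq> \<zero>\<^bsub>G x\<^esub>}"
      using fs by (meson finite_imageI finite_subset)
    show "m = \<zero>\<^bsub>G x\<^esub>" if *: "\<And>P. P \<in> I \<Longrightarrow> proj (idx P) x m = \<zero>\<^bsub>G x\<^esub>"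
    proof -
      have "proj U x m = \<zero>\<^bsub>G x\<^esub>" if "character U" for U
        using *[of "piece U"] idx_eq[OF that] zero[OF that _ x m] by fastforce
      then show ?thesis using fs by blast
    qed
  next
    fix x w assume x: "x \<in> V" and w: "\<And>P. P \<in> I \<Longrightarrow> w P \<in> P x"
      and fin: "finite {P \<in> I. w P \<noteq> \<zero>\<^bsub>G x\<^esub>}"
    let ?F = "idx ` {P \<in> I. w P \<noteq> \<zero>\<^bsub>G x\<^esub>}"
    have "\<exists>m\<in>carrier (G x). \<forall>U. character U \<longrightarrow>
        proj U x m = (if U \<in> ?F then w (piece U) else \<zero>\<^bsub>G x\<^esub>)"
      using fin w idx by (intro proj_realize x) auto
    then obtain m where m: "m \<in> carrier (G x)"
      and mU: "\<And>U. character U \<Longrightarrow> proj U x m = (if U \<in> ?F then w (piece U) else \<zero>\<^bsub>G x\<^esub>)"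
      by blast
    have "proj (idx P) x m = w P" if P: "P \<in> I" for P
    proof -
      \<comment> \<open>\<open>piece\<close> inverts \<open>idx\<close> on \<open>I\<close>, so
        \<open>idx\<close> is injective there and no summand with zero component enters the
        support.\<close>
      have "idx P \<in> ?F \<longleftrightarrow> w P \<noteq> \<zero>\<^bsub>G x\<^esub>" 
        using inj_on_image_mem_iff[OF inj_on_inverseI[of I piece idx], OF idx(2) P] P by auto
      then show ?thesis using mU[OF idx(1)[OF P]] idx(2)[OF P] by auto
    qed
    then show "\<exists>m\<in>carrier (G x). \<forall>P\<in>I. proj (idx P) x m = w P" using m by blast
  qed
qed

section \<open>Modules of finite length\<close>

text \<open>Closure under differences is the form in which \<open>sub\<close> speaks of
  subgroups.\<close>

lemma (in left_module) submodule_iff: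
  "submodule K R M \<longleftrightarrow> K \<subseteq> carrier M \<and> \<zero>\<^bsub>M\<^esub> \<in> K \<and> (\<forall>a\<in>K. \<forall>b\<in>K. a \<ominus>\<^bsub>M\<^esub> b \<in> K) \<and>
    (\<forall>r\<in>carrier R. \<forall>a\<in>K. r \<odot>\<^bsub>M\<^esub> a \<in> K)"
proof
  assume K: "submodule K R M"
  interpret submodule K R M by fact
  have "a \<ominus>\<^bsub>M\<^esub> b \<in> K" if "a \<in> K" "b \<in> K" for a b
    using that m_closed[of a "\<ominus>\<^bsub>M\<^esub> b"] m_inv_closed[of b] by (simp add: a_minus_def a_inv_def)
  then show "K \<subseteq> carrier M \<and> \<zero>\<^bsub>M\<^esub> \<in> K \<and> (\<forall>a\<in>K. \<forall>b\<in>K. a \<ominus>\<^bsub>M\<^esub> b \<in> K) \<and>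
    (\<forall>r\<in>carrier R. \<forall>a\<in>K. r \<odot>\<^bsub>M\<^esub> a \<in> K)"
    using subset one_closed by auto
next
  assume K: "K \<subseteq> carrier M \<and> \<zero>\<^bsub>M\<^esub> \<in> K \<and> (\<forall>a\<in>K. \<forall>b\<in>K. a \<ominus>\<^bsub>M\<^esub> b \<in> K) \<and>
    (\<forall>r\<in>carrier R. \<forall>a\<in>K. r \<odot>\<^bsub>M\<^esub> a \<in> K)"
  have neg: "\<ominus>\<^bsub>M\<^esub> b \<in> K" if "b \<in> K" for b
  proof -
    have "\<zero>\<^bsub>M\<^esub> \<ominus>\<^bsub>M\<^esub> b \<in> K" using K that by blast
    moreover have "b \<in> carrier M" using K that by blast
    ultimately show ?thesis by (simp add: M.minus_eq)
  qed
  have "a \<oplus>\<^bsub>M\<^esub> b \<in> K" if "a \<in> K" "b \<in> K" for a b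
  proof -
    have "a \<ominus>\<^bsub>M\<^esub> (\<ominus>\<^bsub>M\<^esub> b) \<in> K" using K neg that by blast
    moreover have "a \<in> carrier M" "b \<in> carrier M" using K that by blast+
    ultimately show ?thesis by (simp add: M.minus_eq)
  qed
  then show "submodule K R M"
    using K neg by (intro submodule.intro subgroup.intro submodule_axioms.intro)
      (auto simp: a_inv_def)
qed

text \<open>The rank of a submodule counts the factors of a fixed composition series that it meets; two
  comparable submodules meeting the same factors coincide.\<close>

lemma (in left_module) finite_length_rank:
  assumes "finite_length R M"
  obtains rk :: "'c set \<Rightarrow> nat" and n where
    "\<And>K K'. \<lbrakk>submodule K R M; submodule K' R M; K \<subset> K'\<rbrakk> \<Longrightarrow> rk K < rk K'"
    and "\<And>K. rk K \<le> n"
proof -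
  obtain n L where L: "L 0 = {\<zero>\<^bsub>M\<^esub>} \<and> L n = carrier M \<and> (\<forall>i\<le>n. submodule (L i) R M) \<and>
      (\<forall>i<n. L i \<subset> L (Suc i) \<and>
        (\<forall>K. submodule K R M \<and> L i \<subseteq> K \<and> K \<subseteq> L (Suc i) \<longrightarrow> K = L i \<or> K = L (Suc i)))"
    using assms unfolding finite_length_def by (elim exE)
  then have L0: "L 0 = {\<zero>\<^bsub>M\<^esub>}" and Ln: "L n = carrier M"
    and Lsub: "\<And>i. i \<le> n \<Longrightarrow> submodule (L i) R M"
    and Linc: "\<And>i. i < n \<Longrightarrow> L i \<subset> L (Suc i)"
    by simp_all
  have Lmax: "K = L i \<or> K = L (Suc i)"
    if "i < n" "submodule K R M" "L i \<subseteq> K" "K \<subseteq> L (Suc i)" for i K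
    using L that by simp
  \<comment> \<open>The index \<open>i\<close> belongs to \<open>J K\<close> when \<open>K\<close>
    has nonzero image in the factor of \<open>L (Suc i)\<close> by \<open>L i\<close>.\<close>
  define J where "J K = {i. i < n \<and> \<not> K \<inter> L (Suc i) \<subseteq> L i}" for K
  have fin: "finite (J K)" for K
    unfolding J_def by simp
  have key: "K' \<subseteq> K" if K: "submodule K R M" and K': "submodule K' R M" and le: "K \<subseteq> K'"
    and J: "J K' \<subseteq> J K" for K K'
  proof -
    \<comment> \<open>The inclusion climbs the composition series one factor at a time; at
      \<open>n\<close> it covers all of \<open>K'\<close>.\<close>
    have "K' \<inter> L i \<subseteq> K" if "i \<le> n" for i
      using that
    proof (induction i)
      case 0
      then show ?case using L0 K submodule_iff by auto
    next
      case (Suc i)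
      then have i: "i < n" and IH: "K' \<inter> L i \<subseteq> K" by simp_all
      have Li: "submodule (L i) R M" "submodule (L (Suc i)) R M" and inc: "L i \<subseteq> L (Suc i)"
        using Lsub i Linc by auto
      show ?case
      proof (cases "i \<in> J K")
        case False
        then have "K' \<inter> L (Suc i) \<subseteq> L i" using J i unfolding J_def by blast
        then show ?thesis using IH by blast
      next
        case True
        \<comment> \<open>\<open>Q\<close> is the part of \<open>K\<close> in
          \<open>L (Suc i)\<close> enlarged by \<open>L i\<close>. Since \<open>K\<close> meets the
          factor, maximality of \<open>L i\<close> forces \<open>Q\<close> to be all of
          \<open>L (Suc i)\<close>.\<close>
        define Q where "Q = {k \<oplus>\<^bsub>M\<^esub> l | k l. k \<in> K \<inter> L (Suc i) \<and> l \<in> L i}"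
        have c: "K \<subseteq> carrier M" "L i \<subseteq> carrier M"
          using K Li unfolding submodule_iff by blast+
        have "submodule Q R M"
          unfolding submodule_iff
        proof (intro conjI ballI)
          show "Q \<subseteq> carrier M" unfolding Q_def using c by auto
          have "\<zero>\<^bsub>M\<^esub> \<in> K" "\<zero>\<^bsub>M\<^esub> \<in> L (Suc i)" "\<zero>\<^bsub>M\<^esub> \<in> L i" "\<zero>\<^bsub>M\<^esub> = \<zero>\<^bsub>M\<^esub> \<oplus>\<^bsub>M\<^esub> \<zero>\<^bsub>M\<^esub>"
            using K Li submodule_iff by auto
          then show "\<zero>\<^bsub>M\<^esub> \<in> Q" unfolding Q_def by blast
        next
          fix a b assume "a \<in> Q" "b \<in> Q"
          then obtain k l k' l' where kl: "k \<in> K \<inter> L (Suc i)" "l \<in> L i" "a = k \<oplus>\<^bsub>M\<^esub> l"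
            "k' \<in> K \<inter> L (Suc i)" "l' \<in> L i" "b = k' \<oplus>\<^bsub>M\<^esub> l'" unfolding Q_def by blast
          have kc: "k \<in> carrier M" "k' \<in> carrier M" "l \<in> carrier M" "l' \<in> carrier M"
            using c kl by blast+
          have "a \<ominus>\<^bsub>M\<^esub> b = (k \<ominus>\<^bsub>M\<^esub> k') \<oplus>\<^bsub>M\<^esub> (l \<ominus>\<^bsub>M\<^esub> l')"
            using kc by (simp add: kl M.minus_eq M.a_ac M.minus_add)
          moreover have "k \<ominus>\<^bsub>M\<^esub> k' \<in> K \<inter> L (Suc i)" "l \<ominus>\<^bsub>M\<^esub> l' \<in> L i"
            using kl K Li unfolding submodule_iff by blast+
          ultimately show "a \<ominus>\<^bsub>M\<^esub> b \<in> Q" unfolding Q_def by blast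
        next
          fix r a assume r: "r \<in> carrier R" and "a \<in> Q"
          then obtain k l where kl: "k \<in> K \<inter> L (Suc i)" "l \<in> L i" "a = k \<oplus>\<^bsub>M\<^esub> l"
            unfolding Q_def by blast
          have "r \<odot>\<^bsub>M\<^esub> a = r \<odot>\<^bsub>M\<^esub> k \<oplus>\<^bsub>M\<^esub> r \<odot>\<^bsub>M\<^esub> l"
            using kl c r smult_r_distr by blast
          moreover have "r \<odot>\<^bsub>M\<^esub> k \<in> K \<inter> L (Suc i)" "r \<odot>\<^bsub>M\<^esub> l \<in> L i"
            using kl K Li r unfolding submodule_iff by blast+
          ultimately show "r \<odot>\<^bsub>M\<^esub> a \<in> Q" unfolding Q_def by blast
        qed
        moreover have "L i \<subseteq> Q"
        proof
          fix l assume l: "l \<in> L i"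
          have "\<zero>\<^bsub>M\<^esub> \<in> K \<inter> L (Suc i)" "l = \<zero>\<^bsub>M\<^esub> \<oplus>\<^bsub>M\<^esub> l"
            using K Li l c submodule_iff by auto
          then show "l \<in> Q" unfolding Q_def using l by blast
        qed
        moreover have "Q \<subseteq> L (Suc i)"
          unfolding Q_def using inc submodule.axioms(1)[OF Li(2)] subgroup.m_closed by fastforce
        moreover have "Q \<noteq> L i"
        proof -
          obtain k where k: "k \<in> K" "k \<in> L (Suc i)" "k \<notin> L i"
            using True unfolding J_def by blast
          have "k = k \<oplus>\<^bsub>M\<^esub> \<zero>\<^bsub>M\<^esub>" "\<zero>\<^bsub>M\<^esub> \<in> L i" using k c Li submodule_iff by auto
          then have "k \<in> Q" unfolding Q_def using k by blast
          then show ?thesis using k by blast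
        qed
        ultimately have Q: "Q = L (Suc i)" using Lmax i by blast
        show ?thesis
        proof
          fix k' assume k': "k' \<in> K' \<inter> L (Suc i)"
          then obtain k l where kl: "k \<in> K" "l \<in> L i" "k' = k \<oplus>\<^bsub>M\<^esub> l"
            using Q unfolding Q_def by blast
          have kc: "k \<in> carrier M" "l \<in> carrier M" using kl c by blast+
          \<comment> \<open>The modular law: \<open>l\<close> is a difference of elements of
            \<open>K'\<close> and lies in \<open>L i\<close>, where the induction hypothesis
            applies.\<close>
          have "l = k' \<ominus>\<^bsub>M\<^esub> k"
            using kc by (simp add: kl M.a_comm[of k l] M.minus_eq M.a_assoc M.r_neg)
          then have "l \<in> K'" using k' kl(1) le K' unfolding submodule_iff by blast
          then have "l \<in> K" using IH kl by blast
          then show "k' \<in> K"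
            using kl subgroup.m_closed[OF submodule.axioms(1)[OF K]] by simp
        qed
      qed
    qed
    then have "K' \<inter> carrier M \<subseteq> K" using Ln by blast
    moreover have "K' \<subseteq> carrier M" using K' unfolding submodule_iff by simp
    ultimately show ?thesis by blast
  qed
  show thesis
  proof (rule that)
    fix K K' assume K: "submodule K R M" "submodule K' R M" "K \<subset> K'"
    then have "J K \<subseteq> J K'" unfolding J_def by blast
    moreover have "\<not> J K' \<subseteq> J K" using key K by blast
    ultimately show "card (J K) < card (J K')"
      using psubset_card_mono[OF fin] by blast
  next
    show "card (J K) \<le> n" for K
      using card_mono[of "{..<n}" "J K"] unfolding J_def by auto
  qed
qed

section \<open>Tensor products\<close>

abbreviation tensor_free ::
    "('s, 'r, 'a, 'y) bimodule_scheme \<Rightarrow> ('r, 'm, 'z) module_scheme \<Rightarrow> ('a \<times> 'm \<Rightarrow>\<^sub>0 int) monoid" where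
  "tensor_free A M \<equiv> free_Abelian_group (carrier A \<times> carrier M)"

definition tensor_class ::
    "('r, 'x) ring_scheme \<Rightarrow> ('s, 'r, 'a, 'y) bimodule_scheme \<Rightarrow> ('r, 'm, 'z) module_scheme
      \<Rightarrow> ('a \<times> 'm \<Rightarrow>\<^sub>0 int) \<Rightarrow> ('a \<times> 'm \<Rightarrow>\<^sub>0 int) set" where
  "tensor_class R A M z = tensor_rels R A M #>\<^bsub>tensor_free A M\<^esub> z"

text \<open>Exactly what the three kinds of relations require. \<open>g\<close> is right linear
  only, so that left multiplication by a scalar qualifies; the left action on the tensor product is
  defined through it.\<close>

definition tensor_compatible ::
    "('r, 'x) ring_scheme
      \<Rightarrow> ('s, 'r, 'a, 'y) bimodule_scheme \<Rightarrow> ('r, 'm, 'z) module_scheme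
      \<Rightarrow> ('t, 'r, 'b, 'u) bimodule_scheme \<Rightarrow> ('r, 'n, 'v) module_scheme
      \<Rightarrow> ('a \<Rightarrow> 'b) \<Rightarrow> ('m \<Rightarrow> 'n) \<Rightarrow> bool" where
  "tensor_compatible R A M B N g f \<longleftrightarrow>
    g \<in> hom (add_monoid A) (add_monoid B) \<and>
    (\<forall>a\<in>carrier A. \<forall>r\<in>carrier R. g (a \<star>\<^bsub>A\<^esub> r) = g a \<star>\<^bsub>B\<^esub> r) \<and>
    f \<in> left_module_hom R M N"

abbreviation tensor_lift :: "('a \<Rightarrow> 'b) \<Rightarrow> ('m \<Rightarrow> 'n) \<Rightarrow> ('a \<times> 'm \<Rightarrow>\<^sub>0 int) \<Rightarrow> ('b \<times> 'n \<Rightarrow>\<^sub>0 int)" where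
  "tensor_lift g f \<equiv> frag_extend (\<lambda>(a, m). frag_of (g a, f m))"

lemma
  shows keys_frag_of_diff: "Poly_Mapping.keys (frag_of p - frag_of q) \<subseteq> {p, q}"
    and keys_frag_of_diff_diff: "Poly_Mapping.keys (frag_of p - frag_of q - frag_of r) \<subseteq> {p, q, r}"
  using keys_diff[of "frag_of p - frag_of q" "frag_of r"] keys_diff[of "frag_of p" "frag_of q"] by auto

lemma tensor_rels_normal:
  assumes "bimodule S R A" "left_module R M"
  shows "tensor_rels R A M \<lhd> tensor_free A M"
proof -
  interpret A: bimodule S R A by fact
  interpret M: left_module R M by fact
  have "subgroup (tensor_rels R A M) (tensor_free A M)"
    unfolding tensor_rels_def
  proof (rule group.generate_is_subgroup[OF group_free_Abelian_group], intro Un_least subsetI,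
      goal_cases)
    case (1 z)
    then obtain a b m where "z = frag_of (a \<oplus>\<^bsub>A\<^esub> b, m) - frag_of (a, m) - frag_of (b, m)"
      "a \<in> carrier A" "b \<in> carrier A" "m \<in> carrier M" by blast
    then show ?case
      using keys_frag_of_diff_diff[of "(a \<oplus>\<^bsub>A\<^esub> b, m)" "(a, m)" "(b, m)"] by auto
  next
    case (2 z)
    then obtain a m n where "z = frag_of (a, m \<oplus>\<^bsub>M\<^esub> n) - frag_of (a, m) - frag_of (a, n)"
      "a \<in> carrier A" "m \<in> carrier M" "n \<in> carrier M" by blast
    then show ?case
      using keys_frag_of_diff_diff[of "(a, m \<oplus>\<^bsub>M\<^esub> n)" "(a, m)" "(a, n)"] by auto
  next
    case (3 z)
    then obtain a r m where "z = frag_of (a \<star>\<^bsub>A\<^esub> r, m) - frag_of (a, r \<odot>\<^bsub>M\<^esub> m)"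
      "a \<in> carrier A" "r \<in> carrier R" "m \<in> carrier M" by blast
    then show ?case
      using keys_frag_of_diff[of "(a \<star>\<^bsub>A\<^esub> r, m)" "(a, r \<odot>\<^bsub>M\<^esub> m)"] A.rsmult_closed M.smult_closed by auto
  qed
  then show ?thesis
    by (simp add: abelian_free_Abelian_group comm_group.normal_iff_subgroup)
qed

lemma tensor_lift_closed:
  assumes "tensor_compatible R A M B N g f" "z \<in> carrier (tensor_free A M)"
  shows "tensor_lift g f z \<in> carrier (tensor_free B N)"
proof -
  have "Poly_Mapping.keys ((\<lambda>(a, m). frag_of (g a, f m)) p) \<subseteq> carrier B \<times> carrier N"
    if "p \<in> Poly_Mapping.keys z" for p
    using that assms
    by (cases p) (auto simp: tensor_compatible_def left_module_hom_def hom_def)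
  then show ?thesis
    using keys_frag_extend[of "\<lambda>(a, m). frag_of (g a, f m)" z] by auto
qed

lemma
  assumes "a \<in> carrier A" "m \<in> carrier M"
  shows tensor_rels_left: "b \<in> carrier A \<Longrightarrow>
      frag_of (a \<oplus>\<^bsub>A\<^esub> b, m) - frag_of (a, m) - frag_of (b, m) \<in> tensor_rels R A M"
    and tensor_rels_right: "n \<in> carrier M \<Longrightarrow>
      frag_of (a, m \<oplus>\<^bsub>M\<^esub> n) - frag_of (a, m) - frag_of (a, n) \<in> tensor_rels R A M"
    and tensor_rels_middle: "r \<in> carrier R \<Longrightarrow>
      frag_of (a \<star>\<^bsub>A\<^esub> r, m) - frag_of (a, r \<odot>\<^bsub>M\<^esub> m) \<in> tensor_rels R A M"
  using assms unfolding tensor_rels_def by (blast intro: generate.incl)+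

text \<open>Each generating relation is sent to a generating relation of the same kind, so the lift
  descends to cosets.\<close>

lemma tensor_rels_lift:
  assumes A: "bimodule S R A" and M: "left_module R M" and B: "bimodule T R B" and N: "left_module R N"
    and c: "tensor_compatible R A M B N g f" and z: "z \<in> tensor_rels R A M"
  shows "tensor_lift g f z \<in> tensor_rels R B N"
proof -
  interpret A: bimodule S R A by fact
  interpret M: left_module R M by fact
  interpret K: normal "tensor_rels R B N" "tensor_free B N"
    by (rule tensor_rels_normal) fact+
  let ?gens = "{frag_of (a \<oplus>\<^bsub>A\<^esub> b, m) - frag_of (a, m) - frag_of (b, m) | a b m.
        a \<in> carrier A \<and> b \<in> carrier A \<and> m \<in> carrier M} \<union>
     {frag_of (a, m \<oplus>\<^bsub>M\<^esub> n) - frag_of (a, m) - frag_of (a, n) | a m n.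
        a \<in> carrier A \<and> m \<in> carrier M \<and> n \<in> carrier M} \<union>
     {frag_of (a \<star>\<^bsub>A\<^esub> r, m) - frag_of (a, r \<odot>\<^bsub>M\<^esub> m) | a r m.
        a \<in> carrier A \<and> r \<in> carrier R \<and> m \<in> carrier M}"
  have gc: "g a \<in> carrier B" if "a \<in> carrier A" for a
    using c that by (auto simp: tensor_compatible_def hom_def)
  have fc: "f m \<in> carrier N" if "m \<in> carrier M" for m
    using c that by (auto simp: tensor_compatible_def left_module_hom_def hom_def)
  have ga: "g (a \<oplus>\<^bsub>A\<^esub> b) = g a \<oplus>\<^bsub>B\<^esub> g b" if "a \<in> carrier A" "b \<in> carrier A" for a b
    using c that by (auto simp: tensor_compatible_def hom_def)
  have fa: "f (m \<oplus>\<^bsub>M\<^esub> n) = f m \<oplus>\<^bsub>N\<^esub> f n" if "m \<in> carrier M" "n \<in> carrier M" for m n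
    using c that by (auto simp: tensor_compatible_def left_module_hom_def hom_def)
  have gr: "g (a \<star>\<^bsub>A\<^esub> r) = g a \<star>\<^bsub>B\<^esub> r" and fr: "f (r \<odot>\<^bsub>M\<^esub> m) = r \<odot>\<^bsub>N\<^esub> f m"
    if "a \<in> carrier A" "r \<in> carrier R" "m \<in> carrier M" for a r m
    using c that by (auto simp: tensor_compatible_def left_module_hom_def)
  have gen: "tensor_lift g f z \<in> tensor_rels R B N \<and> z \<in> carrier (tensor_free A M)" if "z \<in> ?gens" for z
    using that
  proof (elim UnE CollectE exE conjE)
    fix a b m assume "z = frag_of (a \<oplus>\<^bsub>A\<^esub> b, m) - frag_of (a, m) - frag_of (b, m)"
      "a \<in> carrier A" "b \<in> carrier A" "m \<in> carrier M"
    then show ?thesis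
      using tensor_rels_normal[OF A M, THEN normal_imp_subgroup, THEN subgroup.subset]
        tensor_rels_left[of a A m M b R] tensor_rels_left[of "g a" B "f m" N "g b" R]
      by (auto simp: frag_extend_diff gc fc ga simp del: carrier_free_Abelian_group_iff)
  next
    fix a m n assume "z = frag_of (a, m \<oplus>\<^bsub>M\<^esub> n) - frag_of (a, m) - frag_of (a, n)"
      "a \<in> carrier A" "m \<in> carrier M" "n \<in> carrier M"
    then show ?thesis
      using tensor_rels_normal[OF A M, THEN normal_imp_subgroup, THEN subgroup.subset]
        tensor_rels_right[of a A m M n R] tensor_rels_right[of "g a" B "f m" N "f n" R]
      by (auto simp: frag_extend_diff gc fc fa simp del: carrier_free_Abelian_group_iff)
  next
    fix a r m assume "z = frag_of (a \<star>\<^bsub>A\<^esub> r, m) - frag_of (a, r \<odot>\<^bsub>M\<^esub> m)"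
      "a \<in> carrier A" "r \<in> carrier R" "m \<in> carrier M"
    then show ?thesis
      using tensor_rels_normal[OF A M, THEN normal_imp_subgroup, THEN subgroup.subset]
        tensor_rels_middle[of a A m M r R] tensor_rels_middle[of "g a" B "f m" N r R]
      by (auto simp: frag_extend_diff gc fc gr fr simp del: carrier_free_Abelian_group_iff)
  qed
  show ?thesis
    using z unfolding tensor_rels_def[of R A M]
  proof induction
    case one
    have "0 \<in> tensor_rels R B N"
      using subgroup.one_closed[OF K.is_subgroup] by (simp only: one_free_Abelian_group)
    then show ?case by simp
  next
    case (incl h)
    from gen[OF incl] show ?case by (rule conjunct1)
  next
    case (inv h)
    have "inv\<^bsub>tensor_free B N\<^esub> (tensor_lift g f h) = - tensor_lift g f h"
      using gen[OF inv] tensor_lift_closed[OF c, of h] by (intro inv_free_Abelian_group) simp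
    then show ?case
      using gen[OF inv] K.m_inv_closed[of "tensor_lift g f h"] by (simp add: frag_extend_minus)
  next
    case (eng h1 h2)
    then show ?case using subgroup.m_closed[OF K.is_subgroup] by (simp add: frag_extend_add)
  qed
qed

lemma tensor_class_eqI:
  assumes "bimodule S R A" "left_module R M" "z \<in> carrier (tensor_free A M)" "w \<in> carrier (tensor_free A M)"
    and "z - w \<in> tensor_rels R A M"
  shows "tensor_class R A M z = tensor_class R A M w"
proof -
  interpret K: normal "tensor_rels R A M" "tensor_free A M"
    by (rule tensor_rels_normal) fact+
  have "z \<in> tensor_rels R A M #>\<^bsub>tensor_free A M\<^esub> w"
    using assms(5) by (auto simp: r_coset_def intro!: bexI[of _ "z - w"])
  then show ?thesis
    using K.repr_independence[of z "tensor_rels R A M" w] assms K.is_subgroup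
    unfolding tensor_class_def by simp
qed

lemma tensor_class_subset:
  assumes "bimodule S R A" "left_module R M" "z \<in> carrier (tensor_free A M)"
  shows "tensor_class R A M z \<subseteq> carrier (tensor_free A M)"
proof -
  interpret K: normal "tensor_rels R A M" "tensor_free A M"
    by (rule tensor_rels_normal) fact+
  show ?thesis
    using K.r_coset_subset_G[OF K.subset] assms(3) unfolding tensor_class_def by blast
qed

lemma carrier_tensor: "carrier (tensor R A M) = tensor_class R A M ` carrier (tensor_free A M)"
  unfolding tensor_def Let_def tensor_class_def RCOSETS_def by auto

lemma tensor_class_closed: "z \<in> carrier (tensor_free A M) \<Longrightarrow> tensor_class R A M z \<in> carrier (tensor R A M)"
  unfolding carrier_tensor by blast

lemma tensor_class_add:
  assumes "bimodule S R A" "left_module R M" "z \<in> carrier (tensor_free A M)" "w \<in> carrier (tensor_free A M)"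
  shows "tensor_class R A M z \<oplus>\<^bsub>tensor R A M\<^esub> tensor_class R A M w = tensor_class R A M (z + w)"
proof -
  interpret K: normal "tensor_rels R A M" "tensor_free A M"
    by (rule tensor_rels_normal) fact+
  show ?thesis
    using K.rcos_sum[OF assms(3,4)] unfolding tensor_class_def by (simp add: tensor_def Let_def)
qed

text \<open>Two representatives differ by a relation, and \<open>tensor_rels_lift\<close> carries
  the difference to a relation; hence the cosets united in \<open>tensor_map\<close> all
  coincide.\<close>

lemma tensor_map_class:
  assumes "bimodule S R A" "left_module R M" "bimodule T R B" "left_module R N"
    and c: "tensor_compatible R A M B N g f" and z: "z \<in> carrier (tensor_free A M)"
  shows "tensor_map R A M B N g f (tensor_class R A M z) = tensor_class R B N (tensor_lift g f z)"
proof -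
  interpret K: normal "tensor_rels R A M" "tensor_free A M"
    by (rule tensor_rels_normal) fact+
  have "tensor_class R B N (tensor_lift g f w) = tensor_class R B N (tensor_lift g f z)"
    if w: "w \<in> tensor_class R A M z" for w
  proof -
    obtain k where k: "k \<in> tensor_rels R A M" "w = k + z"
      using w unfolding tensor_class_def r_coset_def by auto
    have "w \<in> carrier (tensor_free A M)"
      using tensor_class_subset[OF assms(1,2) z] w by blast
    moreover have "tensor_lift g f w - tensor_lift g f z \<in> tensor_rels R B N"
      using tensor_rels_lift[OF assms(1-5) k(1)] k by (simp add: frag_extend_add)
    ultimately show ?thesis
      using tensor_class_eqI[OF assms(3,4)] tensor_lift_closed[OF c] z by blast
  qed
  moreover have "z \<in> tensor_class R A M z"
    using K.rcos_self[OF z K.is_subgroup] unfolding tensor_class_def .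
  ultimately show ?thesis
    unfolding tensor_map_def tensor_class_def[of R B N, symmetric] by blast
qed

text \<open>Representatives involve only pairs from the carriers, so values elsewhere are invisible.
  This lets restricted functions be exchanged for unrestricted ones inside a tensor map.\<close>

lemma tensor_map_cong:
  assumes "bimodule S R A" "left_module R M" "t \<in> carrier (tensor R A M)"
    and "\<And>a. a \<in> carrier A \<Longrightarrow> g a = g' a" "\<And>m. m \<in> carrier M \<Longrightarrow> f m = f' m"
  shows "tensor_map R A M B N g f t = tensor_map R A M B N g' f' t"
proof -
  obtain z where "z \<in> carrier (tensor_free A M)" "t = tensor_class R A M z"
    using assms(3) unfolding carrier_tensor by blast
  then have "t \<subseteq> carrier (tensor_free A M)"
    using tensor_class_subset[OF assms(1,2)] by blast
  from subsetD[OF this] have "Poly_Mapping.keys w \<subseteq> carrier A \<times> carrier M" if "w \<in> t" for w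
    using that by simp
  then have "tensor_lift g f w = tensor_lift g' f' w" if "w \<in> t" for w
    using that assms(4,5) by (intro frag_extend_eq) fastforce
  then show ?thesis unfolding tensor_map_def by simp
qed

lemma tensor_lift_lift: "tensor_lift g' f' (tensor_lift g f z) = tensor_lift (\<lambda>a. g' (g a)) (\<lambda>m. f' (f m)) z"
  using subset_UNIV by (induction z rule: frag_induction) (auto simp: frag_extend_diff)

lemma tensor_map_comp:
  assumes "bimodule S R A" "left_module R L" "bimodule T R B" "left_module R M" "bimodule U R C" "left_module R N"
    and c: "tensor_compatible R A L B M g f" "tensor_compatible R B M C N g' f'"
    and t: "t \<in> carrier (tensor R A L)"
  shows "tensor_map R B M C N g' f' (tensor_map R A L B M g f t) =
    tensor_map R A L C N (\<lambda>a. g' (g a)) (\<lambda>m. f' (f m)) t"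
proof -
  have c': "tensor_compatible R A L C N (\<lambda>a. g' (g a)) (\<lambda>m. f' (f m))"
    using c unfolding tensor_compatible_def left_module_hom_def hom_def by (auto simp: Pi_iff)
  obtain z where z: "z \<in> carrier (tensor_free A L)" "t = tensor_class R A L z"
    using t unfolding carrier_tensor by blast
  show ?thesis
    unfolding z(2) tensor_map_class[OF assms(1-4) c(1) z(1)] tensor_map_class[OF assms(1,2,5,6) c' z(1)]
      tensor_map_class[OF assms(3-6) c(2) tensor_lift_closed[OF c(1) z(1)]] tensor_lift_lift ..
qed

lemma tensor_map_id:
  assumes "bimodule S R A" "left_module R M" "t \<in> carrier (tensor R A M)"
  shows "tensor_map R A M A M (\<lambda>a. a) (\<lambda>m. m) t = t"
proof -
  have c: "tensor_compatible R A M A M (\<lambda>a. a) (\<lambda>m. m)"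
    unfolding tensor_compatible_def left_module_hom_def hom_def by auto
  obtain z where z: "z \<in> carrier (tensor_free A M)" "t = tensor_class R A M z"
    using assms(3) unfolding carrier_tensor by blast
  have "tensor_lift (\<lambda>a. a) (\<lambda>m. m) z = frag_extend frag_of z"
    by (rule frag_extend_eq) auto
  also have "\<dots> = z" by (rule frag_expansion[symmetric])
  finally have "tensor_lift (\<lambda>a. a) (\<lambda>m. m) z = z" .
  then show ?thesis
    unfolding z(2) tensor_map_class[OF assms(1,2,1,2) c z(1)] by simp
qed

lemma tensor_map_hom:
  assumes "bimodule S R A" "left_module R M" "bimodule T R B" "left_module R N"
    and c: "tensor_compatible R A M B N g f"
  shows "tensor_map R A M B N g f \<in> hom (add_monoid (tensor R A M)) (add_monoid (tensor R B N))"
proof (rule homI)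
  fix t assume "t \<in> carrier (add_monoid (tensor R A M))"
  then show "tensor_map R A M B N g f t \<in> carrier (add_monoid (tensor R B N))"
    using tensor_map_class[OF assms] tensor_lift_closed[OF c] by (auto simp: carrier_tensor)
next
  fix t u assume "t \<in> carrier (add_monoid (tensor R A M))" "u \<in> carrier (add_monoid (tensor R A M))"
  then obtain z w where z: "z \<in> carrier (tensor_free A M)" "t = tensor_class R A M z"
    and w: "w \<in> carrier (tensor_free A M)" "u = tensor_class R A M w"
    by (auto simp: carrier_tensor)
  have zw: "z + w \<in> carrier (tensor_free A M)"
    using z w keys_add[of z w] by auto
  show "tensor_map R A M B N g f (t \<otimes>\<^bsub>add_monoid (tensor R A M)\<^esub> u) =
      tensor_map R A M B N g f t \<otimes>\<^bsub>add_monoid (tensor R B N)\<^esub> tensor_map R A M B N g f u"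
    using z w zw by (simp add: tensor_class_add[OF assms(1,2)] tensor_class_add[OF assms(3,4)]
        tensor_map_class[OF assms] tensor_lift_closed[OF c] frag_extend_add del: carrier_free_Abelian_group_iff)
qed

section \<open>Generation by pure tensors\<close>

lemma tensor_induct [consumes 1, case_names zero generator diff]:
  assumes "t \<in> carrier (tensor R A M)"
    and zero: "P (tensor_class R A M 0)"
    and gen: "\<And>a m. \<lbrakk>a \<in> carrier A; m \<in> carrier M\<rbrakk> \<Longrightarrow> P (tensor_class R A M (frag_of (a, m)))"
    and diff: "\<And>z w. \<lbrakk>z \<in> carrier (tensor_free A M); w \<in> carrier (tensor_free A M);
      P (tensor_class R A M z); P (tensor_class R A M w)\<rbrakk> \<Longrightarrow> P (tensor_class R A M (z - w))"
  shows "P t"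
proof -
  obtain z where z: "z \<in> carrier (tensor_free A M)" and t: "t = tensor_class R A M z"
    using assms(1) unfolding carrier_tensor by blast
  have "Poly_Mapping.keys z \<subseteq> carrier A \<times> carrier M" using z by simp
  then have "z \<in> carrier (tensor_free A M) \<and> P (tensor_class R A M z)"
  proof (induction z rule: frag_induction)
    case (diff a b)
    then show ?case using assms(4) keys_diff[of a b] by auto
  qed (auto simp: zero gen)
  then show ?thesis using t by blast
qed

lemma tensor_hom_diff:
  assumes "bimodule S R A" "left_module R M" "abelian_group H"
    and u: "u \<in> hom (add_monoid (tensor R A M)) (add_monoid H)"
    and z: "z \<in> carrier (tensor_free A M)" and w: "w \<in> carrier (tensor_free A M)"
  shows "u (tensor_class R A M (z - w)) = u (tensor_class R A M z) \<ominus>\<^bsub>H\<^esub> u (tensor_class R A M w)"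
proof -
  interpret H: abelian_group H by fact
  have zw: "z - w \<in> carrier (tensor_free A M)"
    using z w keys_diff[of z w] by auto
  have c: "u (tensor_class R A M v) \<in> carrier H" if "v \<in> carrier (tensor_free A M)" for v
    using hom_in_carrier[OF u] tensor_class_closed[OF that, of R] by simp
  have "u (tensor_class R A M (z - w + w)) = u (tensor_class R A M (z - w)) \<oplus>\<^bsub>H\<^esub> u (tensor_class R A M w)"
    using hom_mult[OF u, of "tensor_class R A M (z - w)" "tensor_class R A M w"]
      tensor_class_closed[OF zw, of R] tensor_class_closed[OF w, of R]
      tensor_class_add[OF assms(1,2) zw w] by simp
  then show ?thesis
    using c[OF zw] c[OF w] by (simp add: H.minus_eq H.a_assoc H.r_neg)
qed

lemma tensor_hom_zero:
  assumes "bimodule S R A" "left_module R M" "abelian_group H"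
    and u: "u \<in> hom (add_monoid (tensor R A M)) (add_monoid H)"
  shows "u (tensor_class R A M 0) = \<zero>\<^bsub>H\<^esub>"
proof -
  interpret H: abelian_group H by fact
  have z: "0 \<in> carrier (tensor_free A M)" by simp
  show ?thesis
    using tensor_hom_diff[OF assms z z] hom_in_carrier[OF u, of "tensor_class R A M 0"]
      tensor_class_closed[OF z, of R] by (simp add: H.minus_eq H.r_neg)
qed

text \<open>The uniqueness half of the universal property: pure tensors generate the tensor product
  under differences.\<close>

lemma tensor_hom_eqI:
  assumes "bimodule S R A" "left_module R M" "abelian_group H"
    and u: "u \<in> hom (add_monoid (tensor R A M)) (add_monoid H)"
    and v: "v \<in> hom (add_monoid (tensor R A M)) (add_monoid H)"
    and gen: "\<And>a m. \<lbrakk>a \<in> carrier A; m \<in> carrier M\<rbrakk> \<Longrightarrow>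
      u (tensor_class R A M (frag_of (a, m))) = v (tensor_class R A M (frag_of (a, m)))"
    and t: "t \<in> carrier (tensor R A M)"
  shows "u t = v t"
  using t
proof (induction rule: tensor_induct)
  case zero
  then show ?case using tensor_hom_zero[OF assms(1-3) u] tensor_hom_zero[OF assms(1-3) v] by simp
next
  case (generator a m)
  then show ?case by (rule gen)
next
  case (diff z w)
  then show ?case using tensor_hom_diff[OF assms(1-3) u] tensor_hom_diff[OF assms(1-3) v] by simp
qed

text \<open>Used to see that a structure map sends tensors over a subfamily back into that
  subfamily.\<close>

lemma tensor_hom_range:
  assumes "bimodule S R A" "left_module R M" "abelian_group H"
    and u: "u \<in> hom (add_monoid (tensor R A M)) (add_monoid H)"
    and K: "\<zero>\<^bsub>H\<^esub> \<in> K" "\<And>a b. \<lbrakk>a \<in> K; b \<in> K\<rbrakk> \<Longrightarrow> a \<ominus>\<^bsub>H\<^esub> b \<in> K"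
    and gen: "\<And>a m. \<lbrakk>a \<in> carrier A; m \<in> carrier M\<rbrakk> \<Longrightarrow> u (tensor_class R A M (frag_of (a, m))) \<in> K"
    and t: "t \<in> carrier (tensor R A M)"
  shows "u t \<in> K"
  using t
proof (induction rule: tensor_induct)
  case zero
  then show ?case using tensor_hom_zero[OF assms(1-4)] K by simp
next
  case (generator a m)
  then show ?case by (rule gen)
next
  case (diff z w)
  then show ?case using tensor_hom_diff[OF assms(1-4)] K by metis
qed

section \<open>Representations as operator families\<close>

definition rep_act ::
    "('c, 'r, 'a) species \<Rightarrow> ('c, 'r, 'a, 'm) rep \<Rightarrow> 'c \<Rightarrow> 'c \<Rightarrow> 'a \<Rightarrow> 'm \<Rightarrow> 'm" where
  "rep_act S M y x a m =
    rmap M y x (tensor_class (vring S x) (arrow S y x) (rmod M x) (frag_of (a, m)))"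

text \<open>Scalars are included as loops, so that invariance covers being a submodule and
  commutation covers linearity; \<open>sub\<close> and \<open>endo\<close> then mean
  subrepresentation and endomorphism.\<close>

definition rep_ops ::
    "('c, 'r, 'a) species \<Rightarrow> ('c, 'r, 'a, 'm) rep \<Rightarrow> 'c \<Rightarrow> 'c \<Rightarrow> ('m \<Rightarrow> 'm) set" where
  "rep_ops S M y x = rep_act S M y x ` carrier (arrow S y x) \<union>
    (if y = x then (\<lambda>r m. r \<odot>\<^bsub>rmod M x\<^esub> m) ` carrier (vring S x) else {})"

text \<open>Tensoring need not preserve injectivity, and the cosets over \<open>P x\<close> live in
  a smaller free group. Hence the structure map cannot simply be restricted; it passes through the
  tensor map of the inclusion.\<close>

definition subrep ::
    "('c, 'r, 'a) species \<Rightarrow> ('c, 'r, 'a, 'm) rep \<Rightarrow> ('c \<Rightarrow> 'm set) \<Rightarrow> ('c, 'r, 'a, 'm) rep" where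
  "subrep S M P =
    \<lparr>rmod = (\<lambda>x. (rmod M x)\<lparr>carrier := P x\<rparr>),
     rmap = (\<lambda>y x t. rmap M y x (tensor_map (vring S x)
       (arrow S y x) ((rmod M x)\<lparr>carrier := P x\<rparr>) (arrow S y x) (rmod M x) (\<lambda>a. a) (\<lambda>m. m) t))\<rparr>"

lemma left_module_homI:
  assumes "\<And>m. m \<in> carrier M \<Longrightarrow> f m \<in> carrier N"
    and "\<And>m n. \<lbrakk>m \<in> carrier M; n \<in> carrier M\<rbrakk> \<Longrightarrow> f (m \<oplus>\<^bsub>M\<^esub> n) = f m \<oplus>\<^bsub>N\<^esub> f n"
    and "\<And>r m. \<lbrakk>r \<in> carrier R; m \<in> carrier M\<rbrakk> \<Longrightarrow> f (r \<odot>\<^bsub>M\<^esub> m) = r \<odot>\<^bsub>N\<^esub> f m"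
  shows "f \<in> left_module_hom R M N"
  using assms unfolding left_module_hom_def hom_def by simp

lemma
  assumes "f \<in> left_module_hom R M N"
  shows left_module_hom_hom: "f \<in> hom (add_monoid M) (add_monoid N)"
    and left_module_hom_closed: "m \<in> carrier M \<Longrightarrow> f m \<in> carrier N"
    and left_module_hom_add: "\<lbrakk>m \<in> carrier M; n \<in> carrier M\<rbrakk> \<Longrightarrow> f (m \<oplus>\<^bsub>M\<^esub> n) = f m \<oplus>\<^bsub>N\<^esub> f n"
    and left_module_hom_smult: "\<lbrakk>r \<in> carrier R; m \<in> carrier M\<rbrakk> \<Longrightarrow> f (r \<odot>\<^bsub>M\<^esub> m) = r \<odot>\<^bsub>N\<^esub> f m"
  using assms unfolding left_module_hom_def hom_def by auto

lemma tensor_compatible_id_left: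
  "f \<in> left_module_hom R M N \<Longrightarrow> tensor_compatible R A M A N (\<lambda>a. a) f"
  unfolding tensor_compatible_def hom_def by auto

lemma left_module_submodule:
  assumes M: "left_module R M" and K: "submodule K R M"
  shows "left_module R (M\<lparr>carrier := K\<rparr>)"
proof -
  interpret M: left_module R M by fact
  interpret K: submodule K R M by fact
  have c: "m \<in> carrier M" if "m \<in> K" for m using that K.subset by auto
  have "abelian_group (M\<lparr>carrier := K\<rparr>)"
  proof (rule abelian_groupI)
    fix x assume "x \<in> carrier (M\<lparr>carrier := K\<rparr>)"
    then show "\<exists>y\<in>carrier (M\<lparr>carrier := K\<rparr>). y \<oplus>\<^bsub>M\<lparr>carrier := K\<rparr>\<^esub> x = \<zero>\<^bsub>M\<lparr>carrier := K\<rparr>\<^esub>"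
      using K.m_inv_closed[of x] M.M.l_neg[of x] c
      by (intro bexI[of _ "\<ominus>\<^bsub>M\<^esub> x"]) (simp_all add: a_inv_def)
  qed (use K.m_closed K.one_closed c in \<open>auto simp: M.M.a_assoc intro: M.M.a_comm\<close>)
  then show ?thesis
    using M.smult_closed M.smult_l_distr M.smult_r_distr M.smult_assoc M.smult_one c
    by (intro left_module.intro left_module_axioms.intro) (auto simp: M.R.ring_axioms)
qed

locale species_rep = species S for S :: "('c, 'r, 'a) species" +
  fixes M :: "('c, 'r, 'a, 'm) rep"
  assumes representation: "representation S M"
begin

abbreviation "V \<equiv> vertices S"
abbreviation "ten N y x \<equiv> tensor (vring S x) (arrow S y x) N"

lemma
  assumes "x \<in> V"
  shows left_module_rmod: "left_module (vring S x) (rmod M x)"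
    and rmap_hom: "y \<in> V \<Longrightarrow> rmap M y x \<in> left_module_hom (vring S y) (ten (rmod M x) y x) (rmod M y)"
  using assms representation unfolding representation_def by blast+

lemma abelian_group_rmod: "x \<in> V \<Longrightarrow> abelian_group (rmod M x)"
  using left_module_rmod left_module.axioms by blast

lemma rep_act_closed:
  assumes "x \<in> V" "y \<in> V" "a \<in> carrier (arrow S y x)" "m \<in> carrier (rmod M x)"
  shows "rep_act S M y x a m \<in> carrier (rmod M y)"
  unfolding rep_act_def using assms
  by (intro left_module_hom_closed[OF rmap_hom] tensor_class_closed) auto

lemma rep_act_add:
  assumes x: "x \<in> V" and y: "y \<in> V" and a: "a \<in> carrier (arrow S y x)"
    and m: "m \<in> carrier (rmod M x)" and n: "n \<in> carrier (rmod M x)"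
  shows "rep_act S M y x a (m \<oplus>\<^bsub>rmod M x\<^esub> n) = rep_act S M y x a m \<oplus>\<^bsub>rmod M y\<^esub> rep_act S M y x a n"
proof -
  let ?c = "tensor_class (vring S x) (arrow S y x) (rmod M x)"
  let ?F = "tensor_free (arrow S y x) (rmod M x)"
  note AM = bimodule_arrow[OF x y] left_module_rmod[OF x]
  interpret X: left_module "vring S x" "rmod M x" by (rule left_module_rmod) fact
  have F: "frag_of (a, m) \<in> carrier ?F" "frag_of (a, n) \<in> carrier ?F" "frag_of (a, m \<oplus>\<^bsub>rmod M x\<^esub> n) \<in> carrier ?F"
    using a m n by auto
  have F': "frag_of (a, m) + frag_of (a, n) \<in> carrier ?F"
    using a m n keys_add[of "frag_of (a, m)" "frag_of (a, n)"] by auto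
  have "?c (frag_of (a, m \<oplus>\<^bsub>rmod M x\<^esub> n)) = ?c (frag_of (a, m) + frag_of (a, n))"
    using tensor_rels_right[OF a m n] by (intro tensor_class_eqI[OF AM F(3) F']) (simp add: diff_diff_eq)
  also have "\<dots> = ?c (frag_of (a, m)) \<oplus>\<^bsub>ten (rmod M x) y x\<^esub> ?c (frag_of (a, n))"
    using tensor_class_add[OF AM F(1,2)] by simp
  finally show ?thesis
    unfolding rep_act_def
    using left_module_hom_add[OF rmap_hom[OF x y]] tensor_class_closed[OF F(1), of "vring S x"]
      tensor_class_closed[OF F(2), of "vring S x"] by simp
qed

lemma op_family: "op_family V (rmod M) (rep_ops S M)"
proof (rule op_family.intro)
  fix x y h m assume xy: "x \<in> V" "y \<in> V" and h: "h \<in> rep_ops S M y x" and m: "m \<in> carrier (rmod M x)"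
  then show "h m \<in> carrier (rmod M y)"
    using rep_act_closed left_module.smult_closed[OF left_module_rmod]
    by (auto simp: rep_ops_def split: if_splits)
  fix n assume n: "n \<in> carrier (rmod M x)"
  show "h (m \<oplus>\<^bsub>rmod M x\<^esub> n) = h m \<oplus>\<^bsub>rmod M y\<^esub> h n"
    using h rep_act_add[OF xy _ m n] left_module.smult_r_distr[OF left_module_rmod _ m n] xy
    by (auto simp: rep_ops_def split: if_splits)
qed (rule abelian_group_rmod)

sublocale op_family V "rmod M" "rep_ops S M"
  by (rule op_family)

lemma act_in_ops: "a \<in> carrier (arrow S y x) \<Longrightarrow> rep_act S M y x a \<in> rep_ops S M y x"
  unfolding rep_ops_def by blast

lemma smult_in_ops: "r \<in> carrier (vring S x) \<Longrightarrow> (\<lambda>m. r \<odot>\<^bsub>rmod M x\<^esub> m) \<in> rep_ops S M x x"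
  unfolding rep_ops_def by auto

lemma sub_submodule:
  assumes "sub P" "x \<in> V"
  shows "submodule (P x) (vring S x) (rmod M x)"
proof -
  interpret X: left_module "vring S x" "rmod M x" by (rule left_module_rmod) fact
  show ?thesis
    unfolding X.submodule_iff
    using sub_carrier[OF assms] sub_zero[OF assms] sub_diff[OF assms]
      sub_op[OF assms assms(2) smult_in_ops] by blast
qed

lemma endo_iff:
  "endo P f \<longleftrightarrow>
    (\<forall>x\<in>V. \<forall>m\<in>P x. f x m \<in> P x) \<and>
    (\<forall>x\<in>V. \<forall>m\<in>P x. \<forall>n\<in>P x. f x (m \<oplus>\<^bsub>rmod M x\<^esub> n) = f x m \<oplus>\<^bsub>rmod M x\<^esub> f x n) \<and>
    (\<forall>x\<in>V. \<forall>r\<in>carrier (vring S x). \<forall>m\<in>P x. f x (r \<odot>\<^bsub>rmod M x\<^esub> m) = r \<odot>\<^bsub>rmod M x\<^esub> f x m) \<and>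
    (\<forall>x\<in>V. \<forall>y\<in>V. \<forall>a\<in>carrier (arrow S y x). \<forall>m\<in>P x.
      f y (rep_act S M y x a m) = rep_act S M y x a (f x m))"
proof -
  have *: "(\<forall>x\<in>V. \<forall>y\<in>V. \<forall>h\<in>rep_ops S M y x. \<forall>m\<in>P x. f y (h m) = h (f x m)) \<longleftrightarrow>
    (\<forall>x\<in>V. \<forall>r\<in>carrier (vring S x). \<forall>m\<in>P x. f x (r \<odot>\<^bsub>rmod M x\<^esub> m) = r \<odot>\<^bsub>rmod M x\<^esub> f x m) \<and>
    (\<forall>x\<in>V. \<forall>y\<in>V. \<forall>a\<in>carrier (arrow S y x). \<forall>m\<in>P x.
      f y (rep_act S M y x a m) = rep_act S M y x a (f x m))"
    unfolding rep_ops_def by (auto split: if_splits)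
  show ?thesis unfolding endo_def * ..
qed

text \<open>Both sides are additive in \<open>t\<close> and agree on pure tensors, where the claim
  is compatibility with one operator.\<close>

lemma rmap_natural:
  assumes f: "endo whole f" and x: "x \<in> V" and y: "y \<in> V" and t: "t \<in> carrier (ten (rmod M x) y x)"
  shows "rmap M y x (tensor_map (vring S x) (arrow S y x) (rmod M x) (arrow S y x) (rmod M x) (\<lambda>a. a) (f x) t) =
    f y (rmap M y x t)"
proof -
  note AM = bimodule_arrow[OF x y] left_module_rmod[OF x]
  have fx: "f z \<in> left_module_hom (vring S z) (rmod M z) (rmod M z)" if "z \<in> V" for z
    using f that unfolding endo_iff by (intro left_module_homI) blast+
  note c = tensor_compatible_id_left[OF fx[OF x], where A = "arrow S y x"]
  show ?thesis
  proof (rule tensor_hom_eqI[OF AM abelian_group_rmod[OF y] _ _ _ t])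
    show "(\<lambda>t. rmap M y x (tensor_map (vring S x) (arrow S y x) (rmod M x) (arrow S y x) (rmod M x) (\<lambda>a. a) (f x) t))
        \<in> hom (add_monoid (ten (rmod M x) y x)) (add_monoid (rmod M y))"
      using hom_compose[OF tensor_map_hom[OF AM AM c] left_module_hom_hom[OF rmap_hom[OF x y]]]
      by (simp add: o_def)
    show "(\<lambda>t. f y (rmap M y x t)) \<in> hom (add_monoid (ten (rmod M x) y x)) (add_monoid (rmod M y))"
      using hom_compose[OF left_module_hom_hom[OF rmap_hom[OF x y]] left_module_hom_hom[OF fx[OF y]]]
      by (simp add: o_def)
    fix a m assume am: "a \<in> carrier (arrow S y x)" "m \<in> carrier (rmod M x)"
    then have F: "frag_of (a, m) \<in> carrier (tensor_free (arrow S y x) (rmod M x))" by simp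
    show "rmap M y x (tensor_map (vring S x) (arrow S y x) (rmod M x) (arrow S y x) (rmod M x) (\<lambda>a. a) (f x)
          (tensor_class (vring S x) (arrow S y x) (rmod M x) (frag_of (a, m)))) =
        f y (rmap M y x (tensor_class (vring S x) (arrow S y x) (rmod M x) (frag_of (a, m))))"
      unfolding tensor_map_class[OF AM AM c F]
      using f am x y unfolding endo_iff rep_act_def by simp
  qed
qed

section \<open>Endomorphisms of a representation and their ring\<close>

text \<open>Evaluation on pure tensors turns compatibility with the structure maps into
  compatibility with the operators; \<open>rmap_natural\<close> goes back. Extensionality accounts
  for the canonical choice of functions.\<close>

lemma rep_hom_self_iff:
  "f \<in> rep_hom S M M \<longleftrightarrow>
    f \<in> extensional V \<and> (\<forall>x\<in>V. f x \<in> extensional (carrier (rmod M x))) \<and> endo whole f"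
proof
  assume f: "f \<in> rep_hom S M M"
  have lin: "f x \<in> left_module_hom (vring S x) (rmod M x) (rmod M x)" if "x \<in> V" for x
    using f that unfolding rep_hom_def by blast
  have act: "f y (rep_act S M y x a m) = rep_act S M y x a (f x m)"
    if x: "x \<in> V" and y: "y \<in> V" and a: "a \<in> carrier (arrow S y x)" and m: "m \<in> carrier (rmod M x)" for x y a m
  proof -
    note AM = bimodule_arrow[OF x y] left_module_rmod[OF x]
    have F: "frag_of (a, m) \<in> carrier (tensor_free (arrow S y x) (rmod M x))" using a m by simp
    have "rmap M y x (tensor_map (vring S x) (arrow S y x) (rmod M x) (arrow S y x) (rmod M x) (\<lambda>a. a) (f x) t) =
        f y (rmap M y x t)" if "t \<in> carrier (ten (rmod M x) y x)" for t
      using f x y that unfolding rep_hom_def by blast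
    from this[OF tensor_class_closed[OF F]] show ?thesis
      unfolding tensor_map_class[OF AM AM tensor_compatible_id_left[OF lin[OF x]] F] rep_act_def
      by simp
  qed
  have "endo whole f"
    unfolding endo_iff
    using left_module_hom_closed[OF lin] left_module_hom_add[OF lin] left_module_hom_smult[OF lin] act
    by blast
  then show "f \<in> extensional V \<and> (\<forall>x\<in>V. f x \<in> extensional (carrier (rmod M x))) \<and> endo whole f"
    using f unfolding rep_hom_def PiE_def by blast
next
  assume f: "f \<in> extensional V \<and> (\<forall>x\<in>V. f x \<in> extensional (carrier (rmod M x))) \<and> endo whole f"
  then have "f x \<in> left_module_hom (vring S x) (rmod M x) (rmod M x)" if "x \<in> V" for x
    using that unfolding endo_iff by (intro left_module_homI) blast+
  then show "f \<in> rep_hom S M M"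
    using f rmap_natural unfolding rep_hom_def by (simp add: PiE_def Pi_iff)
qed

lemma rep_hom_eqI:
  assumes "f \<in> rep_hom S M M" "g \<in> rep_hom S M M"
    and "\<And>x m. \<lbrakk>x \<in> V; m \<in> carrier (rmod M x)\<rbrakk> \<Longrightarrow> f x m = g x m"
  shows "f = g"
proof (rule extensionalityI)
  show "f \<in> extensional V" "g \<in> extensional V"
    using assms unfolding rep_hom_self_iff by blast+
  show "f x = g x" if "x \<in> V" for x
    using assms that unfolding rep_hom_self_iff by (metis extensionalityI)
qed

lemma rep_hom_restrict:
  assumes "endo whole f"
  shows "(\<lambda>x\<in>V. \<lambda>m\<in>carrier (rmod M x). f x m) \<in> rep_hom S M M"
  unfolding rep_hom_self_iff
proof (intro conjI ballI)
  show "endo whole (\<lambda>x\<in>V. \<lambda>m\<in>carrier (rmod M x). f x m)"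
    using assms unfolding endo_def by (simp add: add_closed op_closed)
qed auto

lemma endo_add_fun:
  assumes "sub P" "endo P f" "endo P g"
  shows "endo P (\<lambda>x m. f x m \<oplus>\<^bsub>rmod M x\<^esub> g x m)"
  unfolding endo_def
proof (intro conjI ballI)
  fix x m assume x: "x \<in> V" and m: "m \<in> P x"
  show "f x m \<oplus>\<^bsub>rmod M x\<^esub> g x m \<in> P x"
    using assms x m endo_closed sub_add by metis
  have c: "f x n \<in> carrier (rmod M x)" "g x n \<in> carrier (rmod M x)" if "n \<in> P x" for n
    using assms x that endo_closed sub_carrier by blast+
  interpret X: abelian_group "rmod M x" by (rule abelian_group_rmod) fact
  show "f x (m \<oplus>\<^bsub>rmod M x\<^esub> n) \<oplus>\<^bsub>rmod M x\<^esub> g x (m \<oplus>\<^bsub>rmod M x\<^esub> n) =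
      (f x m \<oplus>\<^bsub>rmod M x\<^esub> g x m) \<oplus>\<^bsub>rmod M x\<^esub> (f x n \<oplus>\<^bsub>rmod M x\<^esub> g x n)" if n: "n \<in> P x" for n
    using endo_add[OF assms(2) x m n] endo_add[OF assms(3) x m n] c[OF m] c[OF n]
    by (simp add: X.a_ac)
  show "f y (h m) \<oplus>\<^bsub>rmod M y\<^esub> g y (h m) = h (f x m \<oplus>\<^bsub>rmod M x\<^esub> g x m)"
    if "y \<in> V" "h \<in> rep_ops S M y x" for y h
    using endo_op[OF assms(2) x that m] endo_op[OF assms(3) x that m] op_add[OF x that] c[OF m] by simp
qed

lemma ring_rep_End: "ring (rep_End S M)"
proof -
  let ?E = "rep_End S M"
  have carrier_E: "carrier ?E = rep_hom S M M" unfolding rep_End_def by simp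
  have endo: "endo whole f" if "f \<in> carrier ?E" for f
    using that unfolding carrier_E rep_hom_self_iff by blast
  have add_app: "(f \<oplus>\<^bsub>?E\<^esub> g) x m = f x m \<oplus>\<^bsub>rmod M x\<^esub> g x m"
    and mult_app: "(f \<otimes>\<^bsub>?E\<^esub> g) x m = f x (g x m)"
    and one_app: "\<one>\<^bsub>?E\<^esub> x m = m"
    and zero_app: "\<zero>\<^bsub>?E\<^esub> x m = \<zero>\<^bsub>rmod M x\<^esub>"
    if "x \<in> V" "m \<in> carrier (rmod M x)" for f g x m
    using that by (simp_all add: rep_End_def rep_comp_def rep_id_def compose_def)
  have app: "f x m \<in> carrier (rmod M x)" if "f \<in> carrier ?E" "x \<in> V" "m \<in> carrier (rmod M x)" for f x m
    using endo_closed[OF endo[OF that(1)] that(2,3)] .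
  have eqI: "f = g" if "f \<in> carrier ?E" "g \<in> carrier ?E"
    "\<And>x m. \<lbrakk>x \<in> V; m \<in> carrier (rmod M x)\<rbrakk> \<Longrightarrow> f x m = g x m" for f g
    using rep_hom_eqI that unfolding carrier_E by blast
  have add: "f \<oplus>\<^bsub>?E\<^esub> g \<in> carrier ?E" if "f \<in> carrier ?E" "g \<in> carrier ?E" for f g
    using rep_hom_restrict[OF endo_add_fun[OF sub_whole endo endo]] that
    by (simp add: rep_End_def)
  have mult: "f \<otimes>\<^bsub>?E\<^esub> g \<in> carrier ?E" if "f \<in> carrier ?E" "g \<in> carrier ?E" for f g
    using rep_hom_restrict[OF endo_comp[OF sub_whole endo endo]] that
    by (simp add: rep_End_def rep_comp_def compose_def)
  have one: "\<one>\<^bsub>?E\<^esub> \<in> carrier ?E"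
    using rep_hom_restrict[OF endo_id] by (simp add: rep_End_def rep_id_def)
  have diff: "(\<lambda>x\<in>V. \<lambda>m\<in>carrier (rmod M x). f x m \<ominus>\<^bsub>rmod M x\<^esub> g x m) \<in> carrier ?E"
    if "f \<in> carrier ?E" "g \<in> carrier ?E" for f g
    using rep_hom_restrict[OF endo_diff_fun[OF sub_whole endo endo]] that
    by (simp add: rep_End_def)
  \<comment> \<open>The zero map is obtained as \<open>1 - 1\<close>, so that the closure of
    endomorphisms under differences covers it; negatives below arise as
    \<open>0 - f\<close>.\<close>
  have zero: "\<zero>\<^bsub>?E\<^esub> \<in> carrier ?E"
  proof -
    have "(\<lambda>x\<in>V. \<lambda>m\<in>carrier (rmod M x). \<one>\<^bsub>?E\<^esub> x m \<ominus>\<^bsub>rmod M x\<^esub> \<one>\<^bsub>?E\<^esub> x m) = \<zero>\<^bsub>?E\<^esub>"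
      by (intro ext) (auto simp: rep_End_def rep_id_def diff_self)
    then show ?thesis using diff[OF one one] by simp
  qed
  show ?thesis
  proof (rule ringI)
    show "abelian_group ?E"
    proof (rule abelian_groupI)
      fix f g h assume f: "f \<in> carrier ?E" and g: "g \<in> carrier ?E" and h: "h \<in> carrier ?E"
      show "f \<oplus>\<^bsub>?E\<^esub> g \<in> carrier ?E" by (rule add[OF f g])
      show "f \<oplus>\<^bsub>?E\<^esub> g \<oplus>\<^bsub>?E\<^esub> h = f \<oplus>\<^bsub>?E\<^esub> (g \<oplus>\<^bsub>?E\<^esub> h)"
        by (rule eqI) (simp_all add: add f g h add_app app abelian_groupE(3)[OF abelian_group_rmod])
      show "f \<oplus>\<^bsub>?E\<^esub> g = g \<oplus>\<^bsub>?E\<^esub> f"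
        by (rule eqI) (simp_all add: add f g add_app app abelian_groupE(4)[OF abelian_group_rmod])
      show "\<zero>\<^bsub>?E\<^esub> \<oplus>\<^bsub>?E\<^esub> f = f"
        by (rule eqI) (simp_all add: add f zero add_app zero_app app abelian_groupE(5)[OF abelian_group_rmod])
      let ?n = "\<lambda>x\<in>V. \<lambda>m\<in>carrier (rmod M x). \<zero>\<^bsub>?E\<^esub> x m \<ominus>\<^bsub>rmod M x\<^esub> f x m"
      have n: "?n \<in> carrier ?E" by (rule diff[OF zero f])
      have "?n \<oplus>\<^bsub>?E\<^esub> f = \<zero>\<^bsub>?E\<^esub>"
        by (rule eqI[OF add[OF n f] zero])
          (simp add: add_app zero_app diff_add_cancel zero_closed app f)
      then show "\<exists>n\<in>carrier ?E. n \<oplus>\<^bsub>?E\<^esub> f = \<zero>\<^bsub>?E\<^esub>" using n by blast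
    qed (rule zero)
    show "monoid ?E"
      by (rule monoidI) (simp_all add: mult one eqI mult_app one_app app)
    fix f g h assume f: "f \<in> carrier ?E" and g: "g \<in> carrier ?E" and h: "h \<in> carrier ?E"
    show "(f \<oplus>\<^bsub>?E\<^esub> g) \<otimes>\<^bsub>?E\<^esub> h = f \<otimes>\<^bsub>?E\<^esub> h \<oplus>\<^bsub>?E\<^esub> g \<otimes>\<^bsub>?E\<^esub> h"
      by (rule eqI) (simp_all add: add mult f g h add_app mult_app app)
    show "h \<otimes>\<^bsub>?E\<^esub> (f \<oplus>\<^bsub>?E\<^esub> g) = h \<otimes>\<^bsub>?E\<^esub> f \<oplus>\<^bsub>?E\<^esub> h \<otimes>\<^bsub>?E\<^esub> g"
      by (rule eqI) (simp_all add: add mult f g h add_app mult_app app endo_add[OF endo])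
  qed
qed

text \<open>The inverse functions at the vertices inherit additivity and compatibility with the
  operators from \<open>f\<close>, hence form an endomorphism.\<close>

lemma bijective_Units:
  assumes f: "f \<in> rep_hom S M M" and bij: "\<And>x. x \<in> V \<Longrightarrow> bij_betw (f x) (carrier (rmod M x)) (carrier (rmod M x))"
  shows "f \<in> Units (rep_End S M)"
proof -
  define g where "g x = inv_into (carrier (rmod M x)) (f x)" for x
  have e: "endo whole f" using f rep_hom_self_iff by blast
  have gc: "g x m \<in> carrier (rmod M x)" and fg: "f x (g x m) = m" and gf: "g x (f x m) = m"
    if "x \<in> V" "m \<in> carrier (rmod M x)" for x m
    using bij[OF that(1)] that(2) unfolding g_def
    by (auto simp: bij_betw_def inv_into_into f_inv_into_f inv_into_f_f)
  have g: "endo whole g"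
    unfolding endo_def
  proof (intro conjI ballI)
    fix x m assume x: "x \<in> V" and m: "m \<in> carrier (rmod M x)"
    show "g x m \<in> carrier (rmod M x)" by (rule gc) fact+
    show "g x (m \<oplus>\<^bsub>rmod M x\<^esub> n) = g x m \<oplus>\<^bsub>rmod M x\<^esub> g x n" if n: "n \<in> carrier (rmod M x)" for n
    proof -
      have "m \<oplus>\<^bsub>rmod M x\<^esub> n = f x (g x m \<oplus>\<^bsub>rmod M x\<^esub> g x n)"
        using endo_add[OF e x gc[OF x m] gc[OF x n]] fg x m n by simp
      then show ?thesis using gf x gc m n add_closed by simp
    qed
    show "g y (h m) = h (g x m)" if y: "y \<in> V" and h: "h \<in> rep_ops S M y x" for y h
    proof -
      have "h m = f y (h (g x m))"
        using endo_op[OF e x y h gc[OF x m]] fg x m by simp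
      then show ?thesis using gf[OF y] op_closed[OF x y h gc[OF x m]] by simp
    qed
  qed
  let ?g = "\<lambda>x\<in>V. \<lambda>m\<in>carrier (rmod M x). g x m"
  have G: "?g \<in> rep_hom S M M" by (rule rep_hom_restrict) fact
  have "rep_comp S M ?g f = rep_id S M" "rep_comp S M f ?g = rep_id S M"
    unfolding rep_comp_def rep_id_def compose_def
    using endo_closed[OF e] gf fg gc by (auto intro!: restrict_ext)
  then show ?thesis
    using f G unfolding Units_def rep_End_def by auto
qed

end

section \<open>Local endomorphism rings\<close>

text \<open>If \<open>a \<oplus> b\<close> has inverse \<open>v\<close>, then
  \<open>v \<otimes> a\<close> and \<open>v \<otimes> b\<close> sum to one, so one of them is a
  unit. Multiplying it on the left by the unit \<open>a \<oplus> b\<close> recovers \<open>a\<close>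
  or \<open>b\<close>, which is then a unit.\<close>

lemma (in ring) local_ringI:
  assumes "\<one> \<noteq> \<zero>"
    and unit: "\<And>a. a \<in> carrier R \<Longrightarrow> a \<in> Units R \<or> (\<exists>b\<in>Units R. a \<oplus> b = \<one>)"
  shows "local_ring R"
  unfolding local_ring_def
proof (intro conjI ballI impI)
  fix a b assume a: "a \<in> carrier R" and b: "b \<in> carrier R" and nu: "a \<notin> Units R \<and> b \<notin> Units R"
  show "a \<oplus> b \<notin> Units R"
  proof
    assume u: "a \<oplus> b \<in> Units R"
    let ?v = "inv (a \<oplus> b)"
    have v: "?v \<in> carrier R" using u by simp
    have sum: "?v \<otimes> a \<oplus> ?v \<otimes> b = \<one>"
      using Units_l_inv[OF u] r_distr[OF a b v] by simp
    have mult: "c \<in> Units R" if "?v \<otimes> c \<in> Units R" "c \<in> carrier R" for c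
    proof -
      have "(a \<oplus> b) \<otimes> (?v \<otimes> c) = c"
        using u that(2) a b v by (simp flip: m_assoc)
      then show ?thesis using Units_m_closed[OF u that(1)] by simp
    qed
    from unit[of "?v \<otimes> a"] mult[of a] nu a v obtain c where c: "c \<in> Units R" "?v \<otimes> a \<oplus> c = \<one>"
      by auto
    have "c = ?v \<otimes> b"
    proof -
      have cc: "c \<in> carrier R" using c(1) by (rule Units_closed)
      have "c \<oplus> ?v \<otimes> a = ?v \<otimes> b \<oplus> ?v \<otimes> a"
        using c(2) sum cc a b v by (simp add: a_comm)
      then show ?thesis using cc a b v add.right_cancel by simp
    qed
    then show False using mult[of b] nu b c by simp
  qed
qed (use assms ring_axioms in auto)

context species_rep
begin

text \<open>The maps \<open>f\<close> and \<open>1 - f\<close> sum to one, so the dichotomy is the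
  criterion of \<open>local_ringI\<close>. It must select one alternative for all vertices at once,
  because a unit is bijective at every vertex.\<close>

lemma strongly_indecomposableI:
  assumes nz: "\<exists>x\<in>V. carrier (rmod M x) \<noteq> {\<zero>\<^bsub>rmod M x\<^esub>}"
    and bij: "\<And>f. endo whole f \<Longrightarrow>
      (\<forall>x\<in>V. bij_betw (f x) (carrier (rmod M x)) (carrier (rmod M x))) \<or>
      (\<forall>x\<in>V. bij_betw (\<lambda>m. m \<ominus>\<^bsub>rmod M x\<^esub> f x m) (carrier (rmod M x)) (carrier (rmod M x)))"
  shows "strongly_indecomposable S M"
  unfolding strongly_indecomposable_def
proof (rule ring.local_ringI[OF ring_rep_End])
  let ?E = "rep_End S M"
  obtain x m where x: "x \<in> V" "m \<in> carrier (rmod M x)" "m \<noteq> \<zero>\<^bsub>rmod M x\<^esub>"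
    using nz zero_closed by blast
  have "\<one>\<^bsub>?E\<^esub> x m \<noteq> \<zero>\<^bsub>?E\<^esub> x m"
    using x by (simp add: rep_End_def rep_id_def)
  then show "\<one>\<^bsub>?E\<^esub> \<noteq> \<zero>\<^bsub>?E\<^esub>" by metis
next
  let ?E = "rep_End S M"
  fix f assume "f \<in> carrier ?E"
  then have f: "f \<in> rep_hom S M M" by (simp add: rep_End_def)
  then have e: "endo whole f" using rep_hom_self_iff by blast
  let ?g = "\<lambda>x\<in>V. \<lambda>m\<in>carrier (rmod M x). m \<ominus>\<^bsub>rmod M x\<^esub> f x m"
  have g: "?g \<in> rep_hom S M M"
    by (rule rep_hom_restrict[OF endo_diff_fun[OF sub_whole endo_id e]])
  have "f \<oplus>\<^bsub>?E\<^esub> ?g = \<one>\<^bsub>?E\<^esub>"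
  proof -
    have "f x m \<oplus>\<^bsub>rmod M x\<^esub> (m \<ominus>\<^bsub>rmod M x\<^esub> f x m) = m" if "x \<in> V" "m \<in> carrier (rmod M x)" for x m
      using that diff_add_cancel[OF that endo_closed[OF e that]] endo_closed[OF e that]
        abelian_groupE(4)[OF abelian_group_rmod] diff_closed by metis
    then show ?thesis
      unfolding rep_End_def rep_id_def by (auto intro!: restrict_ext)
  qed
  moreover have "f \<in> Units ?E \<or> ?g \<in> Units ?E"
    using bij[OF e]
  proof
    assume "\<forall>x\<in>V. bij_betw (f x) (carrier (rmod M x)) (carrier (rmod M x))"
    then show ?thesis using bijective_Units[OF f] by blast
  next
    assume b: "\<forall>x\<in>V. bij_betw (\<lambda>m. m \<ominus>\<^bsub>rmod M x\<^esub> f x m) (carrier (rmod M x)) (carrier (rmod M x))"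
    have "bij_betw (?g x) (carrier (rmod M x)) (carrier (rmod M x))" if "x \<in> V" for x
      using b that by (subst bij_betw_cong[of _ _ "\<lambda>m. m \<ominus>\<^bsub>rmod M x\<^esub> f x m"]) auto
    then show ?thesis using bijective_Units[OF g] by blast
  qed
  ultimately show "f \<in> Units ?E \<or> (\<exists>b\<in>Units ?E. f \<oplus>\<^bsub>?E\<^esub> b = \<one>\<^bsub>?E\<^esub>)" by blast
qed

end

section \<open>Subrepresentations and direct sums\<close>

lemma tensor_compatible_smult:
  assumes "bimodule S R A" "s \<in> carrier S"
  shows "tensor_compatible R A M A M (\<lambda>a. s \<odot>\<^bsub>A\<^esub> a) (\<lambda>m. m)"
proof -
  interpret bimodule S R A by fact
  show ?thesis
    unfolding tensor_compatible_def left_module_hom_def hom_def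
    using assms(2) smult_closed smult_r_distr smult_rsmult by auto
qed

context species_rep
begin

lemma
  shows rmod_subrep [simp]: "rmod (subrep S M P) x = (rmod M x)\<lparr>carrier := P x\<rparr>"
    and rmap_subrep: "rmap (subrep S M P) y x t = rmap M y x (tensor_map (vring S x)
      (arrow S y x) ((rmod M x)\<lparr>carrier := P x\<rparr>) (arrow S y x) (rmod M x) (\<lambda>a. a) (\<lambda>m. m) t)"
  unfolding subrep_def by simp_all

context
  fixes P assumes P: "sub P"
begin

lemma left_module_subrep: "x \<in> V \<Longrightarrow> left_module (vring S x) ((rmod M x)\<lparr>carrier := P x\<rparr>)"
  by (intro left_module_submodule left_module_rmod sub_submodule[OF P])

lemma inclusion_compatible:
  assumes "x \<in> V"
  shows "tensor_compatible (vring S x) A ((rmod M x)\<lparr>carrier := P x\<rparr>) A (rmod M x) (\<lambda>a. a) (\<lambda>m. m)"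
  using sub_carrier[OF P assms] by (intro tensor_compatible_id_left left_module_homI) auto

text \<open>The tensor map of the inclusion sends a pure tensor to the one with the same entries, so
  the operators of the subrepresentation are restrictions of those of \<open>M\<close>, and its
  endomorphisms are endomorphisms of \<open>P\<close>.\<close>

lemma rep_act_subrep:
  assumes x: "x \<in> V" and y: "y \<in> V" and a: "a \<in> carrier (arrow S y x)" and m: "m \<in> P x"
  shows "rep_act S (subrep S M P) y x a m = rep_act S M y x a m"
proof -
  have F: "frag_of (a, m) \<in> carrier (tensor_free (arrow S y x) ((rmod M x)\<lparr>carrier := P x\<rparr>))"
    using a m by simp
  show ?thesis
    unfolding rep_act_def rmap_subrep rmod_subrep
      tensor_map_class[OF bimodule_arrow[OF x y] left_module_subrep[OF x] bimodule_arrow[OF x y]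
        left_module_rmod[OF x] inclusion_compatible[OF x] F] by simp
qed

lemma representation_subrep: "representation S (subrep S M P)"
  unfolding representation_def
proof (intro conjI ballI)
  fix x assume "x \<in> V"
  then show "left_module (vring S x) (rmod (subrep S M P) x)"
    using left_module_subrep by simp
next
  fix x y assume x: "x \<in> V" and y: "y \<in> V"
  let ?N = "(rmod M x)\<lparr>carrier := P x\<rparr>"
  let ?A = "arrow S y x"
  let ?R = "vring S x"
  let ?i = "tensor_map ?R ?A ?N ?A (rmod M x) (\<lambda>a. a) (\<lambda>m. m)"
  note A = bimodule_arrow[OF x y]
  note N = left_module_subrep[OF x] and X = left_module_rmod[OF x]
  note i = inclusion_compatible[OF x, of ?A]
  note i_hom = tensor_map_hom[OF A N A X i]
  have comp: "(\<lambda>t. rmap M y x (?i t)) \<in> hom (add_monoid (ten ?N y x)) (add_monoid (rmod M y))"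
    using hom_compose[OF i_hom left_module_hom_hom[OF rmap_hom[OF x y]]] by (simp add: o_def)
  interpret A: bimodule "vring S y" ?R ?A by (rule A)
  show "rmap (subrep S M P) y x \<in>
      left_module_hom (vring S y) (ten (rmod (subrep S M P) x) y x) (rmod (subrep S M P) y)"
    unfolding rmod_subrep
  proof (rule left_module_homI)
    fix t assume t: "t \<in> carrier (ten ?N y x)"
    have "rmap M y x (?i t) \<in> P y"
    proof (rule tensor_hom_range[OF A N abelian_group_rmod[OF y] comp _ _ _ t])
      fix a m assume am: "a \<in> carrier ?A" "m \<in> carrier ?N"
      then have "rep_act S (subrep S M P) y x a m \<in> P y"
        using rep_act_subrep[OF x y] sub_op[OF P x y act_in_ops] by simp
      then show "rmap M y x (?i (tensor_class ?R ?A ?N (frag_of (a, m)))) \<in> P y"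
        unfolding rep_act_def rmap_subrep rmod_subrep .
    qed (use sub_zero[OF P y] sub_diff[OF P y] in auto)
    then show "rmap (subrep S M P) y x t \<in> carrier ((rmod M y)\<lparr>carrier := P y\<rparr>)"
      unfolding rmap_subrep by simp
    fix r assume r: "r \<in> carrier (vring S y)"
    note s = tensor_compatible_smult[OF A r]
    \<comment> \<open>Multiplication by \<open>r\<close> and the inclusion act on different tensor
      factors; both orders of composition give the same tensor map.\<close>
    have "?i (r \<odot>\<^bsub>ten ?N y x\<^esub> t) = r \<odot>\<^bsub>ten (rmod M x) y x\<^esub> ?i t"
      using tensor_map_comp[OF A N A N A X s i t] tensor_map_comp[OF A N A X A X i s t]
      by (simp add: tensor_def Let_def)
    moreover have "?i t \<in> carrier (ten (rmod M x) y x)"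
      using hom_in_carrier[OF i_hom] t by simp
    ultimately show "rmap (subrep S M P) y x (r \<odot>\<^bsub>ten ?N y x\<^esub> t) =
        r \<odot>\<^bsub>(rmod M y)\<lparr>carrier := P y\<rparr>\<^esub> rmap (subrep S M P) y x t"
      unfolding rmap_subrep using left_module_hom_smult[OF rmap_hom[OF x y] r] by simp
  next
    fix t u assume "t \<in> carrier (ten ?N y x)" "u \<in> carrier (ten ?N y x)"
    then show "rmap (subrep S M P) y x (t \<oplus>\<^bsub>ten ?N y x\<^esub> u) =
        rmap (subrep S M P) y x t \<oplus>\<^bsub>(rmod M y)\<lparr>carrier := P y\<rparr>\<^esub> rmap (subrep S M P) y x u"
      unfolding rmap_subrep using hom_mult[OF comp, of t u] by simp
  qed
qed

lemma species_rep_subrep: "species_rep S (subrep S M P)"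
  by unfold_locales (rule representation_subrep)

lemma endo_subrep:
  assumes f: "op_family.endo V (rmod (subrep S M P)) (rep_ops S (subrep S M P)) P f"
  shows "endo P f"
proof -
  interpret N: species_rep S "subrep S M P" by (rule species_rep_subrep)
  show ?thesis
    using f unfolding N.endo_iff endo_iff
    by (simp add: rep_act_subrep)
qed

text \<open>Negatives are defined relative to the carrier, so shrinking it could change them. The
  difference is pinned down by the addition instead, which the two modules share.\<close>

lemma diff_subrep:
  assumes "x \<in> V" "m \<in> P x" "n \<in> P x"
  shows "m \<ominus>\<^bsub>rmod (subrep S M P) x\<^esub> n = m \<ominus>\<^bsub>rmod M x\<^esub> n"
proof -
  interpret N: species_rep S "subrep S M P" by (rule species_rep_subrep)
  let ?d = "m \<ominus>\<^bsub>rmod (subrep S M P) x\<^esub> n"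
  have "?d \<in> P x" "?d \<oplus>\<^bsub>rmod M x\<^esub> n = m"
    using N.diff_closed[OF assms(1), of m n] N.diff_add_cancel[OF assms(1), of m n] assms by auto
  then show ?thesis
    using diff_eq_iff[of x m n ?d] sub_carrier[OF P] assms by simp
qed

lemma strongly_indecomposable_subrep:
  assumes nz: "\<exists>x\<in>V. P x \<noteq> {\<zero>\<^bsub>rmod M x\<^esub>}"
    and bij: "\<And>f. endo P f \<Longrightarrow> (\<forall>x\<in>V. bij_betw (f x) (P x) (P x)) \<or>
      (\<forall>x\<in>V. bij_betw (\<lambda>m. m \<ominus>\<^bsub>rmod M x\<^esub> f x m) (P x) (P x))"
  shows "strongly_indecomposable S (subrep S M P)"
proof -
  interpret N: species_rep S "subrep S M P" by (rule species_rep_subrep)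
  show ?thesis
  proof (rule N.strongly_indecomposableI)
    show "\<exists>x\<in>V. N.whole x \<noteq> {\<zero>\<^bsub>rmod (subrep S M P) x\<^esub>}"
      using nz by simp
    fix f assume "N.endo N.whole f"
    then have f: "endo P f" using endo_subrep by simp
    have "bij_betw (\<lambda>m. m \<ominus>\<^bsub>rmod (subrep S M P) x\<^esub> f x m) (P x) (P x) \<longleftrightarrow>
        bij_betw (\<lambda>m. m \<ominus>\<^bsub>rmod M x\<^esub> f x m) (P x) (P x)" if "x \<in> V" for x
      using that diff_subrep endo_closed[OF f] by (intro bij_betw_cong) blast
    then show "(\<forall>x\<in>V. bij_betw (f x) (N.whole x) (N.whole x)) \<or>
        (\<forall>x\<in>V. bij_betw (\<lambda>m. m \<ominus>\<^bsub>rmod (subrep S M P) x\<^esub> f x m) (N.whole x) (N.whole x))"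
      using bij[OF f] by simp
  qed
qed

end

text \<open>The structure maps of \<open>N\<close> are determined by those of \<open>M\<close> through the bijection, so the inverse
  commutes with them by functoriality of the tensor product.\<close>

lemma rep_isomorphicI:
  assumes N: "\<And>x. x \<in> V \<Longrightarrow> left_module (vring S x) (rmod N x)"
    and f: "f \<in> rep_hom S M N"
    and bij: "\<And>x. x \<in> V \<Longrightarrow> bij_betw (f x) (carrier (rmod M x)) (carrier (rmod N x))"
  shows "rep_isomorphic S M N"
proof -
  define g where "g = (\<lambda>x\<in>V. \<lambda>n\<in>carrier (rmod N x). inv_into (carrier (rmod M x)) (f x) n)"
  have lin: "f x \<in> left_module_hom (vring S x) (rmod M x) (rmod N x)" if "x \<in> V" for x
    using f that unfolding rep_hom_def by blast
  have gc: "g x n \<in> carrier (rmod M x)" and fg: "f x (g x n) = n"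
    if "x \<in> V" "n \<in> carrier (rmod N x)" for x n
    using bij[OF that(1)] that unfolding g_def
    by (auto simp: bij_betw_def inv_into_into f_inv_into_f)
  have fc: "f x m \<in> carrier (rmod N x)" and gf: "g x (f x m) = m"
    if "x \<in> V" "m \<in> carrier (rmod M x)" for x m
    using bij[OF that(1)] that unfolding g_def
    by (auto simp: bij_betw_def inv_into_f_f)
  have eqI: "m = m'" if "x \<in> V" "m \<in> carrier (rmod M x)" "m' \<in> carrier (rmod M x)" "f x m = f x m'" for x m m'
    using gf that by metis
  have g_lin: "g x \<in> left_module_hom (vring S x) (rmod N x) (rmod M x)" if x: "x \<in> V" for x
  proof (rule left_module_homI)
    interpret M: left_module "vring S x" "rmod M x" by (rule left_module_rmod) fact
    interpret N: left_module "vring S x" "rmod N x" by (rule N) fact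
    fix n assume n: "n \<in> carrier (rmod N x)"
    show "g x n \<in> carrier (rmod M x)" using gc x n .
    show "g x (n \<oplus>\<^bsub>rmod N x\<^esub> n') = g x n \<oplus>\<^bsub>rmod M x\<^esub> g x n'" if n': "n' \<in> carrier (rmod N x)" for n'
      using x n n' by (intro eqI[OF x]) (simp_all add: gc fg left_module_hom_add[OF lin[OF x]])
    show "g x (r \<odot>\<^bsub>rmod N x\<^esub> n) = r \<odot>\<^bsub>rmod M x\<^esub> g x n" if r: "r \<in> carrier (vring S x)" for r
      using x n r N.smult_closed[OF r n] M.smult_closed[OF r gc[OF x n]]
      by (intro eqI[OF x]) (simp_all add: gc fg left_module_hom_smult[OF lin[OF x]])
  qed
  have "g \<in> rep_hom S N M"
    unfolding rep_hom_def
  proof (intro CollectI conjI ballI)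
    show "g \<in> (\<Pi>\<^sub>E x\<in>V. left_module_hom (vring S x) (rmod N x) (rmod M x) \<inter> extensional (carrier (rmod N x)))"
      using g_lin by (auto simp: g_def)
    fix x y t assume x: "x \<in> V" and y: "y \<in> V" and t: "t \<in> carrier (ten (rmod N x) y x)"
    note A = bimodule_arrow[OF x y] and X = left_module_rmod[OF x] and Y = N[OF x]
    note cg = tensor_compatible_id_left[OF g_lin[OF x], of "arrow S y x"]
    note cf = tensor_compatible_id_left[OF lin[OF x], of "arrow S y x"]
    define s where "s = tensor_map (vring S x) (arrow S y x) (rmod N x) (arrow S y x) (rmod M x) (\<lambda>a. a) (g x) t"
    have s: "s \<in> carrier (ten (rmod M x) y x)"
      unfolding s_def using hom_in_carrier[OF tensor_map_hom[OF A Y A X cg]] t by simp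
    have "tensor_map (vring S x) (arrow S y x) (rmod M x) (arrow S y x) (rmod N x) (\<lambda>a. a) (f x) s =
        tensor_map (vring S x) (arrow S y x) (rmod N x) (arrow S y x) (rmod N x) (\<lambda>a. a) (\<lambda>m. f x (g x m)) t"
      unfolding s_def by (rule tensor_map_comp[OF A Y A X A Y cg cf t])
    also have "\<dots> = t"
      by (subst tensor_map_cong[OF A Y t, of "\<lambda>a. a" "\<lambda>a. a" "\<lambda>m. f x (g x m)" "\<lambda>m. m"])
        (simp_all add: fg x tensor_map_id[OF A Y t])
    \<comment> \<open>Compatibility of \<open>f\<close> is used at \<open>s\<close>, whose image
      under the tensor map of \<open>f x\<close> is \<open>t\<close>; applying \<open>g y\<close>
      then gives compatibility of \<open>g\<close>.\<close>
    finally have "f y (rmap M y x s) = rmap N y x t"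
      using f x y s unfolding rep_hom_def by force
    then show "rmap M y x s = g y (rmap N y x t)"
      using gf[OF y left_module_hom_closed[OF rmap_hom[OF x y] s]] by simp
  qed
  moreover have "rep_comp S M g f = rep_id S M" "rep_comp S N f g = rep_id S N"
    unfolding rep_comp_def rep_id_def compose_def using gf fg by (auto intro!: restrict_ext)
  ultimately show ?thesis
    unfolding rep_isomorphic_def using f by blast
qed

end

section \<open>Direct sums of modules and of representations\<close>

lemma left_module_direct_sum:
  assumes R: "ring R" and N: "\<And>i. i \<in> I \<Longrightarrow> left_module R (N i)"
  shows "left_module R (module_direct_sum I N)"
proof -
  let ?D = "module_direct_sum I N"
  have ab: "abelian_group (N i)" if "i \<in> I" for i
    using N[OF that] left_module.axioms by blast
  note ag = abelian_groupE[OF ab]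
  have smult_zero: "r \<odot>\<^bsub>N i\<^esub> \<zero>\<^bsub>N i\<^esub> = \<zero>\<^bsub>N i\<^esub>" if i: "i \<in> I" and r: "r \<in> carrier R" for i r
  proof -
    interpret left_module R "N i" by (rule N) fact
    have "r \<odot>\<^bsub>N i\<^esub> \<zero>\<^bsub>N i\<^esub> = r \<odot>\<^bsub>N i\<^esub> \<zero>\<^bsub>N i\<^esub> \<oplus>\<^bsub>N i\<^esub> r \<odot>\<^bsub>N i\<^esub> \<zero>\<^bsub>N i\<^esub>"
      using smult_r_distr[OF r M.zero_closed M.zero_closed] by simp
    then show ?thesis
      using smult_closed[OF r M.zero_closed] by (metis M.add.l_cancel_one')
  qed
  have neg_zero: "\<ominus>\<^bsub>N i\<^esub> \<zero>\<^bsub>N i\<^esub> = \<zero>\<^bsub>N i\<^esub>" if "i \<in> I" for i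
  proof -
    interpret abelian_group "N i" by (rule ab) fact
    show ?thesis using r_neg[OF zero_closed] by simp
  qed
  have c: "carrier ?D = {v \<in> \<Pi>\<^sub>E i\<in>I. carrier (N i). finite {i \<in> I. v i \<noteq> \<zero>\<^bsub>N i\<^esub>}}"
    and add: "v \<oplus>\<^bsub>?D\<^esub> w = (\<lambda>i\<in>I. v i \<oplus>\<^bsub>N i\<^esub> w i)"
    and zero: "\<zero>\<^bsub>?D\<^esub> = (\<lambda>i\<in>I. \<zero>\<^bsub>N i\<^esub>)"
    and smult: "r \<odot>\<^bsub>?D\<^esub> v = (\<lambda>i\<in>I. r \<odot>\<^bsub>N i\<^esub> v i)" for v w r
    unfolding module_direct_sum_def by simp_all
  have app: "v i \<in> carrier (N i)" if "v \<in> carrier ?D" "i \<in> I" for v i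
    using that unfolding c by auto
  have eqI: "v = w" if "v \<in> carrier ?D" "w \<in> carrier ?D" "\<And>i. i \<in> I \<Longrightarrow> v i = w i" for v w
    using that unfolding c by (auto intro: PiE_ext)
  have add_closed: "v \<oplus>\<^bsub>?D\<^esub> w \<in> carrier ?D" if v: "v \<in> carrier ?D" and w: "w \<in> carrier ?D" for v w
  proof -
    have "{i \<in> I. v i \<oplus>\<^bsub>N i\<^esub> w i \<noteq> \<zero>\<^bsub>N i\<^esub>} \<subseteq> {i \<in> I. v i \<noteq> \<zero>\<^bsub>N i\<^esub>} \<union> {i \<in> I. w i \<noteq> \<zero>\<^bsub>N i\<^esub>}"
      using ag(2,5) by auto
    moreover have "finite ({i \<in> I. v i \<noteq> \<zero>\<^bsub>N i\<^esub>} \<union> {i \<in> I. w i \<noteq> \<zero>\<^bsub>N i\<^esub>})"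
      using v w unfolding c by simp
    ultimately have "finite {i \<in> I. v i \<oplus>\<^bsub>N i\<^esub> w i \<noteq> \<zero>\<^bsub>N i\<^esub>}" by (rule finite_subset)
    then show ?thesis
      using app[OF v] app[OF w] ag(1) unfolding c add by (auto cong: conj_cong)
  qed
  have smult_closed: "r \<odot>\<^bsub>?D\<^esub> v \<in> carrier ?D" if r: "r \<in> carrier R" and v: "v \<in> carrier ?D" for r v
  proof -
    have "{i \<in> I. r \<odot>\<^bsub>N i\<^esub> v i \<noteq> \<zero>\<^bsub>N i\<^esub>} \<subseteq> {i \<in> I. v i \<noteq> \<zero>\<^bsub>N i\<^esub>}"
      using smult_zero[OF _ r] by auto
    moreover have "finite {i \<in> I. v i \<noteq> \<zero>\<^bsub>N i\<^esub>}" using v unfolding c by simp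
    ultimately have "finite {i \<in> I. r \<odot>\<^bsub>N i\<^esub> v i \<noteq> \<zero>\<^bsub>N i\<^esub>}" by (rule finite_subset)
    then show ?thesis
      using app[OF v] left_module.smult_closed[OF N r] unfolding c smult by (auto cong: conj_cong)
  qed
  have zero_closed: "\<zero>\<^bsub>?D\<^esub> \<in> carrier ?D"
    using ag(2) unfolding c zero by (auto cong: conj_cong)
  have "abelian_group ?D"
  proof (rule abelian_groupI)
    fix u v w assume u: "u \<in> carrier ?D" and v: "v \<in> carrier ?D" and w: "w \<in> carrier ?D"
    show "u \<oplus>\<^bsub>?D\<^esub> v \<oplus>\<^bsub>?D\<^esub> w = u \<oplus>\<^bsub>?D\<^esub> (v \<oplus>\<^bsub>?D\<^esub> w)"
      by (rule eqI) (simp_all add: add_closed u v w, simp add: add app u v w ag(3))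
    show "u \<oplus>\<^bsub>?D\<^esub> v = v \<oplus>\<^bsub>?D\<^esub> u"
      by (rule eqI) (simp_all add: add_closed u v, simp add: add app u v ag(4))
    show "\<zero>\<^bsub>?D\<^esub> \<oplus>\<^bsub>?D\<^esub> u = u"
      by (rule eqI) (simp_all add: add_closed zero_closed u, simp add: add zero app u ag(5))
    show "u \<oplus>\<^bsub>?D\<^esub> v \<in> carrier ?D" by (rule add_closed) fact+
    let ?n = "\<lambda>i\<in>I. \<ominus>\<^bsub>N i\<^esub> u i"
    have "{i \<in> I. \<ominus>\<^bsub>N i\<^esub> u i \<noteq> \<zero>\<^bsub>N i\<^esub>} \<subseteq> {i \<in> I. u i \<noteq> \<zero>\<^bsub>N i\<^esub>}"
      using neg_zero by auto
    moreover have "finite {i \<in> I. u i \<noteq> \<zero>\<^bsub>N i\<^esub>}" using u unfolding c by simp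
    ultimately have "finite {i \<in> I. \<ominus>\<^bsub>N i\<^esub> u i \<noteq> \<zero>\<^bsub>N i\<^esub>}" by (rule finite_subset)
    then have n: "?n \<in> carrier ?D"
      using app[OF u] abelian_group.a_inv_closed[OF ab] unfolding c by (auto cong: conj_cong)
    have "?n \<oplus>\<^bsub>?D\<^esub> u = \<zero>\<^bsub>?D\<^esub>"
      by (rule eqI[OF add_closed[OF n u] zero_closed])
        (simp add: add zero app u abelian_group.l_neg[OF ab])
    then show "\<exists>n\<in>carrier ?D. n \<oplus>\<^bsub>?D\<^esub> u = \<zero>\<^bsub>?D\<^esub>" using n by blast
  qed (rule zero_closed)
  moreover have "left_module_axioms R ?D"
  proof (rule left_module_axioms.intro)
    interpret R: ring R by fact
    show "\<one>\<^bsub>R\<^esub> \<odot>\<^bsub>?D\<^esub> v = v" if v: "v \<in> carrier ?D" for v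
      by (rule eqI) (simp_all add: smult_closed v, simp add: smult app v left_module.smult_one[OF N])
    fix r s v w
    assume r: "r \<in> carrier R" and v: "v \<in> carrier ?D"
    show "r \<odot>\<^bsub>?D\<^esub> v \<in> carrier ?D" by (rule smult_closed) fact+
    show "r \<odot>\<^bsub>?D\<^esub> (v \<oplus>\<^bsub>?D\<^esub> w) = r \<odot>\<^bsub>?D\<^esub> v \<oplus>\<^bsub>?D\<^esub> r \<odot>\<^bsub>?D\<^esub> w" if w: "w \<in> carrier ?D"
      by (rule eqI) (simp_all add: smult_closed add_closed r v w,
        simp add: smult add app r v w left_module.smult_r_distr[OF N])
    assume s: "s \<in> carrier R"
    show "(r \<oplus>\<^bsub>R\<^esub> s) \<odot>\<^bsub>?D\<^esub> v = r \<odot>\<^bsub>?D\<^esub> v \<oplus>\<^bsub>?D\<^esub> s \<odot>\<^bsub>?D\<^esub> v"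
      by (rule eqI) (simp_all add: smult_closed add_closed r s v,
        simp add: smult add app r s v left_module.smult_l_distr[OF N])
    show "(r \<otimes>\<^bsub>R\<^esub> s) \<odot>\<^bsub>?D\<^esub> v = r \<odot>\<^bsub>?D\<^esub> (s \<odot>\<^bsub>?D\<^esub> v)"
      by (rule eqI) (simp_all add: smult_closed r s v,
        simp add: smult app r s v left_module.smult_assoc[OF N])
  qed
  ultimately show ?thesis using R by (intro left_module.intro)
qed

lemma direct_sum_proj_hom:
  "i \<in> I \<Longrightarrow> (\<lambda>v. v i) \<in> left_module_hom R (module_direct_sum I N) (N i)"
  by (rule left_module_homI) (auto simp: module_direct_sum_def)

text \<open>The isomorphism collects the components \<open>p P x m\<close>: \<open>fin\<close>
  places them in the direct sum, \<open>inj\<close> and \<open>surj\<close> give bijectivity, and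
  \<open>rep_isomorphicI\<close> supplies the inverse morphism.\<close>

lemma (in species_rep) direct_sum_isomorphic:
  assumes sub: "\<And>P. P \<in> I \<Longrightarrow> sub P"
    and p: "\<And>P. P \<in> I \<Longrightarrow> endo whole (p P)"
    and range: "\<And>P x m. \<lbrakk>P \<in> I; x \<in> V; m \<in> carrier (rmod M x)\<rbrakk> \<Longrightarrow> p P x m \<in> P x"
    and fin: "\<And>x m. \<lbrakk>x \<in> V; m \<in> carrier (rmod M x)\<rbrakk> \<Longrightarrow> finite {P \<in> I. p P x m \<noteq> \<zero>\<^bsub>rmod M x\<^esub>}"
    and inj: "\<And>x m. \<lbrakk>x \<in> V; m \<in> carrier (rmod M x); \<And>P. P \<in> I \<Longrightarrow> p P x m = \<zero>\<^bsub>rmod M x\<^esub>\<rbrakk> \<Longrightarrow>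
      m = \<zero>\<^bsub>rmod M x\<^esub>"
    and surj: "\<And>x w. \<lbrakk>x \<in> V; \<And>P. P \<in> I \<Longrightarrow> w P \<in> P x; finite {P \<in> I. w P \<noteq> \<zero>\<^bsub>rmod M x\<^esub>}\<rbrakk> \<Longrightarrow>
      \<exists>m\<in>carrier (rmod M x). \<forall>P\<in>I. p P x m = w P"
  shows "rep_isomorphic S M (rep_direct_sum S I (subrep S M))"
proof -
  let ?N = "rep_direct_sum S I (subrep S M)"
  define f where "f = (\<lambda>x\<in>V. \<lambda>m\<in>carrier (rmod M x). \<lambda>P\<in>I. p P x m)"
  have N: "rmod ?N x = module_direct_sum I (\<lambda>P. (rmod M x)\<lparr>carrier := P x\<rparr>)" for x
    unfolding rep_direct_sum_def by simp
  have D: "left_module (vring S x) (rmod ?N x)" if x: "x \<in> V" for x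
    unfolding N using x by (intro left_module_direct_sum ring_vring left_module_subrep sub)
  have lin: "f x \<in> left_module_hom (vring S x) (rmod M x) (rmod ?N x)" if x: "x \<in> V" for x
  proof (rule left_module_homI)
    interpret M: left_module "vring S x" "rmod M x" by (rule left_module_rmod) fact
    fix m assume m: "m \<in> carrier (rmod M x)"
    show "f x m \<in> carrier (rmod ?N x)"
      unfolding N using x m range fin by (simp add: f_def module_direct_sum_def cong: conj_cong)
    show "f x (m \<oplus>\<^bsub>rmod M x\<^esub> n) = f x m \<oplus>\<^bsub>rmod ?N x\<^esub> f x n" if n: "n \<in> carrier (rmod M x)" for n
      unfolding N using x m n endo_add[OF p x m n]
      by (simp add: f_def module_direct_sum_def cong: restrict_cong)
    show "f x (r \<odot>\<^bsub>rmod M x\<^esub> m) = r \<odot>\<^bsub>rmod ?N x\<^esub> f x m" if r: "r \<in> carrier (vring S x)" for r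
      unfolding N using x m r M.smult_closed[OF r m] endo_op[OF p x x smult_in_ops[OF r] m]
      by (simp add: f_def module_direct_sum_def cong: restrict_cong)
  qed
  have "f \<in> rep_hom S M ?N"
    unfolding rep_hom_def
  proof (intro CollectI conjI ballI)
    show "f \<in> (\<Pi>\<^sub>E x\<in>V. left_module_hom (vring S x) (rmod M x) (rmod ?N x) \<inter> extensional (carrier (rmod M x)))"
      using lin by (auto simp: f_def)
    fix x y t assume x: "x \<in> V" and y: "y \<in> V" and t: "t \<in> carrier (ten (rmod M x) y x)"
    let ?R = "vring S x" and ?A = "arrow S y x"
    note A = bimodule_arrow[OF x y] and X = left_module_rmod[OF x] and DX = D[OF x]
    note cf = tensor_compatible_id_left[OF lin[OF x], of ?A]
    define s where "s = tensor_map ?R ?A (rmod M x) ?A (rmod ?N x) (\<lambda>a. a) (f x) t"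
    have rt: "rmap M y x t \<in> carrier (rmod M y)"
      using left_module_hom_closed[OF rmap_hom[OF x y] t] .
    have "rmap (subrep S M P) y x (tensor_map ?R ?A (rmod ?N x) ?A (rmod (subrep S M P) x) (\<lambda>a. a) (\<lambda>v. v P) s) =
        p P y (rmap M y x t)" if P: "P \<in> I" for P
    proof -
      let ?P = "(rmod M x)\<lparr>carrier := P x\<rparr>"
      note LP = left_module_subrep[OF sub[OF P] x]
      have pr: "(\<lambda>v. v P) \<in> left_module_hom ?R (rmod ?N x) ?P"
        unfolding N by (rule direct_sum_proj_hom[OF P])
      note cp = tensor_compatible_id_left[OF pr, of ?A]
      note ci = inclusion_compatible[OF sub[OF P] x, of ?A]
      have pf: "(\<lambda>m. f x m P) \<in> left_module_hom ?R (rmod M x) ?P"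
        using pr lin[OF x] unfolding left_module_hom_def hom_def by (auto simp: Pi_iff)
      note cpf = tensor_compatible_id_left[OF pf, of ?A]
      \<comment> \<open>The map \<open>f\<close>, the projection to \<open>P\<close> and the
        inclusion of \<open>P\<close> compose to \<open>p P\<close>. Functoriality carries this
        through the tensor product and leaves naturality of \<open>rmap\<close> for the endomorphism
        \<open>p P\<close>.\<close>
      have "tensor_map ?R ?A (rmod ?N x) ?A ?P (\<lambda>a. a) (\<lambda>v. v P) s =
          tensor_map ?R ?A (rmod M x) ?A ?P (\<lambda>a. a) (\<lambda>m. f x m P) t"
        unfolding s_def by (rule tensor_map_comp[OF A X A DX A LP cf cp t])
      then have "rmap (subrep S M P) y x (tensor_map ?R ?A (rmod ?N x) ?A ?P (\<lambda>a. a) (\<lambda>v. v P) s) =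
          rmap M y x (tensor_map ?R ?A (rmod M x) ?A (rmod M x) (\<lambda>a. a) (\<lambda>m. f x m P) t)"
        unfolding rmap_subrep using tensor_map_comp[OF A X A LP A X cpf ci t] by simp
      also have "\<dots> = rmap M y x (tensor_map ?R ?A (rmod M x) ?A (rmod M x) (\<lambda>a. a) (p P x) t)"
        using P x by (subst tensor_map_cong[OF A X t, of "\<lambda>a. a" "\<lambda>a. a" "\<lambda>m. f x m P" "p P x"])
          (auto simp: f_def)
      also have "\<dots> = p P y (rmap M y x t)"
        by (rule rmap_natural[OF p[OF P] x y t])
      finally show ?thesis by simp
    qed
    then have "rmap ?N y x s = (\<lambda>P\<in>I. p P y (rmap M y x t))"
      unfolding rep_direct_sum_def by (simp cong: restrict_cong)
    then show "rmap ?N y x s = f y (rmap M y x t)"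
      using y rt by (simp add: f_def)
  qed
  moreover have "bij_betw (f x) (carrier (rmod M x)) (carrier (rmod ?N x))" if x: "x \<in> V" for x
    unfolding bij_betw_def
  proof
    show "inj_on (f x) (carrier (rmod M x))"
    proof (rule inj_onI)
      fix m n assume m: "m \<in> carrier (rmod M x)" and n: "n \<in> carrier (rmod M x)" and eq: "f x m = f x n"
      have "p P x (m \<ominus>\<^bsub>rmod M x\<^esub> n) = \<zero>\<^bsub>rmod M x\<^esub>" if P: "P \<in> I" for P
      proof -
        have "p P x m = p P x n"
          using fun_cong[OF eq, of P] P x m n by (simp add: f_def)
        then show ?thesis
          using endo_diff[OF sub_whole p[OF P] x m n] diff_self[OF x endo_closed[OF p[OF P] x n]] by simp
      qed
      then show "m = n"
        using inj[OF x diff_closed[OF x m n]] diff_eq_zero_iff[OF x m n] by blast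
    qed
    show "f x ` carrier (rmod M x) = carrier (rmod ?N x)"
    proof
      show "f x ` carrier (rmod M x) \<subseteq> carrier (rmod ?N x)"
        using left_module_hom_closed[OF lin[OF x]] by blast
      show "carrier (rmod ?N x) \<subseteq> f x ` carrier (rmod M x)"
      proof
        fix w assume "w \<in> carrier (rmod ?N x)"
        then have w: "w \<in> extensional I" "\<And>P. P \<in> I \<Longrightarrow> w P \<in> P x"
          "finite {P \<in> I. w P \<noteq> \<zero>\<^bsub>rmod M x\<^esub>}"
          unfolding N module_direct_sum_def by (auto simp: PiE_iff)
        obtain m where m: "m \<in> carrier (rmod M x)" "\<forall>P\<in>I. p P x m = w P"
          using surj[OF x w(2,3)] by blast
        then have "w = f x m"
          using x w(1) by (auto simp: f_def intro!: extensionalityI[of _ I])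
        then show "w \<in> f x ` carrier (rmod M x)" using m by blast
      qed
    qed
  qed
  ultimately show ?thesis
    using rep_isomorphicI D by blast
qed

theorem lemma3p9:
  fixes S :: "('c, 'r, 'a) species" and M :: "('c, 'r, 'a, 'm) rep"
  assumes "species S" and "representation S M"
    and "\<And>x. x \<in> vertices S \<Longrightarrow> finite_length (vring S x) (rmod M x)"
  shows "\<exists>(I :: ('c \<Rightarrow> 'm set) set) (N :: ('c \<Rightarrow> 'm set) \<Rightarrow> ('c, 'r, 'a, 'm) rep).
    (\<forall>i\<in>I. representation S (N i) \<and> strongly_indecomposable S (N i)) \<and>
    rep_isomorphic S M (rep_direct_sum S I N)"
proof -
  interpret species_rep S M
    using assms by (intro species_rep.intro species_rep_axioms.intro)
  \<comment> \<open>One rank and one bound are chosen per vertex, without any relation between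
    vertices.\<close>
  have "\<exists>rk n. (\<forall>K K'. submodule K (vring S x) (rmod M x) \<and> submodule K' (vring S x) (rmod M x) \<and> K \<subset> K'
      \<longrightarrow> rk K < (rk K' :: nat)) \<and> (\<forall>K. rk K \<le> n)" if x: "x \<in> V" for x
    using left_module.finite_length_rank[OF left_module_rmod[OF x] assms(3)[OF x]] by metis
  then obtain rk :: "'c \<Rightarrow> 'm set \<Rightarrow> nat" and bd where
    rk: "\<And>x K K'. \<lbrakk>x \<in> V; submodule K (vring S x) (rmod M x); submodule K' (vring S x) (rmod M x); K \<subset> K'\<rbrakk>
      \<Longrightarrow> rk x K < rk x K'"
    and bd: "\<And>x K. x \<in> V \<Longrightarrow> rk x K \<le> bd x"
    by metis
  \<comment> \<open>Since the operators contain the scalars, the component of a subfamily at a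
    vertex is a submodule, so the rank of submodules serves as \<open>len\<close>.\<close>
  interpret finite_op_family V "rmod M" "rep_ops S M" rk bd
    by unfold_locales (use rk bd sub_submodule in auto)
  show ?thesis
  proof (rule decomposition)
    fix I p
    assume I: "\<And>P. P \<in> I \<Longrightarrow> sub P" "\<And>P. P \<in> I \<Longrightarrow> \<exists>x\<in>V. P x \<noteq> {\<zero>\<^bsub>rmod M x\<^esub>}"
      "\<And>P. P \<in> I \<Longrightarrow> endo whole (p P)"
      "\<And>P x m. \<lbrakk>P \<in> I; x \<in> V; m \<in> carrier (rmod M x)\<rbrakk> \<Longrightarrow> p P x m \<in> P x"
      "\<And>x m. \<lbrakk>x \<in> V; m \<in> carrier (rmod M x)\<rbrakk> \<Longrightarrow> finite {P \<in> I. p P x m \<noteq> \<zero>\<^bsub>rmod M x\<^esub>}"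
      "\<And>x m. \<lbrakk>x \<in> V; m \<in> carrier (rmod M x); \<And>P. P \<in> I \<Longrightarrow> p P x m = \<zero>\<^bsub>rmod M x\<^esub>\<rbrakk> \<Longrightarrow> m = \<zero>\<^bsub>rmod M x\<^esub>"
      "\<And>x w. \<lbrakk>x \<in> V; \<And>P. P \<in> I \<Longrightarrow> w P \<in> P x; finite {P \<in> I. w P \<noteq> \<zero>\<^bsub>rmod M x\<^esub>}\<rbrakk> \<Longrightarrow>
        \<exists>m\<in>carrier (rmod M x). \<forall>P\<in>I. p P x m = w P"
      "\<And>P f. \<lbrakk>P \<in> I; endo P f\<rbrakk> \<Longrightarrow> (\<forall>x\<in>V. bij_betw (f x) (P x) (P x)) \<or>
        (\<forall>x\<in>V. bij_betw (\<lambda>m. m \<ominus>\<^bsub>rmod M x\<^esub> f x m) (P x) (P x))"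
    have "representation S (subrep S M P) \<and> strongly_indecomposable S (subrep S M P)" if "P \<in> I" for P
      using representation_subrep I(1) strongly_indecomposable_subrep[OF I(1) I(2) I(8)] that by blast
    moreover have "rep_isomorphic S M (rep_direct_sum S I (subrep S M))"
      using direct_sum_isomorphic[OF I(1,3-7)] by blast
    ultimately show ?thesis by blast
  qed
qed

end
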